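(* Let $\mathfrak{s}$ be the Schrödinger Lie algebra. Let $n\in\mathbb{Z}_{\ge 0}$ and $\lambda_2\in\mathbb{C}$, $\lambda_2\neq 0$. Then, in $U(\mathfrak{s})$, \[ \operatorname{Ann}(V(n,\lambda_2))=\operatorname{Ann}(\Delta(n-1,\lambda_2))=\operatorname{Ann}(\Delta(-n-2,\lambda_2)), \] and these annihilators are centrally generated (i.e. generated, as two-sided ideals, by their intersection with the center $Z(\mathfrak{s})$ of $U(\mathfrak{s})$).
   Context: Everything is over $\mathbb{C}$. The Schrödinger Lie algebra $\mathfrak{s}$ has basis $\{e,h,f,p,q,z\}$, where $e,h,f$ satisfy the usual $\mathfrak{sl}_2$-relations, $z$ is central, and $[e,p]=0$, $[h,p]=p$, $[f,p]=q$, $[e,q]=p$, $[h,q]=-q$, $[f,q]=0$, $[p,q]=z$. Verma modules: for $(\lambda_1,\lambda_2)\in\mathbb{C}^2$, $\Delta(\lambda_1,\lambda_2)=U(\mathfrak{s})\otimes_{U(\tilde{\mathfrak{b}})}\mathbb{C}_\lambda$, where $\tilde{\mathfrak{b}}=\mathrm{span}\{h,z,e,p\}$ and on the one-dimensional module $\mathbb{C}_\lambda$ the elements $e,p$ act by $0$, $h$ by $\lambda_1$, $z$ by $\lambda_2$. Completion functor: let $U=U(\mathfrak{s})$, let $U_{(f)}$ be the Ore localization of $U$ at the powers of $f$, and $S_f:=U_{(f)}/U$, a $U$-$U$-bimodule. For an $\mathfrak{s}$-module $M$, $\mathbf{EA}(M)$ is the submodule of $S_f\otimes_U M$ consisting of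 all $m$ with $\dim\mathbb{C}[e]m<\infty$. For $n\ge 0$ and $\lambda_2\neq 0$, $V(n,\lambda_2):=\mathbf{EA}(\Delta(n-1,\lambda_2))$. *)

theory Defs
  imports Complex_Main "HOL-Library.Poly_Mapping" "HOL-Algebra.Module"
begin

section \<open>Two-sided ideals, center\<close>

definition two_sided_ideal :: "'a::ring_1 set \<Rightarrow> bool" where
  "two_sided_ideal I \<longleftrightarrow>
     0 \<in> I \<and> (\<forall>x\<in>I. \<forall>y\<in>I. x + y \<in> I) \<and> (\<forall>x\<in>I. \<forall>r. r * x \<in> I \<and> x * r \<in> I)"

definition ideal_gen :: "'a::ring_1 set \<Rightarrow> 'a set" where
  "ideal_gen S = \<Inter>{I. two_sided_ideal I \<and> S \<subseteq> I}"

definition ring_center :: "'a::ring_1 set" where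
  "ring_center = {c. \<forall>x. c * x = x * c}"

definition centrally_generated :: "'a::ring_1 set \<Rightarrow> bool" where
  "centrally_generated I \<longleftrightarrow> I = ideal_gen (I \<inter> ring_center)"

lemma two_sided_ideal_ideal_gen: "two_sided_ideal (ideal_gen S)"
  unfolding ideal_gen_def two_sided_ideal_def by blast

lemma ideal_gen_subset: "S \<subseteq> ideal_gen S"
  unfolding ideal_gen_def by blast

lemma ideal_gen_least: "two_sided_ideal I \<Longrightarrow> S \<subseteq> I \<Longrightarrow> ideal_gen S \<subseteq> I"
  unfolding ideal_gen_def by blast

lemma two_sided_idealD:
  assumes "two_sided_ideal I"
  shows "0 \<in> I" "x \<in> I \<Longrightarrow> y \<in> I \<Longrightarrow> x + y \<in> I" "x \<in> I \<Longrightarrow> r * x \<in> I" "x \<in> I \<Longrightarrow> x * r \<in> I"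
    "x \<in> I \<Longrightarrow> - x \<in> I" "x \<in> I \<Longrightarrow> y \<in> I \<Longrightarrow> x - y \<in> I"
proof -
  show *: "0 \<in> I" "\<And>x y. x \<in> I \<Longrightarrow> y \<in> I \<Longrightarrow> x + y \<in> I" "\<And>x r. x \<in> I \<Longrightarrow> r * x \<in> I"
    "\<And>x r. x \<in> I \<Longrightarrow> x * r \<in> I"
    using assms unfolding two_sided_ideal_def by auto
  show **: "\<And>x. x \<in> I \<Longrightarrow> - x \<in> I"
    using *(3)[of _ "- 1"] by simp
  show "x \<in> I \<Longrightarrow> y \<in> I \<Longrightarrow> x - y \<in> I"
    using *(2)[of x "- y"] **[of y] by simp
qed


section \<open>Complex Lie algebras and their universal enveloping algebras\<close>

class lie_algebra = ab_group_add +
  fixes lscale :: "complex \<Rightarrow> 'a \<Rightarrow> 'a"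
    and lbr :: "'a \<Rightarrow> 'a \<Rightarrow> 'a"
  assumes lscale_add_right: "lscale c (x + y) = lscale c x + lscale c y"
    and lscale_add_left: "lscale (c + d) x = lscale c x + lscale d x"
    and lscale_lscale: "lscale c (lscale d x) = lscale (c * d) x"
    and lscale_one: "lscale 1 x = x"
    and lbr_add_left: "lbr (x + y) w = lbr x w + lbr y w"
    and lbr_add_right: "lbr w (x + y) = lbr w x + lbr w y"
    and lbr_scale_left: "lbr (lscale c x) y = lscale c (lbr x y)"
    and lbr_scale_right: "lbr x (lscale c y) = lscale c (lbr x y)"
    and lbr_alternating: "lbr x x = 0"
    and jacobi: "lbr x (lbr y w) + lbr y (lbr w x) + lbr w (lbr x y) = 0"

text \<open>Noncommutative words; with concatenation as the monoid operation, the convolution algebra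
  \<open>'g word \<Rightarrow>\<^sub>0 complex\<close> is the free associative unital algebra on the set \<open>'g\<close>.\<close>

datatype 'g word = Word (letters: "'g list")

instantiation word :: (type) monoid_add
begin

definition zero_word :: "'a word" where "0 = Word []"
definition plus_word :: "'a word \<Rightarrow> 'a word \<Rightarrow> 'a word" where
  "v + w = Word (letters v @ letters w)"

instance
  by standard (simp_all add: zero_word_def plus_word_def)

end

type_synonym 'g free_alg = "'g word \<Rightarrow>\<^sub>0 complex"

definition free_scalar :: "complex \<Rightarrow> 'g free_alg" where
  "free_scalar c = Poly_Mapping.single 0 c"

definition free_gen :: "'g \<Rightarrow> 'g free_alg" where
  "free_gen x = Poly_Mapping.single (Word [x]) 1"

text \<open>The first two families make the generators depend linearly on elements of the Lie algebra,
  so that dividing by them gives the tensor algebra.\<close>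

definition uea_relations :: "'g::lie_algebra free_alg set" where
  "uea_relations =
     {free_gen (x + y) - free_gen x - free_gen y | x y. True} \<union>
     {free_gen (lscale c x) - free_scalar c * free_gen x | c x. True} \<union>
     {free_gen x * free_gen y - free_gen y * free_gen x - free_gen (lbr x y) | x y. True}"

definition uea_rel :: "'g::lie_algebra free_alg \<Rightarrow> 'g free_alg \<Rightarrow> bool" where
  "uea_rel a b \<longleftrightarrow> a - b \<in> ideal_gen uea_relations"

lemma equivp_mod_ideal:
  assumes "two_sided_ideal I"
  shows "equivp (\<lambda>a b. a - b \<in> I)"
proof (rule equivpI)
  note I = two_sided_idealD[OF assms]
  show "reflp (\<lambda>a b. a - b \<in> I)" using I(1) by (simp add: reflp_def)
  show "symp (\<lambda>a b. a - b \<in> I)"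
  proof (rule sympI)
    fix a b assume "a - b \<in> I"
    from I(5)[OF this] show "b - a \<in> I" by simp
  qed
  show "transp (\<lambda>a b. a - b \<in> I)"
  proof (rule transpI)
    fix a b c assume "a - b \<in> I" "b - c \<in> I"
    from I(2)[OF this] show "a - c \<in> I" by simp
  qed
qed

quotient_type (overloaded) 'g uea = "'g::lie_algebra free_alg" / uea_rel
  unfolding uea_rel_def[abs_def] by (rule equivp_mod_ideal[OF two_sided_ideal_ideal_gen])

class complex_algebra = ring_1 +
  fixes cscal :: "complex \<Rightarrow> 'a"
  assumes cscal_add: "cscal (c + d) = cscal c + cscal d"
    and cscal_mult: "cscal (c * d) = cscal c * cscal d"
    and cscal_one: "cscal 1 = 1"
    and cscal_commute: "cscal c * x = x * cscal c"

instantiation complex :: complex_algebra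
begin
definition cscal_complex :: "complex \<Rightarrow> complex" where "cscal_complex c = c"
instance by standard (simp_all add: cscal_complex_def)
end

lemma poly_mapping_single_add_induct [case_names zero single add]:
  fixes a :: "'k \<Rightarrow>\<^sub>0 'b::comm_monoid_add"
  assumes "P 0" "\<And>k v. P (Poly_Mapping.single k v)" "\<And>a b. P a \<Longrightarrow> P b \<Longrightarrow> P (a + b)"
  shows "P a"
proof (induction a rule: update_induct)
  case const
  show ?case using assms(1) by simp
next
  case (update f a b)
  have "Poly_Mapping.update a b f = f + Poly_Mapping.single a b"
    using update.hyps(1)
    by (intro poly_mapping_eqI) (auto simp: lookup_add lookup_single in_keys_iff lookup_update when_def)
  then show ?case using assms(2,3) update.IH by metis
qed

lemma free_scalar_commute: "free_scalar c * a = a * free_scalar c"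
proof (induction a rule: poly_mapping_single_add_induct)
  case (single k v)
  then show ?case by (simp add: free_scalar_def mult_single mult.commute)
qed (simp_all add: distrib_left distrib_right)

lemma uea_rel_simps:
  fixes a b :: "'g::lie_algebra free_alg"
  shows uea_rel_plus: "uea_rel a b \<Longrightarrow> uea_rel c d \<Longrightarrow> uea_rel (a + c) (b + d)"
    and uea_rel_minus: "uea_rel a b \<Longrightarrow> uea_rel c d \<Longrightarrow> uea_rel (a - c) (b - d)"
    and uea_rel_uminus: "uea_rel a b \<Longrightarrow> uea_rel (- a) (- b)"
    and uea_rel_times: "uea_rel a b \<Longrightarrow> uea_rel c d \<Longrightarrow> uea_rel (a * c) (b * d)"
proof -
  note I = two_sided_idealD[OF two_sided_ideal_ideal_gen[of "uea_relations :: 'g free_alg set"]]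
  show "uea_rel a b \<Longrightarrow> uea_rel c d \<Longrightarrow> uea_rel (a + c) (b + d)"
    using I(2)[of "a - b" "c - d"] by (simp add: uea_rel_def algebra_simps)
  show "uea_rel a b \<Longrightarrow> uea_rel c d \<Longrightarrow> uea_rel (a - c) (b - d)"
    using I(6)[of "a - b" "c - d"] by (simp add: uea_rel_def algebra_simps)
  show "uea_rel a b \<Longrightarrow> uea_rel (- a) (- b)"
    using I(5)[of "a - b"] by (simp add: uea_rel_def)
  show "uea_rel (a * c) (b * d)" if "uea_rel a b" "uea_rel c d"
  proof -
    have "a * c - b * d = (a - b) * c + b * (c - d)" by (simp add: algebra_simps)
    then show ?thesis using that I(2,3,4) unfolding uea_rel_def by metis
  qed
qed

lemma uea_rel_refl: "uea_rel a a"
  by (simp add: uea_rel_def two_sided_idealD(1)[OF two_sided_ideal_ideal_gen])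

text \<open>Evaluation of a noncommutative polynomial, and the map on the enveloping algebra it induces.\<close>

definition free_eval :: "('g \<Rightarrow> 'r::complex_algebra) \<Rightarrow> 'g free_alg \<Rightarrow> 'r" where
  "free_eval \<phi> a =
     (\<Sum>w\<in>Poly_Mapping.keys a. cscal (Poly_Mapping.lookup a w) * prod_list (map \<phi> (letters w)))"

definition lie_morphism :: "('g::lie_algebra \<Rightarrow> 'r::complex_algebra) \<Rightarrow> bool" where
  "lie_morphism \<phi> \<longleftrightarrow>
     (\<forall>x y. \<phi> (x + y) = \<phi> x + \<phi> y) \<and> (\<forall>c x. \<phi> (lscale c x) = cscal c * \<phi> x) \<and>
     (\<forall>x y. \<phi> (lbr x y) = \<phi> x * \<phi> y - \<phi> y * \<phi> x)"

lemma cscal_zero [simp]: "cscal 0 = 0"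
  using cscal_add[of 0 0] by simp

lemma free_eval_zero [simp]: "free_eval \<phi> 0 = 0"
  by (simp add: free_eval_def)

lemma free_eval_single [simp]:
  "free_eval \<phi> (Poly_Mapping.single w c) = cscal c * prod_list (map \<phi> (letters w))"
  by (simp add: free_eval_def)

lemma free_eval_superset:
  assumes "finite K" "Poly_Mapping.keys a \<subseteq> K"
  shows "free_eval \<phi> a = (\<Sum>w\<in>K. cscal (Poly_Mapping.lookup a w) * prod_list (map \<phi> (letters w)))"
  unfolding free_eval_def using assms
  by (intro sum.mono_neutral_left) (auto simp: in_keys_iff)

lemma free_eval_add: "free_eval \<phi> (a + b) = free_eval \<phi> a + free_eval \<phi> b"
proof -
  let ?K = "Poly_Mapping.keys a \<union> Poly_Mapping.keys b"
  show ?thesis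
    using Poly_Mapping.keys_add[of a b]
    by (simp add: free_eval_superset[of ?K] lookup_add cscal_add distrib_right sum.distrib)
qed

lemma free_eval_mult: "free_eval \<phi> (a * b) = free_eval \<phi> a * free_eval \<phi> b"
proof (induction a rule: poly_mapping_single_add_induct)
  case (single v c)
  show ?case
  proof (induction b rule: poly_mapping_single_add_induct)
    case (single w d)
    show ?case
      by (simp add: mult_single cscal_mult plus_word_def mult.assoc)
        (metis cscal_commute mult.assoc)
  qed (simp_all add: distrib_left free_eval_add)
qed (simp_all add: distrib_right free_eval_add)

lemma free_eval_uminus: "free_eval \<phi> (- a) = - free_eval \<phi> a"
  using free_eval_add[of \<phi> a "- a"] by (simp add: eq_neg_iff_add_eq_0 add.commute)

lemma free_eval_diff: "free_eval \<phi> (a - b) = free_eval \<phi> a - free_eval \<phi> b"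
  using free_eval_add[of \<phi> a "- b"] by (simp add: free_eval_uminus)

lemma free_eval_gen [simp]: "free_eval \<phi> (free_gen x) = \<phi> x"
  by (simp add: free_gen_def cscal_one)

lemma free_eval_scalar [simp]: "free_eval \<phi> (free_scalar c) = cscal c"
  by (simp add: free_scalar_def zero_word_def)

lemma free_eval_one [simp]: "free_eval \<phi> 1 = 1"
  by (simp add: zero_word_def cscal_one flip: single_one)

lemma free_eval_relations:
  assumes "lie_morphism \<phi>" "a \<in> ideal_gen uea_relations"
  shows "free_eval \<phi> a = 0"
proof -
  let ?I = "{a. free_eval \<phi> a = 0}"
  have "two_sided_ideal ?I"
    by (auto simp: two_sided_ideal_def free_eval_add free_eval_mult)
  moreover have "uea_relations \<subseteq> ?I"
    using assms(1)
    by (auto simp: uea_relations_def lie_morphism_def free_eval_diff free_eval_mult)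
  ultimately show ?thesis using ideal_gen_least[of ?I uea_relations] assms(2) by blast
qed

lemma uea_rel_free_eval: "lie_morphism \<phi> \<Longrightarrow> uea_rel a b \<Longrightarrow> free_eval \<phi> a = free_eval \<phi> b"
  using free_eval_relations[of \<phi> "a - b"] by (simp add: uea_rel_def free_eval_diff)

instantiation uea :: (lie_algebra) ring_1
begin

lift_definition zero_uea :: "'a uea" is 0 .
lift_definition one_uea :: "'a uea" is 1 .
lift_definition plus_uea :: "'a uea \<Rightarrow> 'a uea \<Rightarrow> 'a uea" is "(+)" by (rule uea_rel_plus)
lift_definition minus_uea :: "'a uea \<Rightarrow> 'a uea \<Rightarrow> 'a uea" is "(-)" by (rule uea_rel_minus)
lift_definition uminus_uea :: "'a uea \<Rightarrow> 'a uea" is uminus by (rule uea_rel_uminus)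
lift_definition times_uea :: "'a uea \<Rightarrow> 'a uea \<Rightarrow> 'a uea" is "(*)" by (rule uea_rel_times)

instance
proof
  have "lie_morphism (\<lambda>x::'a. 0 :: complex)" by (simp add: lie_morphism_def)
  then have "\<not> uea_rel (0 :: 'a free_alg) 1" using uea_rel_free_eval by fastforce
  then show "(0 :: 'a uea) \<noteq> 1" by transfer
qed (transfer, simp add: uea_rel_refl algebra_simps)+

end

instantiation uea :: (lie_algebra) complex_algebra
begin

lift_definition cscal_uea :: "complex \<Rightarrow> 'a uea" is free_scalar .

instance
proof
  fix c d :: complex and x :: "'a uea"
  show "cscal (c + d) = (cscal c + cscal d :: 'a uea)"
    by transfer (simp add: uea_rel_refl free_scalar_def single_add)
  show "cscal (c * d) = (cscal c * cscal d :: 'a uea)"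
    by transfer (simp add: uea_rel_refl free_scalar_def mult_single)
  show "cscal 1 = (1 :: 'a uea)"
    by transfer (simp add: uea_rel_refl free_scalar_def)
  show "cscal c * x = x * cscal c"
    by transfer (simp add: uea_rel_refl free_scalar_commute)
qed

end

lift_definition uea_gen :: "'g::lie_algebra \<Rightarrow> 'g uea" is free_gen .

definition uea_lift :: "('g::lie_algebra \<Rightarrow> 'r::complex_algebra) \<Rightarrow> 'g uea \<Rightarrow> 'r" where
  "uea_lift \<phi> u = free_eval \<phi> (rep_uea u)"

lemma uea_lift_abs: "lie_morphism \<phi> \<Longrightarrow> uea_lift \<phi> (abs_uea a) = free_eval \<phi> a"
  unfolding uea_lift_def by (rule uea_rel_free_eval) (auto intro: Quotient3_rep_abs[OF Quotient3_uea] uea_rel_refl)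

lemma uea_lift_hom:
  assumes "lie_morphism \<phi>"
  shows uea_lift_gen: "uea_lift \<phi> (uea_gen x) = \<phi> x"
    and uea_lift_cscal: "uea_lift \<phi> (cscal c) = cscal c"
    and uea_lift_one: "uea_lift \<phi> 1 = 1"
    and uea_lift_add: "uea_lift \<phi> (u + v) = uea_lift \<phi> u + uea_lift \<phi> v"
    and uea_lift_mult: "uea_lift \<phi> (u * v) = uea_lift \<phi> u * uea_lift \<phi> v"
proof -
  note [simp] = uea_lift_abs[OF assms]
  show "uea_lift \<phi> (uea_gen x) = \<phi> x" by (simp add: uea_gen_def)
  show "uea_lift \<phi> (cscal c) = cscal c" by (simp add: cscal_uea_def)
  show "uea_lift \<phi> 1 = 1" by (simp add: one_uea_def)
  show "uea_lift \<phi> (u + v) = uea_lift \<phi> u + uea_lift \<phi> v"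
    by (induct u rule: uea.abs_induct, induct v rule: uea.abs_induct)
      (simp add: plus_uea.abs_eq free_eval_add)
  show "uea_lift \<phi> (u * v) = uea_lift \<phi> u * uea_lift \<phi> v"
    by (induct u rule: uea.abs_induct, induct v rule: uea.abs_induct)
      (simp add: times_uea.abs_eq free_eval_mult)
qed

lemma lie_morphism_uea_gen: "lie_morphism uea_gen"
  unfolding lie_morphism_def
proof (intro conjI allI)
  fix x y :: 'a and c
  have R: "uea_rel a b" if "a - b \<in> uea_relations" for a b :: "'a free_alg"
    using that ideal_gen_subset unfolding uea_rel_def by blast
  show "uea_gen (x + y) = uea_gen x + uea_gen y"
    by transfer (rule R, auto simp: uea_relations_def diff_diff_eq[symmetric])
  show "uea_gen (lscale c x) = cscal c * uea_gen x"
    by transfer (rule R, auto simp: uea_relations_def)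
  have "uea_gen x * uea_gen y - uea_gen y * uea_gen x = uea_gen (lbr x y)"
    by transfer (rule R, auto simp: uea_relations_def)
  then show "uea_gen (lbr x y) = uea_gen x * uea_gen y - uea_gen y * uea_gen x" by simp
qed


section \<open>The Schroedinger algebra\<close>

text \<open>Coordinates with respect to the basis \<open>e, h, f, p, q, z\<close>.\<close>

datatype schr = Schr (e_co: complex) (h_co: complex) (f_co: complex)
  (p_co: complex) (q_co: complex) (z_co: complex)

definition "sE = Schr 1 0 0 0 0 0"
definition "sH = Schr 0 1 0 0 0 0"
definition "sF = Schr 0 0 1 0 0 0"
definition "sP = Schr 0 0 0 1 0 0"
definition "sQ = Schr 0 0 0 0 1 0"
definition "sZ = Schr 0 0 0 0 0 1"

lemma schr_eq_iff:
  "x = y \<longleftrightarrow> e_co x = e_co y \<and> h_co x = h_co y \<and> f_co x = f_co y \<and>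
     p_co x = p_co y \<and> q_co x = q_co y \<and> z_co x = z_co y"
  by (cases x; cases y) auto

instantiation schr :: lie_algebra
begin

definition zero_schr :: schr where "0 = Schr 0 0 0 0 0 0"

definition plus_schr :: "schr \<Rightarrow> schr \<Rightarrow> schr" where
  "x + y = Schr (e_co x + e_co y) (h_co x + h_co y) (f_co x + f_co y)
                (p_co x + p_co y) (q_co x + q_co y) (z_co x + z_co y)"

definition minus_schr :: "schr \<Rightarrow> schr \<Rightarrow> schr" where
  "x - y = Schr (e_co x - e_co y) (h_co x - h_co y) (f_co x - f_co y)
                (p_co x - p_co y) (q_co x - q_co y) (z_co x - z_co y)"

definition uminus_schr :: "schr \<Rightarrow> schr" where
  "- x = Schr (- e_co x) (- h_co x) (- f_co x) (- p_co x) (- q_co x) (- z_co x)"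

definition lscale_schr :: "complex \<Rightarrow> schr \<Rightarrow> schr" where
  "lscale c x = Schr (c * e_co x) (c * h_co x) (c * f_co x) (c * p_co x) (c * q_co x) (c * z_co x)"

definition lbr_schr :: "schr \<Rightarrow> schr \<Rightarrow> schr" where
  "lbr x y = Schr
     (2 * (h_co x * e_co y - e_co x * h_co y))
     (e_co x * f_co y - f_co x * e_co y)
     (- 2 * (h_co x * f_co y - f_co x * h_co y))
     ((h_co x * p_co y - p_co x * h_co y) + (e_co x * q_co y - q_co x * e_co y))
     ((f_co x * p_co y - p_co x * f_co y) - (h_co x * q_co y - q_co x * h_co y))
     (p_co x * q_co y - q_co x * p_co y)"

instance
  by standard
    (simp_all add: schr_eq_iff zero_schr_def plus_schr_def minus_schr_def uminus_schr_def
      lscale_schr_def lbr_schr_def algebra_simps)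

end

lemmas schr_defs = zero_schr_def plus_schr_def minus_schr_def uminus_schr_def
  lscale_schr_def lbr_schr_def sE_def sH_def sF_def sP_def sQ_def sZ_def

lemma schr_brackets:
  "lbr sH sE = lscale 2 sE" "lbr sH sF = lscale (- 2) sF" "lbr sE sF = sH"
  "lbr sZ x = 0"
  "lbr sE sP = 0" "lbr sH sP = sP" "lbr sF sP = sQ"
  "lbr sE sQ = sP" "lbr sH sQ = - sQ" "lbr sF sQ = 0"
  "lbr sP sQ = sZ"
  by (simp_all add: schr_defs)

typedef schr_borel = "{x :: schr. f_co x = 0 \<and> q_co x = 0}"
  by (rule exI[of _ 0]) (simp add: schr_defs)

setup_lifting type_definition_schr_borel

instantiation schr_borel :: lie_algebra
begin

lift_definition zero_schr_borel :: schr_borel is 0 by (simp add: schr_defs)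
lift_definition plus_schr_borel :: "schr_borel \<Rightarrow> schr_borel \<Rightarrow> schr_borel" is "(+)"
  by (simp add: schr_defs)
lift_definition minus_schr_borel :: "schr_borel \<Rightarrow> schr_borel \<Rightarrow> schr_borel" is "(-)"
  by (simp add: schr_defs)
lift_definition uminus_schr_borel :: "schr_borel \<Rightarrow> schr_borel" is uminus
  by (simp add: schr_defs)
lift_definition lscale_schr_borel :: "complex \<Rightarrow> schr_borel \<Rightarrow> schr_borel" is lscale
  by (simp add: schr_defs)
lift_definition lbr_schr_borel :: "schr_borel \<Rightarrow> schr_borel \<Rightarrow> schr_borel" is lbr
  by (simp add: schr_defs)

instance
  by standard
    (transfer, simp add: lscale_add_right lscale_add_left lscale_lscale lscale_one lbr_add_left
      lbr_add_right lbr_scale_left lbr_scale_right lbr_alternating jacobi)+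

end

definition borel_incl :: "schr_borel uea \<Rightarrow> schr uea" where
  "borel_incl = uea_lift (\<lambda>x. uea_gen (Rep_schr_borel x))"

definition borel_weight :: "complex \<Rightarrow> complex \<Rightarrow> schr_borel \<Rightarrow> complex" where
  "borel_weight l1 l2 x = l1 * h_co (Rep_schr_borel x) + l2 * z_co (Rep_schr_borel x)"

lemma lie_morphism_borel_incl:
  "lie_morphism (\<lambda>x. uea_gen (Rep_schr_borel x) :: schr uea)"
  using lie_morphism_uea_gen[where 'a = schr]
  by (simp add: lie_morphism_def plus_schr_borel.rep_eq lscale_schr_borel.rep_eq
      lbr_schr_borel.rep_eq)

lemma lie_morphism_borel_weight: "lie_morphism (borel_weight l1 l2)"
  unfolding lie_morphism_def borel_weight_def cscal_complex_def
  by (intro conjI allI; transfer) (simp_all add: schr_defs algebra_simps)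


section \<open>Localization at the powers of f\<close>

definition fU :: "schr uea" where "fU = uea_gen sF"

definition ad_f :: "schr uea \<Rightarrow> schr uea" where "ad_f u = fU * u - u * fU"

lemma ad_f_add: "ad_f (u + v) = ad_f u + ad_f v"
  by (simp add: ad_f_def algebra_simps)

lemma ad_f_mult: "ad_f (u * v) = ad_f u * v + u * ad_f v"
  by (simp add: ad_f_def algebra_simps)

lemma ad_f_pow_zero: "(ad_f ^^ n) 0 = 0"
  by (induction n) (simp_all add: ad_f_def)

lemma ad_f_pow_add: "(ad_f ^^ n) (u + v) = (ad_f ^^ n) u + (ad_f ^^ n) v"
  by (induction n) (simp_all add: ad_f_add)

lemma ad_f_pow_vanish_mono: "(ad_f ^^ m) u = 0 \<Longrightarrow> m \<le> n \<Longrightarrow> (ad_f ^^ n) u = 0"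
  by (metis ad_f_pow_zero comp_apply funpow_add le_add_diff_inverse2)

lemma ad_f_pow_mult:
  "(ad_f ^^ a) u = 0 \<Longrightarrow> (ad_f ^^ b) v = 0 \<Longrightarrow> (ad_f ^^ (a + b)) (u * v) = 0"
proof (induction "a + b" arbitrary: a b u v)
  case 0
  then show ?case by simp
next
  case (Suc n)
  show ?case
  proof (cases "a = 0 \<or> b = 0")
    case True
    then have "u = 0 \<or> v = 0" using Suc.prems by auto
    then show ?thesis by (auto simp: ad_f_pow_zero)
  next
    case False
    then obtain a' b' where ab: "a = Suc a'" "b = Suc b'" by (metis not0_implies_Suc)
    have "(ad_f ^^ (a' + b)) (ad_f u * v) = 0"
      using Suc.prems ab Suc.hyps(2) by (intro Suc.hyps(1)) (simp_all add: funpow_Suc_right del: funpow.simps)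
    moreover have "(ad_f ^^ (a + b')) (u * ad_f v) = 0"
      using Suc.prems ab Suc.hyps(2) by (intro Suc.hyps(1)) (simp_all add: funpow_Suc_right del: funpow.simps)
    moreover have "a + b = Suc (a' + b)" "a + b' = a' + b" using ab by simp_all
    ultimately show ?thesis
      by (simp add: funpow_Suc_right ad_f_mult ad_f_pow_add del: funpow.simps)
  qed
qed

lemma ad_f_gen: "ad_f (uea_gen x) = uea_gen (lbr sF x)"
  using lie_morphism_uea_gen[where 'a = schr] by (simp add: lie_morphism_def ad_f_def fU_def)

lemma uea_gen_zero: "uea_gen (0 :: 'g::lie_algebra) = 0"
proof -
  have "uea_gen (0 + 0 :: 'g) = uea_gen 0 + uea_gen 0"
    using lie_morphism_uea_gen unfolding lie_morphism_def by blast
  then show ?thesis by simp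
qed

lemma ad_f_nilpotent_gen: "(ad_f ^^ 3) (uea_gen x) = 0"
proof -
  have "lbr sF (lbr sF (lbr sF x)) = 0" by (simp add: schr_defs)
  then show ?thesis by (simp add: numeral_3_eq_3 ad_f_gen uea_gen_zero)
qed

lemma uea_gen_induct [case_names scal gen add mult]:
  fixes u :: "'g::lie_algebra uea"
  assumes "\<And>c. P (cscal c)" "\<And>x. P (uea_gen x)"
    "\<And>u v. P u \<Longrightarrow> P v \<Longrightarrow> P (u + v)" "\<And>u v. P u \<Longrightarrow> P v \<Longrightarrow> P (u * v)"
  shows "P u"
proof (induct u rule: uea.abs_induct)
  fix a :: "'g free_alg"
  have word: "P (abs_uea (Poly_Mapping.single (Word xs) c))" for xs c
  proof (induction xs)
    case Nil
    then show ?case using assms(1)[of c] by (simp add: cscal_uea_def free_scalar_def zero_word_def)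
  next
    case (Cons x xs)
    have "abs_uea (Poly_Mapping.single (Word (x # xs)) c)
        = uea_gen x * abs_uea (Poly_Mapping.single (Word xs) c)"
      by (simp add: uea_gen_def times_uea.abs_eq free_gen_def mult_single plus_word_def)
    then show ?case using assms(2,4) Cons by simp
  qed
  show "P (abs_uea a)"
  proof (induction a rule: poly_mapping_single_add_induct)
    case zero
    have "(0 :: 'g uea) = cscal 0" by simp
    then show ?case using assms(1) by (metis zero_uea_def)
  next
    case (single k v)
    then show ?case using word[of "letters k"] by simp
  next
    case (add a b)
    then show ?case using assms(3) by (metis plus_uea.abs_eq)
  qed
qed

lemma ad_f_locally_nilpotent: "\<exists>n. (ad_f ^^ n) u = 0"
proof (induction u rule: uea_gen_induct)
  case (scal c)
  have "(ad_f ^^ 1) (cscal c) = 0" by (simp add: ad_f_def cscal_commute)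
  then show ?case ..
next
  case (gen x)
  then show ?case using ad_f_nilpotent_gen by blast
next
  case (add u v)
  then obtain m n where "(ad_f ^^ m) u = 0" "(ad_f ^^ n) v = 0" by blast
  then have "(ad_f ^^ (max m n)) (u + v) = 0"
    using ad_f_pow_vanish_mono by (simp add: ad_f_pow_add)
  then show ?case ..
next
  case (mult u v)
  then show ?case using ad_f_pow_mult by blast
qed

lemma ore_condition_aux: "(ad_f ^^ n) u = 0 \<Longrightarrow> \<exists>w. fU ^ (n + k) * u = w * fU ^ k"
proof (induction n arbitrary: u k)
  case 0
  then show ?case by (intro exI[of _ 0]) simp
next
  case (Suc n)
  note outer = Suc.IH
  have D: "(ad_f ^^ n) (ad_f u) = 0"
    using Suc.prems by (simp add: funpow_Suc_right del: funpow.simps)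
  show ?case
  proof (induction k)
    case 0
    then show ?case by simp
  next
    case (Suc k)
    then obtain w where w: "fU ^ (Suc n + k) * u = w * fU ^ k" by blast
    obtain w' where w': "fU ^ (n + Suc k) * ad_f u = w' * fU ^ Suc k"
      using outer[OF D] by blast
    have "fU ^ (Suc n + Suc k) * u = fU ^ (Suc n + k) * (u * fU + ad_f u)"
    proof -
      have "fU ^ (Suc n + Suc k) = fU ^ (Suc n + k) * fU"
        by (simp only: add_Suc_right power_Suc2)
      moreover have "u * fU + ad_f u = fU * u" by (simp add: ad_f_def)
      ultimately show ?thesis by (simp only: mult.assoc)
    qed
    also have "\<dots> = (fU ^ (Suc n + k) * u) * fU + fU ^ (n + Suc k) * ad_f u"
      by (simp add: distrib_left mult.assoc)
    also have "\<dots> = (w + w') * fU ^ Suc k"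
      unfolding w w' by (simp only: distrib_right mult.assoc power_Suc2)
    finally show ?case by blast
  qed
qed

lemma ore_condition: "\<exists>k w. fU ^ k * u = w * fU ^ j"
  using ad_f_locally_nilpotent ore_condition_aux by blast

lemma left_reversible: "u * fU ^ k = 0 \<Longrightarrow> \<exists>m. fU ^ m * u = 0"
proof (induction k arbitrary: u)
  case 0
  then show ?case by simp
next
  case (Suc k)
  have one: "\<exists>m. fU ^ m * v = 0" if "v * fU = 0" for v
  proof -
    have "(ad_f ^^ n) v = fU ^ n * v" for n
      by (induction n) (simp_all add: ad_f_def mult.assoc that)
    then show ?thesis using ad_f_locally_nilpotent[of v] by metis
  qed
  have "(u * fU ^ k) * fU = 0" using Suc.prems by (simp only: mult.assoc power_Suc2)
  then obtain m where "fU ^ m * (u * fU ^ k) = 0" using one by blast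
  then have "(fU ^ m * u) * fU ^ k = 0" by (simp add: mult.assoc)
  then obtain m' where "fU ^ m' * (fU ^ m * u) = 0" using Suc.IH by blast
  then have "fU ^ (m' + m) * u = 0" by (simp add: power_add mult.assoc)
  then show ?case ..
qed

text \<open>The pair \<open>(i, u)\<close> stands for the left fraction with numerator \<open>u\<close> and denominator the
  \<open>i\<close>-th power of \<open>f\<close>.\<close>

definition frac_rel :: "nat \<times> schr uea \<Rightarrow> nat \<times> schr uea \<Rightarrow> bool" where
  "frac_rel = (\<lambda>(i, u) (j, v). \<exists>k l. k + i = l + j \<and> fU ^ k * u = fU ^ l * v)"

lemma frac_rel_refl: "frac_rel x x"
  by (auto simp: frac_rel_def split: prod.splits)

lemma equivp_frac_rel: "equivp frac_rel"
proof (rule equivpI)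
  show "reflp frac_rel" by (simp add: reflp_def frac_rel_refl)
  show "symp frac_rel"
    by (rule sympI) (auto simp: frac_rel_def split: prod.splits, metis)
  show "transp frac_rel"
  proof (rule transpI)
    fix x y z assume xy: "frac_rel x y" and yz: "frac_rel y z"
    obtain i u j v n w where X: "x = (i, u)" "y = (j, v)" "z = (n, w)" by (metis surj_pair)
    from xy obtain k l where 1: "k + i = l + j" "fU ^ k * u = fU ^ l * v"
      by (auto simp: frac_rel_def X)
    from yz obtain r s where 2: "r + j = s + n" "fU ^ r * v = fU ^ s * w"
      by (auto simp: frac_rel_def X)
    have "fU ^ (r + k) * u = fU ^ (l + r) * v"
      using 1(2) by (simp only: add.commute[of l] power_add mult.assoc)
    also have "\<dots> = fU ^ (l + s) * w" using 2(2) by (simp add: power_add mult.assoc)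
    finally have "fU ^ (r + k) * u = fU ^ (l + s) * w" .
    moreover have "r + k + i = l + s + n" using 1(1) 2(1) by simp
    ultimately show "frac_rel x z" unfolding frac_rel_def X by blast
  qed
qed

text \<open>Lifting setups are dropped once they are used, so that the next quotient treats the earlier one
  as an atomic type.\<close>

lifting_forget uea.lifting

quotient_type f_loc = "nat \<times> schr uea" / frac_rel
  by (rule equivp_frac_rel)

lift_definition lfrac :: "nat \<Rightarrow> schr uea \<Rightarrow> f_loc" is Pair .

definition ore_witness :: "schr uea \<Rightarrow> nat \<Rightarrow> nat \<times> schr uea" where
  "ore_witness u j = (SOME (k, w). fU ^ k * u = w * fU ^ j)"

text \<open>To multiply two left fractions, the middle factor, a numerator times an inverse power of
  \<open>f\<close>, is first rewritten as a left fraction.\<close>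

definition frac_times :: "nat \<times> schr uea \<Rightarrow> nat \<times> schr uea \<Rightarrow> nat \<times> schr uea" where
  "frac_times = (\<lambda>(i, u) (j, v). case ore_witness u j of (k, w) \<Rightarrow> (i + k, w * v))"

lemma ore_witness: "ore_witness u j = (k, w) \<Longrightarrow> fU ^ k * u = w * fU ^ j"
proof -
  assume *: "ore_witness u j = (k, w)"
  obtain k' w' where w': "fU ^ k' * u = w' * fU ^ j" using ore_condition by blast
  let ?P = "\<lambda>(k, w). fU ^ k * u = w * fU ^ j"
  have "?P (k', w')" using w' by simp
  then have "?P (ore_witness u j)" unfolding ore_witness_def by (rule someI[of ?P])
  with * show ?thesis by simp
qed

lemma frac_rel_sym: "frac_rel x y \<Longrightarrow> frac_rel y x"
  by (rule equivp_symp[OF equivp_frac_rel])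

lemma frac_rel_trans: "frac_rel x y \<Longrightarrow> frac_rel y z \<Longrightarrow> frac_rel x z"
  by (rule equivp_transp[OF equivp_frac_rel])

lemma frac_rel_expand: "frac_rel (i, u) (k + i, fU ^ k * u)"
  unfolding frac_rel_def by (auto intro!: exI[of _ k] exI[of _ "0::nat"])

lemma fU_pow_left_commute: "fU ^ a * (fU ^ b * t) = fU ^ b * (fU ^ a * t)"
  by (simp only: mult.assoc[symmetric] power_add[symmetric] add.commute)

lemma frac_times_witness_unique:
  assumes "fU ^ k * u = w * fU ^ j" "fU ^ l * u = w' * fU ^ j"
  shows "frac_rel (i + k, w * v) (i + l, w' * v)"
proof -
  have "(fU ^ l * w - fU ^ k * w') * fU ^ j = fU ^ l * (w * fU ^ j) - fU ^ k * (w' * fU ^ j)"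
    by (simp only: left_diff_distrib mult.assoc)
  also have "\<dots> = 0"
    unfolding assms[symmetric] fU_pow_left_commute[of l] by simp
  finally obtain m where "fU ^ m * (fU ^ l * w - fU ^ k * w') = 0" using left_reversible by blast
  then have "fU ^ (m + l) * w = fU ^ (m + k) * w'"
    by (simp add: right_diff_distrib power_add mult.assoc)
  then have "fU ^ (m + l) * (w * v) = fU ^ (m + k) * (w' * v)"
    by (simp only: mult.assoc[symmetric])
  moreover have "(m + l) + (i + k) = (m + k) + (i + l)" by simp
  ultimately show ?thesis unfolding frac_rel_def by blast
qed

lemma frac_times_witness:
  assumes "fU ^ k * u = w * fU ^ j"
  shows "frac_rel (frac_times (i, u) (j, v)) (i + k, w * v)"
proof -
  obtain l w' where l: "ore_witness u j = (l, w')" by force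
  from frac_times_witness_unique[OF ore_witness[OF l] assms]
  show ?thesis by (simp add: frac_times_def l)
qed

lemma frac_times_expand_left:
  "frac_rel (frac_times (i, u) (j, v)) (frac_times (n + i, fU ^ n * u) (j, v))"
proof -
  obtain k w where k: "fU ^ k * (fU ^ n * u) = w * fU ^ j" using ore_condition by blast
  then have k': "fU ^ (k + n) * u = w * fU ^ j" by (simp add: power_add mult.assoc)
  have eq: "n + i + k = i + (k + n)" by simp
  have "frac_rel (frac_times (i, u) (j, v)) (n + i + k, w * v)"
    unfolding eq by (rule frac_times_witness[OF k'])
  from frac_rel_trans[OF this frac_rel_sym[OF frac_times_witness[OF k]]] show ?thesis .
qed

lemma frac_times_expand_right:
  "frac_rel (frac_times (i, u) (j, v)) (frac_times (i, u) (n + j, fU ^ n * v))"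
proof -
  obtain k w where k: "fU ^ k * u = w * fU ^ (n + j)" using ore_condition by blast
  then have k': "fU ^ k * u = (w * fU ^ n) * fU ^ j" by (simp add: power_add mult.assoc)
  have "frac_rel (frac_times (i, u) (j, v)) (i + k, w * (fU ^ n * v))"
    using frac_times_witness[OF k', of i v] by (simp only: mult.assoc)
  from frac_rel_trans[OF this frac_rel_sym[OF frac_times_witness[OF k]]] show ?thesis .
qed

lemma frac_times_cong:
  assumes "frac_rel x x'" "frac_rel y y'"
  shows "frac_rel (frac_times x y) (frac_times x' y')"
proof -
  obtain i u i' u' j v j' v' where X: "x = (i, u)" "x' = (i', u')" "y = (j, v)" "y' = (j', v')"
    by (metis surj_pair)
  from assms(1) obtain k l where 1: "k + i = l + i'" "fU ^ k * u = fU ^ l * u'"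
    by (auto simp: frac_rel_def X)
  from assms(2) obtain r s where 2: "r + j = s + j'" "fU ^ r * v = fU ^ s * v'"
    by (auto simp: frac_rel_def X)
  have "frac_rel (frac_times x y) (frac_times x' y)"
    using frac_rel_trans[OF frac_times_expand_left[of i u j v k, unfolded 1]
        frac_rel_sym[OF frac_times_expand_left[of i' u' j v l]]] unfolding X .
  moreover have "frac_rel (frac_times x' y) (frac_times x' y')"
    using frac_rel_trans[OF frac_times_expand_right[of i' u' j v r, unfolded 2]
        frac_rel_sym[OF frac_times_expand_right[of i' u' j' v' s]]] unfolding X .
  ultimately show ?thesis by (rule frac_rel_trans)
qed

lemma frac_plus_cong:
  assumes "frac_rel x x'" "frac_rel y y'"
  shows "frac_rel ((\<lambda>(i, u) (j, v). (i + j, fU ^ j * u + fU ^ i * v)) x y)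
    ((\<lambda>(i, u) (j, v). (i + j, fU ^ j * u + fU ^ i * v)) x' y')"
proof -
  obtain i u i' u' j v j' v' where X: "x = (i, u)" "x' = (i', u')" "y = (j, v)" "y' = (j', v')"
    by (metis surj_pair)
  from assms(1) obtain k l where 1: "k + i = l + i'" "fU ^ k * u = fU ^ l * u'"
    by (auto simp: frac_rel_def X)
  from assms(2) obtain r s where 2: "r + j = s + j'" "fU ^ r * v = fU ^ s * v'"
    by (auto simp: frac_rel_def X)
  have c: "fU ^ (a + b) * (fU ^ n * s) = fU ^ (b + n) * (fU ^ a * s)"
    "fU ^ (a + b) * (fU ^ n * s) = fU ^ (a + n) * (fU ^ b * s)" for a b n s
    by (simp_all only: mult.assoc[symmetric] power_add[symmetric] ac_simps)
  have "fU ^ (k + r) * (fU ^ j * u + fU ^ i * v)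
      = fU ^ (r + j) * (fU ^ k * u) + fU ^ (k + i) * (fU ^ r * v)"
    by (simp only: distrib_left c(1)[of k r j] c(2)[of k r i])
  also have "\<dots> = fU ^ (s + j') * (fU ^ l * u') + fU ^ (l + i') * (fU ^ s * v')"
    unfolding 1 2 ..
  also have "\<dots> = fU ^ (l + s) * (fU ^ j' * u' + fU ^ i' * v')"
    by (simp only: distrib_left c(1)[of l s j'] c(2)[of l s i'])
  finally have "fU ^ (k + r) * (fU ^ j * u + fU ^ i * v) = fU ^ (l + s) * (fU ^ j' * u' + fU ^ i' * v')" .
  moreover have "(k + r) + (i + j) = (l + s) + (i' + j')" using 1(1) 2(1) by simp
  ultimately show ?thesis unfolding X frac_rel_def by auto
qed

instantiation f_loc :: "{plus, times, zero, one, uminus, minus}"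
begin

lift_definition zero_f_loc :: f_loc is "(0, 0)" .
lift_definition one_f_loc :: f_loc is "(0, 1)" .
lift_definition plus_f_loc :: "f_loc \<Rightarrow> f_loc \<Rightarrow> f_loc" is
  "\<lambda>(i, u) (j, v). (i + j, fU ^ j * u + fU ^ i * v)"
  by (rule frac_plus_cong)
lift_definition uminus_f_loc :: "f_loc \<Rightarrow> f_loc" is "\<lambda>(i, u). (i, - u)"
  by (force simp: frac_rel_def)
lift_definition times_f_loc :: "f_loc \<Rightarrow> f_loc \<Rightarrow> f_loc" is frac_times
  by (rule frac_times_cong)
definition minus_f_loc :: "f_loc \<Rightarrow> f_loc \<Rightarrow> f_loc" where "(x :: f_loc) - y = x + - y"

instance ..

end

lemma frac_eq_iff: "lfrac i u = lfrac j v \<longleftrightarrow> (\<exists>k l. k + i = l + j \<and> fU ^ k * u = fU ^ l * v)"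
  by transfer (simp add: frac_rel_def)

lemma frac_expand: "lfrac i u = lfrac (k + i) (fU ^ k * u)"
  by transfer (rule frac_rel_expand)

lemma frac_cases [cases type: f_loc]: obtains i u where "x = lfrac i u"
  by transfer (metis frac_rel_refl surj_pair)

lemma frac_add: "lfrac i u + lfrac j v = lfrac (i + j) (fU ^ j * u + fU ^ i * v)"
  by transfer (simp add: frac_rel_refl)

lemma frac_add_same: "lfrac i u + lfrac i v = lfrac i (u + v)"
  unfolding frac_add distrib_left[symmetric] frac_expand[of i "u + v" i] ..

lemma frac_mult: "fU ^ k * u = w * fU ^ j \<Longrightarrow> lfrac i u * lfrac j v = lfrac (i + k) (w * v)"
  by transfer (rule frac_times_witness)

lemma frac_common:
  obtains i u v where "x = lfrac i u" "y = lfrac i v"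
proof -
  obtain i u j v where "x = lfrac i u" "y = lfrac j v" by (metis frac_cases)
  then have "x = lfrac (j + i) (fU ^ j * u)" "y = lfrac (j + i) (fU ^ i * v)"
    using frac_expand[of i u j] frac_expand[of j v i] by (simp_all add: add.commute[of j])
  then show ?thesis using that by blast
qed

lemma ore_condition2: "\<exists>k w w'. fU ^ k * u = w * fU ^ j \<and> fU ^ k * v = w' * fU ^ j"
proof -
  obtain k w l w' where "fU ^ k * u = w * fU ^ j" "fU ^ l * v = w' * fU ^ j"
    using ore_condition by metis
  then have "fU ^ (l + k) * u = (fU ^ l * w) * fU ^ j" "fU ^ (k + l) * v = (fU ^ k * w') * fU ^ j"
    by (simp_all only: mult.assoc power_add)
  then show ?thesis unfolding add.commute[of l k] by blast
qed

lemma frac_common3: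
  obtains i u v w where "x = lfrac i u" "y = lfrac i v" "t = lfrac i w"
proof -
  obtain i u v where 1: "x = lfrac i u" "y = lfrac i v" by (rule frac_common)
  obtain j w where 2: "t = lfrac j w" by (rule frac_cases)
  have "x = lfrac (j + i) (fU ^ j * u)" "y = lfrac (j + i) (fU ^ j * v)"
    using 1 frac_expand[of i u j] frac_expand[of i v j] by simp_all
  moreover have "t = lfrac (j + i) (fU ^ i * w)"
    using 2 frac_expand[of j w i] by (simp add: add.commute)
  ultimately show ?thesis using that by blast
qed

lemma frac_zero: "lfrac i 0 = 0"
  using frac_eq_iff[of i 0 0 0] by (auto simp: zero_f_loc_def lfrac.abs_eq intro: exI[of _ 0])

lemma frac_uminus: "- lfrac i u = lfrac i (- u)"
  by transfer (simp add: frac_rel_refl)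

lemma frac_times_plus_left: "lfrac i (u + v) * lfrac j w = lfrac i u * lfrac j w + lfrac i v * lfrac j w"
proof -
  obtain k a b where ab: "fU ^ k * u = a * fU ^ j" "fU ^ k * v = b * fU ^ j"
    using ore_condition2 by blast
  then have "fU ^ k * (u + v) = (a + b) * fU ^ j" by (simp add: algebra_simps)
  from frac_mult[OF this] frac_mult[OF ab(1)] frac_mult[OF ab(2)]
  show ?thesis by (simp add: frac_add_same distrib_right)
qed

lemma frac_times_plus_right: "lfrac i u * lfrac j (v + w) = lfrac i u * lfrac j v + lfrac i u * lfrac j w"
proof -
  obtain k a where "fU ^ k * u = a * fU ^ j" using ore_condition by blast
  then show ?thesis by (simp add: frac_mult frac_add_same distrib_left)
qed

lemma frac_times_assoc:
  "lfrac i u * lfrac j v * lfrac n t = lfrac i u * (lfrac j v * lfrac n t)"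
proof -
  obtain c b where b: "fU ^ c * v = b * fU ^ n" using ore_condition by blast
  obtain d a where a: "fU ^ d * u = a * fU ^ (j + c)" using ore_condition by blast
  have 1: "fU ^ d * u = (a * fU ^ c) * fU ^ j"
    using a by (simp add: mult.assoc power_add add.commute[of j c])
  have 2: "fU ^ 0 * (a * fU ^ c * v) = (a * b) * fU ^ n"
    using b by (simp add: mult.assoc)
  have "lfrac i u * lfrac j v * lfrac n t = lfrac (i + d) (a * b * t)"
    using frac_mult[OF 1] frac_mult[OF 2] by simp
  also have "\<dots> = lfrac i u * (lfrac j v * lfrac n t)"
    using frac_mult[OF b] frac_mult[OF a] by (simp add: mult.assoc)
  finally show ?thesis .
qed

instance f_loc :: "{ring, monoid_mult}"
proof
  fix x y t :: f_loc
  show "x + y = y + x" by (rule frac_common[of x y]) (simp add: frac_add_same add.commute)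
  show "0 + x = x" 
  proof (cases x)
    case (1 i u)
    show ?thesis using frac_add_same[of i 0 u] unfolding 1 by (simp add: frac_zero)
  qed
  show "- x + x = 0" by (cases x) (simp add: frac_uminus frac_add_same frac_zero)
  show "x - y = x + - y" by (rule minus_f_loc_def)
  show "x + y + t = x + (y + t)"
    by (rule frac_common3[of x y t]) (simp add: frac_add_same add.assoc)
  have one: "1 = lfrac 0 1" by (simp add: one_f_loc_def lfrac.abs_eq)
  show "1 * x = x"
  proof (cases x)
    case (1 i u)
    have "lfrac 0 1 * lfrac i u = lfrac i u"
      using frac_mult[of i 1 1 i 0 u] by simp
    with 1 show ?thesis by (simp add: one)
  qed
  show "x * 1 = x"
    by (cases x) (simp add: one frac_mult[of 0 _ _ 0])
  show "x * y * t = x * (y * t)"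
    by (cases x; cases y; cases t) (simp add: frac_times_assoc)
  show "(x + y) * t = x * t + y * t"
    by (rule frac_common[of x y]; cases t) (simp add: frac_add_same frac_times_plus_left)
  show "x * (y + t) = x * y + x * t"
    by (rule frac_common[of y t]; cases x) (simp add: frac_add_same frac_times_plus_right)
qed

text \<open>The properties characterizing the left Ore localization.\<close>

lemma lfrac_hom:
  "lfrac 0 1 = 1" "lfrac 0 (u + v) = lfrac 0 u + lfrac 0 v" "lfrac 0 (u * v) = lfrac 0 u * lfrac 0 v"
proof -
  show "lfrac 0 1 = 1" by (simp add: one_f_loc_def lfrac.abs_eq)
qed (simp_all add: frac_add_same frac_mult[of 0 u u 0 0 v])

lemma lfrac_zero_eq_zero_iff: "lfrac 0 u = 0 \<longleftrightarrow> (\<exists>k. fU ^ k * u = 0)"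
  by (auto simp: frac_eq_iff simp flip: frac_zero[of 0])

lemma fU_unit: "lfrac 0 fU * lfrac 1 1 = 1" "lfrac 1 1 * lfrac 0 fU = 1"
proof -
  show "lfrac 0 fU * lfrac 1 1 = 1"
    using frac_mult[of 0 fU 1 1 0 1] lfrac_hom(1) by simp
  show "lfrac 1 1 * lfrac 0 fU = 1"
    using frac_mult[of 0 1 1 0 1 fU] frac_expand[of 0 1 1] lfrac_hom(1) by simp
qed

lemma lfrac_decompose: "lfrac i u = lfrac 1 1 ^ i * lfrac 0 u"
proof (induction i)
  case 0
  then show ?case by simp
next
  case (Suc i)
  have "lfrac (Suc i) u = lfrac 1 1 * lfrac i u"
    using frac_mult[of i 1 1 i 1 u] by simp
  then show ?case by (simp add: Suc mult.assoc)
qed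

text \<open>The bimodule \<open>S\<^sub>f\<close>, the localization modulo the enveloping algebra.\<close>

definition sf_rel :: "f_loc \<Rightarrow> f_loc \<Rightarrow> bool" where
  "sf_rel x y \<longleftrightarrow> x - y \<in> range (lfrac 0)"

lemma range_lfrac:
  "0 \<in> range (lfrac 0)"
  "x \<in> range (lfrac 0) \<Longrightarrow> y \<in> range (lfrac 0) \<Longrightarrow> x + y \<in> range (lfrac 0)"
  "x \<in> range (lfrac 0) \<Longrightarrow> - x \<in> range (lfrac 0)"
  "x \<in> range (lfrac 0) \<Longrightarrow> lfrac 0 u * x \<in> range (lfrac 0)"
  "x \<in> range (lfrac 0) \<Longrightarrow> x * lfrac 0 u \<in> range (lfrac 0)"
proof -
  show "0 \<in> range (lfrac 0)" by (rule range_eqI[of _ _ 0]) (simp add: frac_zero)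
qed (auto simp: lfrac_hom[symmetric] frac_uminus)

lemma sf_rel_refl: "sf_rel x x"
  by (simp add: sf_rel_def range_lfrac)

lemma equivp_sf_rel: "equivp sf_rel"
proof (rule equivpI)
  show "reflp sf_rel" by (simp add: reflp_def sf_rel_refl)
  show "symp sf_rel"
  proof (rule sympI)
    fix x y assume "sf_rel x y"
    then show "sf_rel y x" using range_lfrac(3)[of "x - y"] by (simp add: sf_rel_def)
  qed
  show "transp sf_rel"
  proof (rule transpI)
    fix x y t assume "sf_rel x y" "sf_rel y t"
    then show "sf_rel x t" using range_lfrac(2)[of "x - y" "y - t"] by (simp add: sf_rel_def)
  qed
qed

lifting_forget f_loc.lifting

quotient_type sf = f_loc / sf_rel
  by (rule equivp_sf_rel)

instantiation sf :: ab_group_add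
begin

lift_definition zero_sf :: sf is 0 .
lift_definition plus_sf :: "sf \<Rightarrow> sf \<Rightarrow> sf" is "(+)"
  unfolding sf_rel_def by (simp only: add_diff_add range_lfrac)
lift_definition uminus_sf :: "sf \<Rightarrow> sf" is uminus
  unfolding sf_rel_def by (simp only: minus_diff_minus range_lfrac)
definition minus_sf :: "sf \<Rightarrow> sf \<Rightarrow> sf" where "(x :: sf) - y = x + - y"

instance
proof
  fix x y t :: sf
  show "x + y + t = x + (y + t)" by transfer (simp add: sf_rel_refl add.assoc)
  show "x + y = y + x" by transfer (simp add: sf_rel_refl add.commute)
  show "0 + x = x" by transfer (simp add: sf_rel_refl)
  show "- x + x = 0" by transfer (simp add: sf_rel_refl)
  show "x - y = x + - y" by (rule minus_sf_def)
qed

end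

lift_definition sf_left :: "schr uea \<Rightarrow> sf \<Rightarrow> sf" is "\<lambda>u x. lfrac 0 u * x"
  unfolding sf_rel_def by (simp only: right_diff_distrib[symmetric] range_lfrac)

lift_definition sf_right :: "sf \<Rightarrow> schr uea \<Rightarrow> sf" is "\<lambda>x u. x * lfrac 0 u"
  unfolding sf_rel_def by (simp only: left_diff_distrib[symmetric] range_lfrac)

definition bimodule :: "('s::ring_1 \<Rightarrow> 'm \<Rightarrow> 'm) \<Rightarrow> ('m::ab_group_add \<Rightarrow> 'r::ring_1 \<Rightarrow> 'm) \<Rightarrow> bool" where
  "bimodule L R \<longleftrightarrow>
     (\<forall>s m m'. L s (m + m') = L s m + L s m') \<and> (\<forall>s t m. L (s + t) m = L s m + L t m) \<and>
     (\<forall>s t m. L (s * t) m = L s (L t m)) \<and> (\<forall>m. L 1 m = m) \<and>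
     (\<forall>m m' r. R (m + m') r = R m r + R m' r) \<and> (\<forall>m r r'. R m (r + r') = R m r + R m r') \<and>
     (\<forall>m r r'. R m (r * r') = R (R m r) r') \<and> (\<forall>m. R m 1 = m) \<and>
     (\<forall>s m r. L s (R m r) = R (L s m) r)"

lemma bimoduleD:
  assumes "bimodule L R"
  shows "L s (m + m') = L s m + L s m'" "L (s + t) m = L s m + L t m"
    "L (s * t) m = L s (L t m)" "L 1 m = m" "L s (R m r) = R (L s m) r"
  using assms by (simp_all add: bimodule_def)

lemma bimodule_sf: "bimodule sf_left sf_right"
  unfolding bimodule_def
  by (intro conjI allI; transfer) (simp_all add: sf_rel_refl lfrac_hom algebra_simps)


section \<open>Left modules and tensor products\<close>

text \<open>The library's locale of modules requires a commutative ring of scalars; only its record type is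
  used here, with the fields \<open>mult\<close> and \<open>one\<close> left unspecified.\<close>

locale left_module = abelian_group M for M :: "('r::ring_1, 'm) module" (structure) +
  assumes smult_closed: "x \<in> carrier M \<Longrightarrow> r \<odot> x \<in> carrier M"
    and smult_add_left: "x \<in> carrier M \<Longrightarrow> (r + s) \<odot> x = r \<odot> x \<oplus> s \<odot> x"
    and smult_add_right: "x \<in> carrier M \<Longrightarrow> y \<in> carrier M \<Longrightarrow> r \<odot> (x \<oplus> y) = r \<odot> x \<oplus> r \<odot> y"
    and smult_mult: "x \<in> carrier M \<Longrightarrow> (r * s) \<odot> x = r \<odot> (s \<odot> x)"
    and smult_one: "x \<in> carrier M \<Longrightarrow> 1 \<odot> x = x"

definition annihilator :: "('r, 'm) module \<Rightarrow> 'r set" where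
  "annihilator M = {r. \<forall>x\<in>carrier M. r \<odot>\<^bsub>M\<^esub> x = \<zero>\<^bsub>M\<^esub>}"

definition additive_gen :: "'a::ab_group_add set \<Rightarrow> 'a set" where
  "additive_gen S = \<Inter>{H. 0 \<in> H \<and> (\<forall>x\<in>H. \<forall>y\<in>H. x - y \<in> H) \<and> S \<subseteq> H}"

text \<open>The tensor product of a right module, given by the operation \<open>R\<close>, and the left module
  \<open>N\<close>, as a quotient of the free abelian group on pairs; a left action \<open>L\<close> on the first factor
  acts on the tensor product.\<close>

definition tensor_rels ::
    "('m::ab_group_add \<Rightarrow> 'r \<Rightarrow> 'm) \<Rightarrow> ('r, 'n) module \<Rightarrow> ('m \<times> 'n \<Rightarrow>\<^sub>0 int) set" where
  "tensor_rels R N = additive_gen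
     ({frag_of (m + m', n) - frag_of (m, n) - frag_of (m', n) | m m' n. n \<in> carrier N} \<union>
      {frag_of (m, n \<oplus>\<^bsub>N\<^esub> n') - frag_of (m, n) - frag_of (m, n') | m n n'.
         n \<in> carrier N \<and> n' \<in> carrier N} \<union>
      {frag_of (R m r, n) - frag_of (m, r \<odot>\<^bsub>N\<^esub> n) | m r n. n \<in> carrier N})"

definition additive_coset :: "'a::ab_group_add set \<Rightarrow> 'a \<Rightarrow> 'a set" where
  "additive_coset K x = {y. y - x \<in> K}"

definition act_first :: "('s \<Rightarrow> 'm \<Rightarrow> 'm) \<Rightarrow> 's \<Rightarrow> ('m \<times> 'n \<Rightarrow>\<^sub>0 int) \<Rightarrow> ('m \<times> 'n \<Rightarrow>\<^sub>0 int)" where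
  "act_first L s = frag_extend (\<lambda>(m, n). frag_of (L s m, n))"

definition tensor_product ::
    "('s \<Rightarrow> 'm \<Rightarrow> 'm) \<Rightarrow> ('m::ab_group_add \<Rightarrow> 'r \<Rightarrow> 'm) \<Rightarrow> ('r, 'n) module
     \<Rightarrow> ('s, ('m \<times> 'n \<Rightarrow>\<^sub>0 int) set) module" where
  "tensor_product L R N = (let K = tensor_rels R N in
     \<lparr>carrier = {additive_coset K x | x. Poly_Mapping.keys x \<subseteq> UNIV \<times> carrier N},
      mult = undefined, one = undefined,
      zero = K,
      add = (\<lambda>A B. {a + b | a b. a \<in> A \<and> b \<in> B}),
      smult = (\<lambda>s A. \<Union>a\<in>A. additive_coset K (act_first L s a))\<rparr>)"

lemma additive_gen_closed:
  "0 \<in> additive_gen S"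
  "x \<in> additive_gen S \<Longrightarrow> y \<in> additive_gen S \<Longrightarrow> x - y \<in> additive_gen S"
  "x \<in> S \<Longrightarrow> x \<in> additive_gen S"
  unfolding additive_gen_def by blast+

lemma additive_gen_uminus: "x \<in> additive_gen S \<Longrightarrow> - x \<in> additive_gen S"
  using additive_gen_closed(1)[of S] additive_gen_closed(2)[of 0 S x] by simp

lemma additive_gen_plus: "x \<in> additive_gen S \<Longrightarrow> y \<in> additive_gen S \<Longrightarrow> x + y \<in> additive_gen S"
  using additive_gen_closed(2)[of x S "- y"] additive_gen_uminus[of y] by simp

lemma additive_gen_least:
  "0 \<in> H \<Longrightarrow> (\<And>x y. x \<in> H \<Longrightarrow> y \<in> H \<Longrightarrow> x - y \<in> H) \<Longrightarrow> S \<subseteq> H \<Longrightarrow> additive_gen S \<subseteq> H"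
  unfolding additive_gen_def by blast

lemma additive_coset_eq_iff:
  "additive_coset (additive_gen S) x = additive_coset (additive_gen S) y \<longleftrightarrow> x - y \<in> additive_gen S"
proof
  assume "additive_coset (additive_gen S) x = additive_coset (additive_gen S) y"
  moreover have "x \<in> additive_coset (additive_gen S) x"
    by (simp add: additive_coset_def additive_gen_closed)
  ultimately show "x - y \<in> additive_gen S" by (simp add: additive_coset_def)
next
  assume xy: "x - y \<in> additive_gen S"
  have "t - x \<in> additive_gen S \<longleftrightarrow> t - y \<in> additive_gen S" for t
    using additive_gen_plus[OF _ xy, of "t - x"] additive_gen_closed(2)[OF _ xy, of "t - y"] by auto
  then show "additive_coset (additive_gen S) x = additive_coset (additive_gen S) y"
    by (simp add: additive_coset_def)
qed

lemma additive_coset_add: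
  "{a + b | a b. a \<in> additive_coset (additive_gen S) x \<and> b \<in> additive_coset (additive_gen S) y}
     = additive_coset (additive_gen S) (x + y)" (is "?A = ?B")
proof (intro equalityI subsetI)
  fix t assume "t \<in> ?A"
  then obtain a b where "t = a + b" "a - x \<in> additive_gen S" "b - y \<in> additive_gen S"
    by (auto simp: additive_coset_def)
  then show "t \<in> ?B"
    using additive_gen_plus[of "a - x" S "b - y"] by (simp add: additive_coset_def algebra_simps)
next
  fix t assume "t \<in> ?B"
  then have "t - y - x \<in> additive_gen S" by (simp add: additive_coset_def algebra_simps)
  then have "t - y \<in> additive_coset (additive_gen S) x" "y \<in> additive_coset (additive_gen S) y"
    by (simp_all add: additive_coset_def additive_gen_closed)
  then show "t \<in> ?A" by force
qed

lemma act_first_simps [simp]: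
  "act_first L s 0 = 0"
  "act_first L s (frag_of (m, n)) = frag_of (L s m, n)"
  "act_first L s (x - y) = act_first L s x - act_first L s y"
  "act_first L s (x + y) = act_first L s x + act_first L s y"
  "act_first L s (- x) = - act_first L s x"
  by (simp_all add: act_first_def frag_extend_diff frag_extend_add frag_extend_minus)

lemma act_first_keys:
  "Poly_Mapping.keys x \<subseteq> UNIV \<times> A \<Longrightarrow> Poly_Mapping.keys (act_first L s x) \<subseteq> UNIV \<times> A"
  unfolding act_first_def by (rule order_trans[OF keys_frag_extend]) auto

lemma act_first_rels:
  assumes "bimodule L R" "x \<in> tensor_rels R N"
  shows "act_first L s x \<in> tensor_rels R N"
proof -
  let ?S = "{frag_of (m + m', n) - frag_of (m, n) - frag_of (m', n) | m m' n. n \<in> carrier N} \<union>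
      {frag_of (m, n \<oplus>\<^bsub>N\<^esub> n') - frag_of (m, n) - frag_of (m, n') | m n n'.
         n \<in> carrier N \<and> n' \<in> carrier N} \<union>
      {frag_of (R m r, n) - frag_of (m, r \<odot>\<^bsub>N\<^esub> n) | m r n. n \<in> carrier N}"
  have K: "tensor_rels R N = additive_gen ?S" by (simp add: tensor_rels_def)
  have gen: "act_first L s y \<in> ?S" if y: "y \<in> ?S" for y
  proof -
    have L: "L s (m + m') = L s m + L s m'" "L s (R m r) = R (L s m) r" for m m' r
      by (rule bimoduleD[OF assms(1)])+
    consider (1) m m' n where "y = frag_of (m + m', n) - frag_of (m, n) - frag_of (m', n)" "n \<in> carrier N"
      | (2) m n n' where "y = frag_of (m, n \<oplus>\<^bsub>N\<^esub> n') - frag_of (m, n) - frag_of (m, n')"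
          "n \<in> carrier N" "n' \<in> carrier N"
      | (3) m r n where "y = frag_of (R m r, n) - frag_of (m, r \<odot>\<^bsub>N\<^esub> n)" "n \<in> carrier N"
      using y by blast
    then show ?thesis
    proof cases
      case 1
      then have "act_first L s y = frag_of (L s m + L s m', n) - frag_of (L s m, n) - frag_of (L s m', n)"
        by (simp add: L)
      then show ?thesis using 1(2) by blast
    next
      case 2
      then have "act_first L s y =
          frag_of (L s m, n \<oplus>\<^bsub>N\<^esub> n') - frag_of (L s m, n) - frag_of (L s m, n')" by simp
      then show ?thesis using 2(2,3) by blast
    next
      case 3
      then have "act_first L s y = frag_of (R (L s m) r, n) - frag_of (L s m, r \<odot>\<^bsub>N\<^esub> n)"
        by (simp add: L)
      then show ?thesis using 3(2) by blast
    qed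
  qed
  have "additive_gen ?S \<subseteq> {x. act_first L s x \<in> additive_gen ?S}"
  proof (rule additive_gen_least)
    show "0 \<in> {x. act_first L s x \<in> additive_gen ?S}"
      by (simp only: mem_Collect_eq act_first_simps additive_gen_closed(1))
    show "x - y \<in> {x. act_first L s x \<in> additive_gen ?S}"
      if "x \<in> {x. act_first L s x \<in> additive_gen ?S}" "y \<in> {x. act_first L s x \<in> additive_gen ?S}" for x y
      using that by (simp only: mem_Collect_eq act_first_simps additive_gen_closed(2))
    show "?S \<subseteq> {x. act_first L s x \<in> additive_gen ?S}"
      using additive_gen_closed(3)[OF gen] by (intro subsetI CollectI)
  qed
  then show ?thesis using assms(2) unfolding K by blast
qed

lemma tensor_product_smult:
  assumes "bimodule L R"
  shows "s \<odot>\<^bsub>tensor_product L R N\<^esub> additive_coset (tensor_rels R N) x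
    = additive_coset (tensor_rels R N) (act_first L s x)"
proof -
  let ?c = "additive_coset (tensor_rels R N)"
  have "?c (act_first L s a) = ?c (act_first L s x)" if "a \<in> ?c x" for a
  proof -
    have "a - x \<in> tensor_rels R N" using that by (simp add: additive_coset_def)
    from act_first_rels[OF assms this, of s]
    have "act_first L s a - act_first L s x \<in> tensor_rels R N" by simp
    then show ?thesis unfolding tensor_rels_def by (simp only: additive_coset_eq_iff)
  qed
  then have "(\<Union>a\<in>?c x. ?c (act_first L s a)) = (\<Union>a\<in>?c x. ?c (act_first L s x))"
    by (rule SUP_cong[OF refl])
  moreover have "?c x \<noteq> {}"
    using additive_gen_closed(1) unfolding additive_coset_def tensor_rels_def
    by (metis (mono_tags, lifting) cancel_comm_monoid_add_class.diff_cancel empty_iff mem_Collect_eq)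
  ultimately show ?thesis by (simp add: tensor_product_def Let_def)
qed

lemma left_module_tensor_product:
  fixes L :: "'s::ring_1 \<Rightarrow> 'm::ab_group_add \<Rightarrow> 'm" and R :: "'m::ab_group_add \<Rightarrow> 'r::ring_1 \<Rightarrow> 'm"
    and N :: "('r, 'n) module"
  assumes B: "bimodule L R"
  shows "left_module (tensor_product L R N)"
proof -
  let ?T = "tensor_product L R N" and ?K = "tensor_rels R N"
  let ?c = "additive_coset ?K"
  let ?F = "{x. Poly_Mapping.keys x \<subseteq> UNIV \<times> carrier N}"
  have car: "carrier ?T = ?c ` ?F"
    by (simp only: tensor_product_def Let_def partial_object.simps image_def) blast
  have zero: "\<zero>\<^bsub>?T\<^esub> = ?c 0"
    by (simp add: tensor_product_def Let_def additive_coset_def)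
  have add: "?c x \<oplus>\<^bsub>?T\<^esub> ?c y = ?c (x + y)" for x y
    by (simp add: tensor_product_def Let_def tensor_rels_def additive_coset_add)
  have smult: "s \<odot>\<^bsub>?T\<^esub> ?c x = ?c (act_first L s x)" for s x
    by (rule tensor_product_smult[OF B])
  have F0: "0 \<in> ?F" by simp
  have Fadd: "x + y \<in> ?F" if "x \<in> ?F" "y \<in> ?F" for x y
    using that unfolding mem_Collect_eq
    by (intro order_trans[OF Poly_Mapping.keys_add Un_least])
  have Fminus: "- x \<in> ?F" if "x \<in> ?F" for x using that by (simp add: keys_minus)
  have Fact: "act_first L s x \<in> ?F" if "x \<in> ?F" for s x 
    using that unfolding mem_Collect_eq by (rule act_first_keys)
  have Kz: "?c x = ?c y \<longleftrightarrow> x - y \<in> ?K" for x y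
    unfolding tensor_rels_def by (rule additive_coset_eq_iff)
  have carE: "\<exists>a\<in>?F. x = ?c a" if "x \<in> carrier ?T" for x
    using that unfolding car by (elim imageE) blast
  have carI: "?c a \<in> carrier ?T" if "a \<in> ?F" for a
    using that unfolding car by (rule imageI)
  have group: "abelian_group ?T"
  proof (rule abelian_groupI)
    fix x y assume "x \<in> carrier ?T" "y \<in> carrier ?T"
    then obtain a b where a: "a \<in> ?F" "x = ?c a" and b: "b \<in> ?F" "y = ?c b" using carE by meson
    show "x \<oplus>\<^bsub>?T\<^esub> y \<in> carrier ?T"
      unfolding a(2) b(2) add using a(1) b(1) by (intro carI Fadd)
    show "x \<oplus>\<^bsub>?T\<^esub> y = y \<oplus>\<^bsub>?T\<^esub> x"
      unfolding a(2) b(2) add by (simp only: add.commute)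
    fix t assume "t \<in> carrier ?T"
    then obtain d where d: "t = ?c d" using carE by meson
    show "x \<oplus>\<^bsub>?T\<^esub> y \<oplus>\<^bsub>?T\<^esub> t = x \<oplus>\<^bsub>?T\<^esub> (y \<oplus>\<^bsub>?T\<^esub> t)"
      unfolding a(2) b(2) d add by (simp only: add.assoc)
  next
    show "\<zero>\<^bsub>?T\<^esub> \<in> carrier ?T" unfolding zero by (rule carI[OF F0])
  next
    fix x assume "x \<in> carrier ?T"
    then obtain a where a: "a \<in> ?F" "x = ?c a" using carE by meson
    show "\<zero>\<^bsub>?T\<^esub> \<oplus>\<^bsub>?T\<^esub> x = x" unfolding a(2) zero add by simp
    have "?c (- a) \<oplus>\<^bsub>?T\<^esub> x = \<zero>\<^bsub>?T\<^esub>" unfolding a(2) zero add by simp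
    then show "\<exists>y\<in>carrier ?T. y \<oplus>\<^bsub>?T\<^esub> x = \<zero>\<^bsub>?T\<^esub>" using carI[OF Fminus[OF a(1)]] by (rule bexI)
  qed
  have distr: "act_first L (r + s) x - (act_first L r x + act_first L s x) \<in> ?K" if "x \<in> ?F" for r s x
  proof -
    have "Poly_Mapping.keys x \<subseteq> UNIV \<times> carrier N" using that by simp
    then show ?thesis
    proof (induction x rule: frag_induction)
      case zero
      then show ?case by (simp add: tensor_rels_def additive_gen_closed)
    next
      case (one p)
      obtain m n where p: "p = (m, n)" by force
      have "L (r + s) m = L r m + L s m" by (rule bimoduleD[OF B])
      then show ?case using one unfolding p tensor_rels_def
        by (intro additive_gen_closed(3)) (auto simp: diff_diff_eq[symmetric])
    next
      case (diff a b)
      have "act_first L (r + s) (a - b) - (act_first L r (a - b) + act_first L s (a - b))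
        = (act_first L (r + s) a - (act_first L r a + act_first L s a))
          - (act_first L (r + s) b - (act_first L r b + act_first L s b))" by simp
      also have "\<dots> \<in> ?K"
        using diff unfolding tensor_rels_def by (rule additive_gen_closed(2))
      finally show ?case .
    qed
  qed
  have mult: "act_first L (r * s) x = act_first L r (act_first L s x)"
    for r s and x :: "'m \<times> 'n \<Rightarrow>\<^sub>0 int"
  proof (rule frag_induction[of x UNIV])
    fix p :: "'m \<times> 'n"
    show "act_first L (r * s) (frag_of p) = act_first L r (act_first L s (frag_of p))"
      by (cases p) (simp add: bimoduleD[OF B])
  qed simp_all
  have one: "act_first L 1 x = x" for x :: "'m \<times> 'n \<Rightarrow>\<^sub>0 int"
  proof (rule frag_induction[of x UNIV])
    fix p :: "'m \<times> 'n"
    show "act_first L 1 (frag_of p) = frag_of p"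
      by (cases p) (simp add: bimoduleD[OF B])
  qed simp_all
  show ?thesis
  proof (intro left_module.intro group left_module_axioms.intro)
    fix x and r s :: 's
    assume "x \<in> carrier ?T"
    then obtain a where a: "a \<in> ?F" "x = ?c a" using carE by meson
    show "r \<odot>\<^bsub>?T\<^esub> x \<in> carrier ?T"
      unfolding a(2) smult using a(1) by (intro carI Fact)
    show "(r + s) \<odot>\<^bsub>?T\<^esub> x = r \<odot>\<^bsub>?T\<^esub> x \<oplus>\<^bsub>?T\<^esub> s \<odot>\<^bsub>?T\<^esub> x"
      unfolding a(2) smult add Kz by (rule distr[OF a(1)])
    show "(r * s) \<odot>\<^bsub>?T\<^esub> x = r \<odot>\<^bsub>?T\<^esub> (s \<odot>\<^bsub>?T\<^esub> x)" unfolding a(2) smult mult ..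
    show "1 \<odot>\<^bsub>?T\<^esub> x = x" unfolding a(2) smult one ..
  next
    fix x y and r :: 's
    assume "x \<in> carrier ?T" "y \<in> carrier ?T"
    then obtain a b where a: "x = ?c a" "y = ?c b" using carE by meson
    show "r \<odot>\<^bsub>?T\<^esub> (x \<oplus>\<^bsub>?T\<^esub> y) = r \<odot>\<^bsub>?T\<^esub> x \<oplus>\<^bsub>?T\<^esub> r \<odot>\<^bsub>?T\<^esub> y"
      unfolding a smult add act_first_simps ..
  qed
qed


section \<open>Verma modules and the completion functor\<close>

definition weight_module :: "complex \<Rightarrow> complex \<Rightarrow> (schr_borel uea, complex) module" where
  "weight_module l1 l2 =
     \<lparr>carrier = UNIV, mult = undefined, one = undefined, zero = 0, add = (+),
      smult = (\<lambda>b v. uea_lift (borel_weight l1 l2) b * v)\<rparr>"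

definition verma :: "complex \<Rightarrow> complex \<Rightarrow> (schr uea, (schr uea \<times> complex \<Rightarrow>\<^sub>0 int) set) module" where
  "verma l1 l2 = tensor_product (*) (\<lambda>u b. u * borel_incl b) (weight_module l1 l2)"

lemma left_module_weight_module: "left_module (weight_module l1 l2)"
proof -
  have "abelian_group (weight_module l1 l2)"
  proof (rule abelian_groupI)
    fix x :: complex
    show "\<exists>y\<in>carrier (weight_module l1 l2). y \<oplus>\<^bsub>weight_module l1 l2\<^esub> x = \<zero>\<^bsub>weight_module l1 l2\<^esub>"
      by (rule bexI[of _ "- x"]) (simp_all add: weight_module_def)
  qed (simp_all add: weight_module_def)
  then show ?thesis
    by (intro left_module.intro left_module_axioms.intro)
      (simp_all add: weight_module_def uea_lift_hom[OF lie_morphism_borel_weight] algebra_simps)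
qed

lemma bimodule_verma: "bimodule (*) (\<lambda>u b. u * borel_incl b)"
  unfolding bimodule_def borel_incl_def
  by (simp add: uea_lift_hom[OF lie_morphism_borel_incl] algebra_simps)

text \<open>Complex scalars act on a module through \<open>cscal\<close>.\<close>

definition cspan :: "('r::complex_algebra, 'm) module \<Rightarrow> 'm set \<Rightarrow> 'm set" where
  "cspan M B = \<Inter>{W. B \<subseteq> W \<and> W \<subseteq> carrier M \<and> \<zero>\<^bsub>M\<^esub> \<in> W \<and>
     (\<forall>x\<in>W. \<forall>y\<in>W. x \<oplus>\<^bsub>M\<^esub> y \<in> W) \<and> (\<forall>c. \<forall>x\<in>W. cscal c \<odot>\<^bsub>M\<^esub> x \<in> W)}"

definition finite_dim :: "('r::complex_algebra, 'm) module \<Rightarrow> 'm set \<Rightarrow> bool" where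
  "finite_dim M W \<longleftrightarrow> (\<exists>B. finite B \<and> B \<subseteq> W \<and> W \<subseteq> cspan M B)"

definition poly_e :: "schr uea set" where
  "poly_e = {\<Sum>k<n. cscal (c k) * uea_gen sE ^ k | (n :: nat) c. True}"

definition EA :: "(schr uea, 'm) module \<Rightarrow> (schr uea, (sf \<times> 'm \<Rightarrow>\<^sub>0 int) set) module" where
  "EA M = (let T = tensor_product sf_left sf_right M in
     T\<lparr>carrier := {x \<in> carrier T. finite_dim T ((\<lambda>u. u \<odot>\<^bsub>T\<^esub> x) ` poly_e)}\<rparr>)"

definition V_module ::
    "nat \<Rightarrow> complex \<Rightarrow> (schr uea, (sf \<times> (schr uea \<times> complex \<Rightarrow>\<^sub>0 int) set \<Rightarrow>\<^sub>0 int) set) module" where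
  "V_module n l2 = EA (verma (of_nat n - 1) l2)"

end

theory Submission
  imports Defs "HOL-Computational_Algebra.Fundamental_Theorem_Algebra"
begin

text \<open>For \<open>\<lambda>\<^sub>2 \<noteq> 0\<close> the quotient \<open>U/(z - \<lambda>\<^sub>2)\<close> is the tensor product of \<open>U(sl\<^sub>2)\<close> with a Weyl algebra,
  and all modules in question have the same central character: the Casimir element of this \<open>sl\<^sub>2\<close> acts as
  on the Verma module of highest weight \<open>n - 1/2\<close>. As \<open>n - 1/2\<close> is not an integer, the ideal \<open>I\<close>
  generated by \<open>z - \<lambda>\<^sub>2\<close> and by the Casimir element minus its value is maximal: reducing an element of a
  larger ideal by commutators with \<open>p\<close> and \<open>q\<close> and by \<open>h\<close>-weights leads to an ideal of polynomials
  in \<open>h\<close>, whose common roots would come in a chain joining roots of two polynomials that do not differ by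
  an even number of the right sign. Central elements killing \<open>\<Delta>(n-1,\<lambda>\<^sub>2)\<close> also kill
  \<open>S\<^sub>f \<otimes> \<Delta>(n-1,\<lambda>\<^sub>2)\<close>, so \<open>I\<close> is contained in all three annihilators, and equality only requires the
  modules to be nonzero. For \<open>V(n,\<lambda>\<^sub>2)\<close> this needs an \<open>e\<close>-finite vector, which is \<open>f\<^sup>-\<^sup>1 \<otimes> w\<close> for a
  singular vector \<open>w\<close> of weight \<open>-n-2\<close>.\<close>

section \<open>Congruences modulo a two-sided ideal\<close>

text \<open>No PBW theorem enters. Modulo \<open>I\<close> every element is brought to a normal
  form, and this uses spanning only; independence is replaced by the hypothesis
  \<open>1 \<notin> J\<close>: in a proper ideal \<open>J\<close> containing \<open>I\<close>, a
  normal form can lie only if all its coefficients vanish. For the same reason nonvanishing of the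
  modules is certified by functionals built from an explicit action on arrays.

  The commuting copy of sl2 has denominators \<open>2z\<close>, so all computations in
  \<open>U\<close> are done with \<open>2z\<close> times its generators, and division by
  \<open>2 * l\<close> happens only modulo \<open>z - l\<close>.

  The vector generating \<open>\<Delta>(l1, l)\<close> has weight \<open>l1 + 1/2\<close> for this
  sl2. The two weights in the statement become \<open>n - 1/2\<close> and \<open>-n - 3/2\<close>,
  which \<open>m \<mapsto> -m - 2\<close> exchanges; hence the common Casimir value.
  Half-integrality enters once: two roots that would have to differ by a nonzero even number differ
  by \<open>0\<close> or by \<open>\<plusminus>(2n + 1)\<close> after the shift by 2.\<close>

definition pev :: "'a::complex_algebra \<Rightarrow> complex poly \<Rightarrow> 'a" where
  "pev x g = fold_coeffs (\<lambda>a s. cscal a + x * s) g 0"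

lemma pev_0 [simp]: "pev x 0 = 0"
  by (simp add: pev_def)

lemma pev_pCons [simp]: "pev x (pCons a g) = cscal a + x * pev x g"
  by (cases "g = 0 \<and> a = 0") (auto simp: pev_def fold_coeffs_pCons_eq)

lemma pev_1 [simp]: "pev x 1 = 1"
  by (simp add: one_pCons cscal_one)

lemma pev_add: "pev x (g + k) = pev x g + pev x k"
  by (induction g k rule: poly_induct2) (simp_all add: cscal_add algebra_simps)

lemma cscal_left_commute: "y * (cscal c * x) = cscal c * (y * x)"
  for x y :: "'a::complex_algebra"
  by (metis cscal_commute mult.assoc)

lemma pev_smult: "pev x (smult c g) = cscal c * pev x g"
  by (induction g) (simp_all add: cscal_mult cscal_left_commute[of x] distrib_left)

lemma pev_mult: "pev x (g * k) = pev x g * pev x k"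
  by (induction g) (simp_all add: pev_add pev_smult distrib_right mult.assoc)

lemma pev_shift: "pev x (pcompose g [:c, 1:]) = pev (x + cscal c) g"
proof (induction g)
  case (pCons a g)
  have c: "pev x [:c, 1:] = x + cscal c" by (simp add: cscal_one add.commute)
  have a: "pev x [:a:] = cscal a" by simp
  show ?case unfolding pcompose_pCons pev_add pev_mult c a pCons by simp
qed simp

lemma cscal_uminus: "cscal (- c) = - cscal c"
  using cscal_add[of c "- c"] by (simp add: eq_neg_iff_add_eq_0 add.commute)

lemma cscal_diff: "cscal (c - d) = cscal c - cscal d"
  using cscal_add[of c "- d"] by (simp add: cscal_uminus)

lemma cscal_inverse_cancel: "c \<noteq> 0 \<Longrightarrow> cscal (inverse c) * (cscal c * x) = x"
  by (simp flip: mult.assoc cscal_mult add: cscal_one)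

lemma pcompose_shift_nonzero: "g \<noteq> 0 \<Longrightarrow> pcompose g [:c, 1:] \<noteq> 0"
  for g :: "'a::idom poly"
  using pcompose_eq_0[of g "[:c, 1:]"] by auto

locale ideal_cong =
  fixes J :: "'a::complex_algebra set"
  assumes J: "two_sided_ideal J"
begin

definition cong :: "'a \<Rightarrow> 'a \<Rightarrow> bool" (infix "\<simeq>" 50) where
  "a \<simeq> b \<longleftrightarrow> a - b \<in> J"

lemmas J_simps = two_sided_idealD[OF J]

lemma cong_refl [simp]: "a \<simeq> a"
  by (simp add: cong_def J_simps)

lemma cong_sym: "a \<simeq> b \<Longrightarrow> b \<simeq> a"
  using J_simps(5)[of "a - b"] by (simp add: cong_def)

lemma cong_trans [trans]: "a \<simeq> b \<Longrightarrow> b \<simeq> c \<Longrightarrow> a \<simeq> c"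
  using J_simps(2)[of "a - b" "b - c"] by (simp add: cong_def)

lemma cong_add: "a \<simeq> b \<Longrightarrow> c \<simeq> d \<Longrightarrow> a + c \<simeq> b + d"
  using J_simps(2)[of "a - b" "c - d"] by (simp add: cong_def algebra_simps)

lemma cong_diff: "a \<simeq> b \<Longrightarrow> c \<simeq> d \<Longrightarrow> a - c \<simeq> b - d"
  using J_simps(6)[of "a - b" "c - d"] by (simp add: cong_def algebra_simps)

lemma cong_mult: "a \<simeq> b \<Longrightarrow> c \<simeq> d \<Longrightarrow> a * c \<simeq> b * d"
proof -
  have "a * c - b * d = (a - b) * c + b * (c - d)" by (simp add: algebra_simps)
  then show "a \<simeq> b \<Longrightarrow> c \<simeq> d \<Longrightarrow> a * c \<simeq> b * d" unfolding cong_def by (simp add: J_simps)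
qed

lemma cong_left: "c \<simeq> d \<Longrightarrow> a * c \<simeq> a * d"
  by (simp add: cong_mult)

lemma cong_right: "a \<simeq> b \<Longrightarrow> a * c \<simeq> b * c"
  by (simp add: cong_mult)

lemma cong_sum: "(\<And>k. k \<in> S \<Longrightarrow> x k \<simeq> y k) \<Longrightarrow> sum x S \<simeq> sum y S"
  by (induction S rule: infinite_finite_induct) (simp_all add: cong_add)

lemma cong_0_iff: "a \<simeq> 0 \<longleftrightarrow> a \<in> J"
  by (simp add: cong_def)

lemma cong_mem: "a \<simeq> b \<Longrightarrow> a \<in> J \<longleftrightarrow> b \<in> J"
  by (metis cong_0_iff cong_sym cong_trans)

lemma cscal_mem_iff: "c \<noteq> 0 \<Longrightarrow> cscal c * a \<in> J \<longleftrightarrow> a \<in> J"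
  using J_simps(3) cscal_inverse_cancel by metis

text \<open>Applied with \<open>x' = x + cscal c\<close>: a weight vector \<open>y\<close> crosses a
  polynomial in \<open>x\<close> at the price of a shift of its argument.\<close>

lemma pev_intertwine:
  assumes "x * y \<simeq> y * x'"
  shows "pev x g * y \<simeq> y * pev x' g"
proof (induction g)
  case (pCons a g)
  have "x * pev x g * y \<simeq> x * (y * pev x' g)"
    unfolding mult.assoc by (rule cong_left[OF pCons(2)])
  also have "\<dots> \<simeq> (y * x') * pev x' g"
    unfolding mult.assoc[symmetric] by (rule cong_right[OF assms])
  finally show ?case
    by (simp add: distrib_left distrib_right mult.assoc cong_add cscal_commute)
qed simp

lemma cong_commute_power:
  assumes "h * y \<simeq> y * (h + cscal s)"
  shows "h * y ^ i \<simeq> y ^ i * (h + cscal (of_nat i * s))"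
proof (induction i)
  case (Suc i)
  have "h * y ^ Suc i \<simeq> y * (h + cscal s) * y ^ i"
    using cong_right[OF assms] by (simp add: mult.assoc)
  also have "\<dots> = y * (h * y ^ i) + cscal s * y ^ Suc i"
    by (simp add: algebra_simps cscal_left_commute[of y])
  also have "\<dots> \<simeq> y * (y ^ i * (h + cscal (of_nat i * s))) + cscal s * y ^ Suc i"
    by (intro cong_add cong_left Suc cong_refl)
  also have "\<dots> = y ^ Suc i * (h + cscal (of_nat (Suc i) * s))"
    by (simp add: algebra_simps cscal_add cscal_commute)
  finally show ?case .
qed simp

lemma pev_commute_power:
  assumes "h * y \<simeq> y * (h + cscal s)"
  shows "pev h g * y ^ i \<simeq> y ^ i * pev h (pcompose g [:of_nat i * s, 1:])"
  unfolding pev_shift by (rule pev_intertwine[OF cong_commute_power[OF assms]])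

text \<open>The innermost factor \<open>x * y\<close> becomes \<open>A(h)\<close>, which then moves
  right across \<open>y ^ i\<close>. Each round multiplies \<open>R\<close> by a shift of
  \<open>A\<close>, and nonzero polynomials have nonzero product.\<close>

lemma power_mult_power_cong:
  assumes h: "h * y \<simeq> y * (h + cscal s)" and xy: "x * y \<simeq> pev h A" and A: "A \<noteq> 0"
  shows "\<exists>R. R \<noteq> 0 \<and> x ^ i * y ^ i \<simeq> pev h R"
proof (induction i)
  case 0
  show ?case by (rule exI[of _ 1]) simp
next
  case (Suc i)
  then obtain R where R: "R \<noteq> 0" "x ^ i * y ^ i \<simeq> pev h R" by blast
  let ?A = "pcompose A [:of_nat i * s, 1:]"
  have "x ^ Suc i * y ^ Suc i = x ^ i * (x * y) * y ^ i"
    unfolding power_Suc2[of x] by (simp add: mult.assoc)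
  also have "\<dots> \<simeq> x ^ i * (pev h A * y ^ i)"
    unfolding mult.assoc[of "x ^ i"] by (intro cong_left cong_right xy)
  also have "\<dots> \<simeq> x ^ i * (y ^ i * pev h ?A)"
    by (intro cong_left pev_commute_power h)
  also have "\<dots> \<simeq> pev h R * pev h ?A"
    unfolding mult.assoc[symmetric] by (intro cong_right R)
  finally have "x ^ Suc i * y ^ Suc i \<simeq> pev h (R * ?A)" by (simp add: pev_mult)
  then show ?case using R(1) pcompose_shift_nonzero[OF A] by (metis mult_eq_0_iff)
qed

text \<open>The operator \<open>ad h - w m\<close> preserves the ideal, kills the summand at
  \<open>m\<close> modulo the ideal and scales every other summand by the nonzero number
  \<open>w k - w m\<close>.\<close>

lemma eigen_separation:
  assumes "finite S" "\<And>k. k \<in> S \<Longrightarrow> h * x k - x k * h \<simeq> cscal (w k) * x k" "inj_on w S"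
    "sum x S \<in> J" "k \<in> S"
  shows "x k \<in> J"
  using assms
proof (induction S arbitrary: x k rule: finite_induct)
  case (insert m S)
  let ?s = "x m + sum x S"
  let ?y = "\<lambda>k. cscal (w k - w m) * x k"
  have eig: "h * ?y k - ?y k * h \<simeq> cscal (w k) * ?y k" if "k \<in> S" for k
  proof -
    have "h * ?y k - ?y k * h = cscal (w k - w m) * (h * x k - x k * h)"
      by (simp add: right_diff_distrib mult.assoc cscal_left_commute[of h])
    also have "\<dots> \<simeq> cscal (w k - w m) * (cscal (w k) * x k)"
      using insert.prems(1) that by (intro cong_left) simp
    finally show ?thesis by (subst cscal_left_commute)
  qed
  have s: "?s \<in> J" using insert.prems(3) insert.hyps by simp
  then have "h * ?s - ?s * h - cscal (w m) * ?s \<in> J" by (simp only: J_simps)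
  moreover have "h * ?s - ?s * h - cscal (w m) * ?s
      = (h * x m - x m * h - cscal (w m) * x m) + (\<Sum>k\<in>S. h * x k - x k * h) - cscal (w m) * sum x S"
    by (simp add: algebra_simps sum_subtractf sum_distrib_left sum_distrib_right)
  moreover have "\<dots> \<simeq> 0 + (\<Sum>k\<in>S. cscal (w k) * x k) - cscal (w m) * sum x S"
    using insert.prems(1) by (intro cong_diff cong_add cong_sum cong_refl) (auto simp: cong_def)
  moreover have "0 + (\<Sum>k\<in>S. cscal (w k) * x k) - cscal (w m) * sum x S = sum ?y S"
    by (simp add: sum_distrib_left cscal_diff left_diff_distrib sum_subtractf)
  ultimately have "sum ?y S \<in> J" using cong_mem by metis
  then have "?y k \<in> J" if "k \<in> S" for k
    using insert.IH[of ?y] eig that insert.prems(2) by (auto simp: inj_on_def)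
  moreover have "w k \<noteq> w m" if "k \<in> S" for k
    using insert.prems(2) insert.hyps(2) that by (auto simp: inj_on_def)
  ultimately have S: "x k \<in> J" if "k \<in> S" for k using cscal_mem_iff that by fastforce
  have "sum x S \<simeq> (\<Sum>k\<in>S. 0)" using S by (intro cong_sum) (simp add: cong_def)
  then have "sum x S \<in> J" by (simp add: cong_0_iff)
  with s have "x m \<in> J" using J_simps(6) by (metis add_diff_cancel_right')
  then show ?case using S insert.prems(4) by blast
qed simp

end

section \<open>Normal forms modulo an ideal for a raising and a lowering element over
  \<open>\<complex>[h]\<close>\<close>

definition ladder :: "'a::monoid_mult \<Rightarrow> 'a \<Rightarrow> int \<Rightarrow> 'a" where
  "ladder E F k = (if k \<ge> 0 then E ^ nat k else F ^ nat (- k))"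

lemma ladder_cases [case_names up down]:
  assumes "\<And>i. P (int i)" "\<And>i. P (- int (Suc i))"
  shows "P k"
  using assms by (metis int_cases)

lemma ladder_simps [simp]:
  "ladder E F 0 = 1" "ladder E F (int i) = E ^ i" "ladder E F (- int i) = F ^ i"
  by (auto simp: ladder_def)

text \<open>These are the relations of a generalized Weyl algebra, imposed modulo \<open>J\<close>.
  The locale is later interpreted twice, for \<open>I\<close> to obtain spanning and for a larger
  ideal to force coefficients to vanish.\<close>

locale sl2_cong = ideal_cong J for J :: "'a::complex_algebra set" +
  fixes h E F :: 'a and A B :: "complex poly"
  assumes hE: "h * E \<simeq> E * (h + cscal 2)" and hF: "h * F \<simeq> F * (h + cscal (- 2))"
    and FE: "F * E \<simeq> pev h A" and EF: "E * F \<simeq> pev h B"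
begin

abbreviation "Y \<equiv> ladder E F"

lemma pev_ladder: "pev h g * Y k \<simeq> Y k * pev h (pcompose g [:2 * of_int k, 1:])"
proof (induction k rule: ladder_cases)
  case (up i)
  show ?case using pev_commute_power[OF hE, of g i] by (simp add: mult.commute)
next
  case (down i)
  show ?case using pev_commute_power[OF hF, of g "Suc i"]
    by (simp only: ladder_simps) (simp add: mult.commute)
qed

lemma h_ladder: "h * Y k \<simeq> Y k * (h + cscal (2 * of_int k))"
  using pev_ladder[of "[:0, 1:]" k] by (simp add: cscal_one pcompose_pCons add.commute)

lemma ladder_opposite:
  assumes "A \<noteq> 0" "B \<noteq> 0"
  shows "\<exists>R. R \<noteq> 0 \<and> Y (- k) * Y k \<simeq> pev h R"
proof (induction k rule: ladder_cases)
  case (up i)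
  show ?case using power_mult_power_cong[OF hE FE assms(1)] by simp
next
  case (down i)
  have "\<exists>R. R \<noteq> 0 \<and> E ^ Suc i * F ^ Suc i \<simeq> pev h R"
    by (rule power_mult_power_cong[OF hF EF assms(2)])
  then show ?case unfolding minus_minus ladder_simps .
qed

text \<open>Only existence of a normal form is recorded; in place of uniqueness stands
  \<open>ladder_sum_mem_zero\<close>.\<close>

definition nf :: "'a set" where
  "nf = {u. \<exists>S g. finite S \<and> u \<simeq> (\<Sum>k\<in>S. Y k * pev h (g k))}"

lemma nf_cong: "u \<simeq> v \<Longrightarrow> v \<in> nf \<Longrightarrow> u \<in> nf"
  unfolding nf_def using cong_trans by blast

lemma nf_single: "Y k * pev h g \<in> nf"
proof -
  have "Y k * pev h g \<simeq> (\<Sum>k\<in>{k}. Y k * pev h ((\<lambda>_. g) k))" by simp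
  then show ?thesis unfolding nf_def mem_Collect_eq by (intro exI[of _ "{k}"] exI[of _ "\<lambda>_. g"]) simp
qed

lemma nf_1: "1 \<in> nf"
  using nf_single[of 0 1] by simp

lemma nf_add:
  assumes "u \<in> nf" "v \<in> nf"
  shows "u + v \<in> nf"
proof -
  obtain S g where S: "finite S" "u \<simeq> (\<Sum>k\<in>S. Y k * pev h (g k))" using assms(1) nf_def by auto
  obtain T k where T: "finite T" "v \<simeq> (\<Sum>i\<in>T. Y i * pev h (k i))" using assms(2) nf_def by auto
  let ?g = "\<lambda>i. (if i \<in> S then g i else 0) + (if i \<in> T then k i else 0)"
  have "(\<Sum>i\<in>S. Y i * pev h (g i)) = (\<Sum>i\<in>S\<union>T. Y i * pev h (if i \<in> S then g i else 0))"
    using S T by (intro sum.mono_neutral_cong_left) auto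
  moreover have "(\<Sum>i\<in>T. Y i * pev h (k i)) = (\<Sum>i\<in>S\<union>T. Y i * pev h (if i \<in> T then k i else 0))"
    using S T by (intro sum.mono_neutral_cong_left) auto
  ultimately have "u + v \<simeq> (\<Sum>i\<in>S\<union>T. Y i * pev h (?g i))"
    using cong_add[OF S(2) T(2)] by (simp add: pev_add distrib_left sum.distrib)
  then show ?thesis unfolding nf_def mem_Collect_eq using S T
    by (intro exI[of _ "S \<union> T"] exI[of _ ?g]) simp
qed

lemma nf_sum: "(\<And>k. k \<in> S \<Longrightarrow> x k \<in> nf) \<Longrightarrow> sum x S \<in> nf"
  using nf_single[of 0 0] by (induction S rule: infinite_finite_induct) (auto intro: nf_add)

lemma nf_left:
  assumes "u \<in> nf" and *: "\<And>k g. x * (Y k * pev h g) \<in> nf"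
  shows "x * u \<in> nf"
proof -
  obtain S g where "u \<simeq> (\<Sum>k\<in>S. Y k * pev h (g k))" using assms(1) nf_def by auto
  then have "x * u \<simeq> (\<Sum>k\<in>S. x * (Y k * pev h (g k)))"
    unfolding sum_distrib_left[symmetric] by (rule cong_left)
  then show ?thesis by (rule nf_cong) (intro nf_sum *)
qed

lemma nf_pev:
  assumes "u \<in> nf"
  shows "pev h p * u \<in> nf"
proof (rule nf_left[OF assms])
  fix k g
  have "pev h p * (Y k * pev h g) \<simeq> Y k * pev h (pcompose p [:2 * of_int k, 1:] * g)"
    unfolding pev_mult mult.assoc[symmetric] by (rule cong_right[OF pev_ladder])
  then show "pev h p * (Y k * pev h g) \<in> nf" by (rule nf_cong) (rule nf_single)
qed

lemma nf_h: "u \<in> nf \<Longrightarrow> h * u \<in> nf"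
  using nf_pev[of u "[:0, 1:]"] by (simp add: cscal_one)

lemma nf_scalar: "u \<in> nf \<Longrightarrow> cscal c * u \<in> nf"
  using nf_pev[of u "[:c:]"] by simp

lemma nf_E:
  assumes "u \<in> nf"
  shows "E * u \<in> nf"
proof (rule nf_left[OF assms])
  fix k g
  show "E * (Y k * pev h g) \<in> nf"
  proof (induction k rule: ladder_cases)
    case (up i)
    show ?case using nf_single[of "int (Suc i)" g] by (simp only: ladder_simps power_Suc mult.assoc)
  next
    case (down i)
    have "E * (Y (- int (Suc i)) * pev h g) = (E * F) * (F ^ i * pev h g)"
      by (simp only: ladder_simps power_Suc mult.assoc)
    also have "\<dots> \<simeq> pev h B * (F ^ i * pev h g)" by (rule cong_right[OF EF])
    finally show ?case by (rule nf_cong) (intro nf_pev nf_single[of "- int i", simplified])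
  qed
qed

lemma nf_F:
  assumes "u \<in> nf"
  shows "F * u \<in> nf"
proof (rule nf_left[OF assms])
  fix k g
  show "F * (Y k * pev h g) \<in> nf"
  proof (induction k rule: ladder_cases)
    case (down i)
    show ?case using nf_single[of "- int (Suc (Suc i))" g]
      by (simp only: ladder_simps power_Suc mult.assoc)
  next
    case (up i)
    show ?case
    proof (cases i)
      case 0
      then show ?thesis using nf_single[of "- int (Suc 0)" g] unfolding ladder_simps by simp
    next
      case (Suc j)
      have "F * (Y (int i) * pev h g) = (F * E) * (E ^ j * pev h g)"
        unfolding Suc by (simp only: ladder_simps power_Suc mult.assoc)
      also have "\<dots> \<simeq> pev h A * (E ^ j * pev h g)" by (rule cong_right[OF FE])
      finally show ?thesis by (rule nf_cong) (intro nf_pev nf_single[of "int j", simplified])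
    qed
  qed
qed

text \<open>A nonzero ideal of \<open>\<complex>[h]\<close> stable under both shifts twisted by \<open>A\<close> and \<open>B\<close> has a common
  root, and the chain of common roots through it must end at a root of \<open>B\<close> below and at a root of
  \<open>A\<close> above.\<close>

lemma pev_mem_zero:
  assumes 1: "1 \<notin> J" and AB: "\<And>r m. poly B r = 0 \<Longrightarrow> poly A (r + 2 * of_nat m) \<noteq> 0"
    and g: "pev h g \<in> J"
  shows "g = 0"
proof (rule ccontr)
  assume "g \<noteq> 0"
  define G where "G = {g. pev h g \<in> J}"
  define Z where "Z = {r. \<forall>g\<in>G. poly g r = 0}"
  have "g \<in> G" using g G_def by simp
  then have "Z \<subseteq> {r. poly g r = 0}" by (auto simp: Z_def)
  then have "finite Z" using poly_roots_finite[OF \<open>g \<noteq> 0\<close>] finite_subset by blast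
  \<comment> \<open>Division with remainder makes an element of least degree a generator of the
    ideal \<open>G\<close>, so each of its roots is a common root.\<close>
  obtain d where d: "d \<in> G" "d \<noteq> 0" and min: "\<And>k. k \<in> G \<Longrightarrow> k \<noteq> 0 \<Longrightarrow> degree d \<le> degree k"
    using arg_min_nat_lemma[of "\<lambda>k. k \<in> G \<and> k \<noteq> 0" g degree] \<open>g \<in> G\<close> \<open>g \<noteq> 0\<close> by blast
  have dvd: "d dvd k" if "k \<in> G" for k
  proof (rule ccontr)
    assume "\<not> d dvd k"
    then have nz: "k mod d \<noteq> 0" by (simp add: dvd_eq_mod_eq_0)
    have "k mod d = k + smult (-1) (k div d) * d"
      by (simp add: minus_div_mult_eq_mod[symmetric])
    then have "pev h (k mod d) = pev h k + pev h (smult (-1) (k div d)) * pev h d"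
      by (simp only: pev_add pev_mult)
    then have "k mod d \<in> G" using d(1) that unfolding G_def by (simp add: J_simps)
    from min[OF this nz] show False using degree_mod_less[OF d(2), of k] nz by simp
  qed
  have "\<not> constant (poly d)"
  proof
    assume "constant (poly d)"
    then have "degree d = 0" by (simp add: constant_degree)
    then obtain c where c: "d = [:c:]" by (metis degree_eq_zeroE)
    then have "cscal c * 1 \<in> J" using d(1) by (simp add: G_def)
    then show False using c d(2) 1 cscal_mem_iff[of c 1] by auto
  qed
  then obtain r where "poly d r = 0" using fundamental_theorem_of_algebra by blast
  then have "poly k r = 0" if "k \<in> G" for k using dvd[OF that] by (metis dvdE mult_zero_left poly_mult)
  then have r: "r \<in> Z" by (simp add: Z_def)
  \<comment> \<open>Sandwiching \<open>k(h)\<close> between \<open>E\<close> and \<open>F\<close>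
    gives \<open>B(h) * k(h - 2)\<close>, again in \<open>G\<close>; evaluating at the common root
    \<open>s\<close> gives the alternative.\<close>
  have down: "poly B s = 0 \<or> s - 2 \<in> Z" if "s \<in> Z" for s
  proof -
    have "poly k (s - 2) * poly B s = 0" if "k \<in> G" for k
    proof -
      have "E * pev h k * F \<simeq> E * (F * pev (h + cscal (- 2)) k)"
        unfolding mult.assoc by (intro cong_left pev_intertwine hF)
      also have "\<dots> \<simeq> pev h B * pev h (pcompose k [:- 2, 1:])"
        unfolding mult.assoc[symmetric] pev_shift by (intro cong_right EF)
      finally have "B * pcompose k [:- 2, 1:] \<in> G"
        using that unfolding G_def by (auto simp: pev_mult J_simps cong_mem[symmetric])
      then show ?thesis using \<open>s \<in> Z\<close> by (auto simp: Z_def poly_pcompose)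
    qed
    then show ?thesis by (auto simp: Z_def)
  qed
  have up: "poly A s = 0 \<or> s + 2 \<in> Z" if "s \<in> Z" for s
  proof -
    have "poly k (s + 2) * poly A s = 0" if "k \<in> G" for k
    proof -
      have "F * pev h k * E \<simeq> F * (E * pev (h + cscal 2) k)"
        unfolding mult.assoc by (intro cong_left pev_intertwine hE)
      also have "\<dots> \<simeq> pev h A * pev h (pcompose k [:2, 1:])"
        unfolding mult.assoc[symmetric] pev_shift by (intro cong_right FE)
      finally have "A * pcompose k [:2, 1:] \<in> G"
        using that unfolding G_def by (auto simp: pev_mult J_simps cong_mem[symmetric])
      then show ?thesis using \<open>s \<in> Z\<close> by (auto simp: Z_def poly_pcompose add.commute)
    qed
    then show ?thesis by (auto simp: Z_def)
  qed
  have chain: "\<exists>m::nat. r + of_nat m * t \<in> Z \<and> r + of_nat (Suc m) * t \<notin> Z" if "t \<noteq> 0" for t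
  proof (rule ccontr)
    assume no: "\<not> ?thesis"
    have "r + of_nat m * t \<in> Z" for m :: nat
      using no r by (induction m) auto
    then have "range (\<lambda>m::nat. r + of_nat m * t) \<subseteq> Z" by auto
    then have "finite (range (\<lambda>m::nat. r + of_nat m * t))" using \<open>finite Z\<close> finite_subset by blast
    moreover have "inj (\<lambda>m::nat. r + of_nat m * t)" using that by (auto simp: inj_on_def)
    ultimately show False using finite_imageD infinite_UNIV_nat by blast
  qed
  obtain m where m: "r + of_nat m * (- 2) \<in> Z" "r + of_nat (Suc m) * (- 2) \<notin> Z"
    using chain[of "- 2"] by auto
  obtain l where l: "r + of_nat l * 2 \<in> Z" "r + of_nat (Suc l) * 2 \<notin> Z" using chain[of 2] by auto
  have "poly B (r + of_nat m * (- 2)) = 0" using down[OF m(1)] m(2) by (auto simp: algebra_simps)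
  moreover have "poly A (r + of_nat l * 2) = 0" using up[OF l(1)] l(2) by (auto simp: algebra_simps)
  moreover have "r + of_nat l * 2 = r + of_nat m * (- 2) + 2 * of_nat (m + l)"
    by (simp add: algebra_simps)
  ultimately show False using AB by metis
qed

text \<open>Separation by \<open>h\<close>-weights isolates \<open>Y k * g k\<close>. Left
  multiplication by \<open>Y (- k)\<close> turns it into the polynomial \<open>R * g k\<close> with
  \<open>R \<noteq> 0\<close>, to which \<open>pev_mem_zero\<close> applies.\<close>

lemma ladder_sum_mem_zero:
  assumes "1 \<notin> J" "\<And>r m. poly B r = 0 \<Longrightarrow> poly A (r + 2 * of_nat m) \<noteq> 0" "A \<noteq> 0" "B \<noteq> 0"
    and S: "finite S" "(\<Sum>k\<in>S. Y k * pev h (g k)) \<in> J" "k \<in> S"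
  shows "g k = 0"
proof -
  have eig: "h * (Y k * pev h (g k)) - Y k * pev h (g k) * h
      \<simeq> cscal (2 * of_int k) * (Y k * pev h (g k))" for k
  proof -
    have hg: "pev h (g k) * h = h * pev h (g k)"
      using pev_mult[of h "g k" "[:0, 1:]"] pev_mult[of h "[:0, 1:]" "g k"]
      by (simp add: cscal_one mult.commute)
    have "h * Y k * pev h (g k) \<simeq> Y k * (h + cscal (2 * of_int k)) * pev h (g k)"
      by (rule cong_right[OF h_ladder])
    then have "h * Y k * pev h (g k) - Y k * pev h (g k) * h
        \<simeq> Y k * (h + cscal (2 * of_int k)) * pev h (g k) - Y k * pev h (g k) * h"
      by (rule cong_diff) simp
    then show ?thesis
      by (simp add: mult.assoc hg distrib_left distrib_right cscal_left_commute[of "Y k"])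
  qed
  have "Y k * pev h (g k) \<in> J"
    by (rule eigen_separation[OF S(1) eig _ S(2,3)]) (simp add: inj_on_def)
  then have "Y (- k) * Y k * pev h (g k) \<in> J" by (simp add: mult.assoc J_simps)
  moreover obtain R where R: "R \<noteq> 0" "Y (- k) * Y k \<simeq> pev h R"
    using ladder_opposite assms(3,4) by blast
  ultimately have "pev h (R * g k) \<in> J"
    unfolding pev_mult using cong_mem[OF cong_right[OF R(2)]] by blast
  from pev_mem_zero[OF assms(1,2) this] R(1) show ?thesis by simp
qed

end

section \<open>Maximality of the ideal of a central character\<close>

abbreviation eU :: "schr uea" where "eU \<equiv> uea_gen sE"
abbreviation hU :: "schr uea" where "hU \<equiv> uea_gen sH"
abbreviation pU :: "schr uea" where "pU \<equiv> uea_gen sP"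
abbreviation qU :: "schr uea" where "qU \<equiv> uea_gen sQ"
abbreviation zU :: "schr uea" where "zU \<equiv> uea_gen sZ"

lemma
  fixes x y :: "'g::lie_algebra"
  shows uea_gen_add: "uea_gen (x + y) = uea_gen x + uea_gen y"
    and uea_gen_lscale: "uea_gen (lscale c x) = cscal c * uea_gen x"
    and uea_gen_commute: "uea_gen x * uea_gen y = uea_gen y * uea_gen x + uea_gen (lbr x y)"
  using lie_morphism_uea_gen[where 'a = 'g] by (simp_all add: lie_morphism_def)

lemma uea_gen_uminus: "uea_gen (- x) = - uea_gen x" for x :: "'g::lie_algebra"
  using uea_gen_add[of x "- x"] by (simp add: uea_gen_zero eq_neg_iff_add_eq_0 add.commute)

lemma uea_gen_diff: "uea_gen (x - y) = uea_gen x - uea_gen y" for x y :: "'g::lie_algebra"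
  using uea_gen_add[of x "- y"] by (simp add: uea_gen_uminus)

lemma schr_span: "x = lscale (e_co x) sE + lscale (h_co x) sH + lscale (f_co x) sF
      + lscale (p_co x) sP + lscale (q_co x) sQ + lscale (z_co x) sZ"
  by (simp add: schr_eq_iff schr_defs)

lemma uea_gen_schr:
  "uea_gen x = cscal (e_co x) * eU + cscal (h_co x) * hU + cscal (f_co x) * fU
     + cscal (p_co x) * pU + cscal (q_co x) * qU + cscal (z_co x) * zU"
  unfolding fU_def by (subst schr_span[of x]) (simp only: uea_gen_add uea_gen_lscale)

lemma schr_uea_induct [case_names scal e h f p q z add mult]:
  fixes u :: "schr uea"
  assumes "\<And>c. P (cscal c)" "P eU" "P hU" "P fU" "P pU" "P qU" "P zU"
    and "\<And>u v. P u \<Longrightarrow> P v \<Longrightarrow> P (u + v)" "\<And>u v. P u \<Longrightarrow> P v \<Longrightarrow> P (u * v)"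
  shows "P u"
proof (induction u rule: uea_gen_induct)
  case (gen x)
  show ?case unfolding uea_gen_schr[of x] by (intro assms)
qed (rule assms; assumption)+

text \<open>Oriented so that rewriting sorts monomials into the order \<open>z, f, q, h, p, e\<close>.\<close>

lemma schr_relations:
  "eU * zU = zU * eU" "hU * zU = zU * hU" "fU * zU = zU * fU" "pU * zU = zU * pU" "qU * zU = zU * qU"
  "qU * fU = fU * qU" "hU * fU = fU * hU - (fU + fU)" "pU * fU = fU * pU - qU" "eU * fU = fU * eU + hU"
  "hU * qU = qU * hU - qU" "pU * qU = qU * pU + zU" "eU * qU = qU * eU + pU"
  "pU * hU = hU * pU - pU" "eU * hU = hU * eU - (eU + eU)" "eU * pU = pU * eU"
proof -
  have [simp]: "lbr sE sZ = 0" "lbr sH sZ = 0" "lbr sF sZ = 0" "lbr sP sZ = 0" "lbr sQ sZ = 0"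
    "lbr sQ sF = 0" "lbr sH sF = - (sF + sF)" "lbr sP sF = - sQ" "lbr sE sF = sH"
    "lbr sH sQ = - sQ" "lbr sP sQ = sZ" "lbr sE sQ = sP"
    "lbr sP sH = - sP" "lbr sE sH = - (sE + sE)" "lbr sE sP = 0"
    by (simp_all add: schr_defs)
  show "eU * zU = zU * eU" "hU * zU = zU * hU" "fU * zU = zU * fU" "pU * zU = zU * pU" "qU * zU = zU * qU"
    "qU * fU = fU * qU" "hU * fU = fU * hU - (fU + fU)" "pU * fU = fU * pU - qU" "eU * fU = fU * eU + hU"
    "hU * qU = qU * hU - qU" "pU * qU = qU * pU + zU" "eU * qU = qU * eU + pU"
    "pU * hU = hU * pU - pU" "eU * hU = hU * eU - (eU + eU)" "eU * pU = pU * eU"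
    unfolding fU_def
    by (subst uea_gen_commute, simp add: uea_gen_add uea_gen_uminus uea_gen_diff uea_gen_zero algebra_simps)+
qed

text \<open>With products associated to the right, a rule for \<open>a * b\<close> must also fire
  inside a longer word.\<close>

lemma mult_rewrite_assoc: "a * b = c \<Longrightarrow> a * (b * x) = c * x" for a :: "'a::semigroup_mult"
  by (metis mult.assoc)

lemmas schr_normalize = schr_relations schr_relations[THEN mult_rewrite_assoc]

text \<open>Over \<open>\<complex>[z, 1/z]\<close> the elements \<open>e - p\<^sup>2/2z\<close>, \<open>f + q\<^sup>2/2z\<close> and \<open>h + (pq + qp)/2z\<close> form an
  \<open>sl\<^sub>2\<close>-triple commuting with \<open>p\<close> and \<open>q\<close>. The following are \<open>2z\<close> times this triple and \<open>4z\<^sup>2\<close> times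
  its Casimir element \<open>h\<^sup>2 + 2ef + 2fe\<close>.\<close>

definition bE :: "schr uea" where "bE = zU * eU + zU * eU - pU * pU"
definition bF :: "schr uea" where "bF = zU * fU + zU * fU + qU * qU"
definition bH :: "schr uea" where "bH = zU * hU + zU * hU + pU * qU + qU * pU"
definition bC :: "schr uea" where "bC = bH * bH + (bE * bF + bE * bF) + (bF * bE + bF * bE)"

lemmas b_defs = bE_def bF_def bH_def

lemma b_commute_heisenberg:
  "pU * bE = bE * pU" "pU * bF = bF * pU" "pU * bH = bH * pU"
  "qU * bE = bE * qU" "qU * bF = bF * qU" "qU * bH = bH * qU"
  by (simp_all add: b_defs schr_normalize algebra_simps)

lemma b_adjoint:
  "eU * bE = bE * eU" "eU * bF = bF * eU + bH" "eU * bH = bH * eU - (bE + bE)"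
  "fU * bE = bE * fU - bH" "fU * bF = bF * fU" "fU * bH = bH * fU + (bF + bF)"
  "hU * bE = bE * hU + (bE + bE)" "hU * bF = bF * hU - (bF + bF)" "hU * bH = bH * hU"
  by (simp_all add: b_defs schr_normalize algebra_simps)

text \<open>Clearing the denominator \<open>2z\<close> of each generator replaces the structure
  constants \<open>1, 2, -2\<close> of sl2 by \<open>2z, 4z, -4z\<close>.\<close>

lemma b_relations:
  "bE * bF = bF * bE + (zU * bH + zU * bH)"
  "bH * bE = bE * bH + (zU * bE + zU * bE + zU * bE + zU * bE)"
  "bH * bF = bF * bH - (zU * bF + zU * bF + zU * bF + zU * bF)"
  by (simp_all add: b_defs schr_normalize algebra_simps)

lemma zU_commute: "u * zU = zU * u"
proof (induction u rule: schr_uea_induct)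
  case (mult u v)
  then show ?case by (metis mult.assoc)
qed (simp_all add: schr_relations cscal_commute distrib_left distrib_right)

text \<open>The elements \<open>p\<close>, \<open>q\<close> commute with the triple, and
  \<open>e\<close>, \<open>h\<close>, \<open>f\<close> act on it by the adjoint action of sl2, which
  fixes the Casimir element.\<close>

lemma bC_commute: "u * bC = bC * u"
proof (induction u rule: schr_uea_induct)
  case (mult u v)
  then show ?case by (metis mult.assoc)
next
  case z
  show ?case by (simp add: zU_commute)
qed (simp_all add: bC_def cscal_commute distrib_left distrib_right mult.assoc
    b_commute_heisenberg b_commute_heisenberg[THEN mult_rewrite_assoc]
    b_adjoint b_adjoint[THEN mult_rewrite_assoc] algebra_simps)

section \<open>Extraction of coefficients by Heisenberg commutators\<close>

context ideal_cong
begin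

lemma heisenberg_commute_power:
  assumes "x * y \<simeq> y * x + cscal l"
  shows "x * y ^ Suc i \<simeq> y ^ Suc i * x + cscal (of_nat (Suc i) * l) * y ^ i"
proof (induction i)
  case 0
  show ?case using assms by simp
next
  case (Suc i)
  have "x * y ^ Suc (Suc i) \<simeq> (y * x + cscal l) * y ^ Suc i"
    using cong_right[OF assms, of "y ^ Suc i"] by (simp add: mult.assoc)
  also have "\<dots> = y * (x * y ^ Suc i) + cscal l * y ^ Suc i"
    by (simp add: distrib_right mult.assoc)
  also have "\<dots> \<simeq> y * (y ^ Suc i * x + cscal (of_nat (Suc i) * l) * y ^ i) + cscal l * y ^ Suc i"
    by (intro cong_add cong_left Suc cong_refl)
  also have "\<dots> = y ^ Suc (Suc i) * x + cscal (of_nat (Suc (Suc i)) * l) * y ^ Suc i"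
  proof -
    have "of_nat (Suc (Suc i)) * l = of_nat (Suc i) * l + l" by (simp add: distrib_right)
    then show ?thesis
      by (simp only: cscal_add distrib_left distrib_right mult.assoc power_Suc cscal_left_commute[of y] add.assoc)
  qed
  finally show ?case .
qed

text \<open>Commuting with \<open>x\<close> differentiates a polynomial in \<open>y\<close>.\<close>

lemma heisenberg_coefficients:
  assumes xy: "x * y \<simeq> y * x + cscal l" and "l \<noteq> 0"
    and "\<And>i. x * b i = b i * x" "(\<Sum>i<N. y ^ i * b i) \<in> J" "i < N"
  shows "b i \<in> J"
  using assms(3-)
proof (induction N arbitrary: b i)
  case (Suc N)
  let ?s = "\<Sum>i<Suc N. y ^ i * b i" and ?b = "\<lambda>i. cscal (of_nat (Suc i) * l) * b (Suc i)"
  have s: "?s = b 0 + (\<Sum>i<N. y ^ Suc i * b (Suc i))"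
    by (simp only: sum.lessThan_Suc_shift power_0 mult_1)
  have comm: "x * (y ^ Suc i * b (Suc i)) - y ^ Suc i * b (Suc i) * x \<simeq> y ^ i * ?b i" for i
  proof -
    have xb: "x * b (Suc i) = b (Suc i) * x" by (rule Suc.prems(1))
    have "x * y ^ Suc i * b (Suc i) \<simeq> (y ^ Suc i * x + cscal (of_nat (Suc i) * l) * y ^ i) * b (Suc i)"
      by (rule cong_right[OF heisenberg_commute_power[OF xy]])
    also have "\<dots> = y ^ Suc i * b (Suc i) * x + y ^ i * ?b i"
      unfolding distrib_right mult.assoc xb cscal_left_commute ..
    finally show ?thesis by (simp add: cong_def mult.assoc diff_diff_eq)
  qed
  \<comment> \<open>The commutator drops \<open>b 0\<close> and lowers every exponent by one, so the
    induction hypothesis yields all \<open>b (Suc i)\<close>; then \<open>b 0\<close> is what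
    remains of the sum.\<close>
  have "x * ?s - ?s * x = (\<Sum>i<N. x * (y ^ Suc i * b (Suc i)) - y ^ Suc i * b (Suc i) * x)"
    unfolding s distrib_left distrib_right sum_distrib_left sum_distrib_right sum_subtractf
      Suc.prems(1)[of 0] by simp
  also have "\<dots> \<simeq> (\<Sum>i<N. y ^ i * ?b i)" by (intro cong_sum comm)
  finally have "(\<Sum>i<N. y ^ i * ?b i) \<in> J" using cong_mem J_simps(3,4,6) Suc.prems(2) by blast
  moreover have "x * ?b i = ?b i * x" for i
    by (simp only: cscal_left_commute[of x] mult.assoc Suc.prems(1))
  ultimately have "?b i \<in> J" if "i < N" for i using Suc.IH[of ?b i] that by blast
  then have b: "b (Suc i) \<in> J" if "i < N" for i
    using cscal_mem_iff[of "of_nat (Suc i) * l" "b (Suc i)"] that \<open>l \<noteq> 0\<close> by (auto simp del: of_nat_Suc)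
  then have "(\<Sum>i<N. y ^ Suc i * b (Suc i)) \<simeq> (\<Sum>i<N. 0)"
    by (intro cong_sum) (simp add: cong_def J_simps)
  then have "(\<Sum>i<N. y ^ Suc i * b (Suc i)) \<in> J" by (simp add: cong_0_iff)
  with Suc.prems(2) s J_simps(6) have "b 0 \<in> J" by (metis add_diff_cancel_right')
  then show ?case using b Suc.prems(3) by (cases i) auto
qed simp

end

section \<open>Polynomials in one element with right coefficients in an additive set\<close>

definition pspan :: "'a::ring_1 \<Rightarrow> 'a set \<Rightarrow> 'a set" where
  "pspan y S = {\<Sum>i<N. y ^ i * b i | N b. \<forall>i. b i \<in> S}"

locale additive_span =
  fixes y :: "'a::ring_1" and S :: "'a set"
  assumes zero_S: "0 \<in> S" and add_S: "a \<in> S \<Longrightarrow> b \<in> S \<Longrightarrow> a + b \<in> S"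
begin

lemma pspan_zero: "0 \<in> pspan y S"
  unfolding pspan_def mem_Collect_eq using zero_S by (intro exI[of _ "0::nat"] exI[of _ "\<lambda>_. 0"]) simp

text \<open>Padding by zero coefficients gives two sums a common length, as their addition
  requires.\<close>

lemma pspan_pad:
  assumes "u \<in> pspan y S"
  shows "\<exists>b M. (\<forall>i. b i \<in> S) \<and> (\<forall>N\<ge>M. u = (\<Sum>i<N. y ^ i * b i))"
proof -
  obtain N b where b: "\<forall>i. b i \<in> S" "u = (\<Sum>i<N. y ^ i * b i)" using assms by (auto simp: pspan_def)
  let ?b = "\<lambda>i. if i < N then b i else 0"
  have "u = (\<Sum>i<M. y ^ i * ?b i)" if "M \<ge> N" for M
    unfolding b(2) using that by (intro sum.mono_neutral_cong_left) auto
  then show ?thesis using b(1) zero_S by (intro exI[of _ ?b] exI[of _ N]) simp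
qed

lemma pspan_add:
  assumes "u \<in> pspan y S" "v \<in> pspan y S"
  shows "u + v \<in> pspan y S"
proof -
  obtain b M where b: "\<forall>i. b i \<in> S" "\<forall>N\<ge>M. u = (\<Sum>i<N. y ^ i * b i)" using pspan_pad[OF assms(1)] by blast
  obtain c L where c: "\<forall>i. c i \<in> S" "\<forall>N\<ge>L. v = (\<Sum>i<N. y ^ i * c i)" using pspan_pad[OF assms(2)] by blast
  have "u + v = (\<Sum>i<M + L. y ^ i * (b i + c i))"
    unfolding distrib_left sum.distrib by (intro arg_cong2[where f = "(+)"] b(2)[rule_format] c(2)[rule_format]) simp_all
  moreover have "\<forall>i. b i + c i \<in> S" using b(1) c(1) add_S by blast
  ultimately show ?thesis unfolding pspan_def mem_Collect_eq
    by (intro exI[of _ "M + L"] exI[of _ "\<lambda>i. b i + c i"]) simp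
qed

lemma pspan_single:
  assumes "s \<in> S"
  shows "y ^ i * s \<in> pspan y S"
proof -
  have "(\<Sum>j<Suc i. y ^ j * (if j = i then s else 0)) = (\<Sum>j\<in>{i}. y ^ j * s)"
    by (rule sum.mono_neutral_cong_right) auto
  then show ?thesis unfolding pspan_def mem_Collect_eq using assms zero_S
    by (intro exI[of _ "Suc i"] exI[of _ "\<lambda>j. if j = i then s else 0"]) simp
qed

lemma pspan_left:
  assumes "u \<in> pspan y S" "\<And>i s. s \<in> S \<Longrightarrow> x * (y ^ i * s) \<in> pspan y S"
  shows "x * u \<in> pspan y S"
proof -
  obtain N b where b: "\<forall>i. b i \<in> S" "u = (\<Sum>i<N. y ^ i * b i)" using assms(1) unfolding pspan_def by blast
  have "(\<Sum>i<N. x * (y ^ i * b i)) \<in> pspan y S" for N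
    by (induction N) (simp_all add: b(1) assms(2) pspan_add pspan_zero)
  then show ?thesis unfolding b(2) sum_distrib_left .
qed

lemma pspan_shift: "u \<in> pspan y S \<Longrightarrow> y * u \<in> pspan y S"
proof (rule pspan_left)
  fix i s assume "s \<in> S"
  from pspan_single[OF this, of "Suc i"] show "y * (y ^ i * s) \<in> pspan y S" by (simp only: power_Suc mult.assoc)
qed

lemma pspan_commute_left:
  assumes "x * y = y * x" "\<And>s. s \<in> S \<Longrightarrow> x * s \<in> S" "u \<in> pspan y S"
  shows "x * u \<in> pspan y S"
proof (rule pspan_left[OF assms(3)])
  fix i s assume "s \<in> S"
  have "x * (y ^ i * s) = y ^ i * (x * s)"
    unfolding mult.assoc[symmetric] power_commuting_commutes[OF assms(1)[symmetric]] ..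
  then show "x * (y ^ i * s) \<in> pspan y S" by (simp only: pspan_single[OF assms(2)[OF \<open>s \<in> S\<close>]])
qed

lemma additive_span_pspan: "additive_span (pspan y S)"
  by unfold_locales (auto intro: pspan_zero pspan_add)

end

text \<open>As a module over that \<open>sl\<^sub>2\<close> and the Weyl algebra, \<open>\<Delta>(n-1,l)\<close> is the Verma module of highest
  weight \<open>n - 1/2\<close> tensored with \<open>\<complex>[q]\<close>; its central character gives \<open>casimir_value\<close>, and \<open>casimir_poly\<close>
  at \<open>t = 1\<close> and \<open>t = -1\<close> expresses \<open>bF * bE\<close> and \<open>bE * bF\<close> through \<open>h\<close>.\<close>

definition casimir_poly :: "nat \<Rightarrow> complex \<Rightarrow> complex \<Rightarrow> complex poly" where
  "casimir_poly n l t = smult (l\<^sup>2) ([:(of_nat n + 1/2)\<^sup>2:] - [:t, 1:]\<^sup>2)"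

definition casimir_value :: "nat \<Rightarrow> complex \<Rightarrow> complex" where
  "casimir_value n l = l\<^sup>2 * ((2 * of_nat n + 1)\<^sup>2 - 4)"

lemma casimir_poly_nonzero: "l \<noteq> 0 \<Longrightarrow> casimir_poly n l t \<noteq> 0"
proof -
  assume "l \<noteq> 0"
  have "coeff (casimir_poly n l t) 2 = - (l\<^sup>2)"
    by (simp add: casimir_poly_def power2_eq_square numeral_2_eq_2)
  with \<open>l \<noteq> 0\<close> show ?thesis by auto
qed

text \<open>The roots for \<open>t = -1\<close> and \<open>t = 1\<close> are \<open>1 \<plusminus> (n + 1/2)\<close> and \<open>-1 \<plusminus> (n + 1/2)\<close>; the second
  minus the first is \<open>-2\<close> or odd.\<close>

lemma casimir_poly_roots:
  assumes "l \<noteq> 0" "poly (casimir_poly n l (- 1)) r = 0"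
  shows "poly (casimir_poly n l 1) (r + 2 * of_nat m) \<noteq> 0"
proof
  assume 2: "poly (casimir_poly n l 1) (r + 2 * of_nat m) = 0"
  define s :: complex where "s = of_nat n + 1/2"
  define a b where "a = r - 1" and "b = r + 2 * of_nat m + 1"
  have "s\<^sup>2 = a\<^sup>2" "s\<^sup>2 = b\<^sup>2"
    using assms 2 by (simp_all add: casimir_poly_def s_def a_def b_def algebra_simps)
  then have "a = s \<or> a = - s" "b = s \<or> b = - s" by (metis power2_eq_iff)+
  \<comment> \<open>The difference is the positive even number \<open>2m + 2\<close>, while the
    signs allow only \<open>0\<close> and the odd numbers
    \<open>\<plusminus>(2n + 1)\<close>.\<close>
  then have "b - a = 0 \<or> b - a = 2 * s \<or> b - a = - (2 * s)" by auto
  moreover have "b - a = of_nat (2 * m + 2)" "2 * s = of_nat (2 * n + 1)"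
    by (simp_all add: a_def b_def s_def)
  ultimately consider "complex_of_nat (2 * m + 2) = 0" | "complex_of_nat (2 * m + 2) = of_nat (2 * n + 1)"
    | "complex_of_nat (2 * m + 2) = - of_nat (2 * n + 1)" by metis
  then show False
  proof cases
    case 2
    then have "2 * m + 2 = 2 * n + 1" by (simp only: of_nat_eq_iff)
    then show False by presburger
  next
    case 3
    then have "complex_of_nat (2 * m + 2 + (2 * n + 1)) = 0"
      unfolding of_nat_add[of "2 * m + 2"] by (simp only: left_minus)
    then show False by (simp only: of_nat_eq_0_iff)
  qed (simp only: of_nat_eq_0_iff)
qed

text \<open>Modulo \<open>z - l\<close> the Cartan element of the commuting sl2 is \<open>bH\<close>
  divided by \<open>2 * l\<close>; fixing the Casimir element then makes both products of
  \<open>bE\<close> and \<open>bF\<close> polynomials in it.\<close>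

lemma schr_sl2_cong:
  assumes J: "two_sided_ideal J" and l: "l \<noteq> 0" and z: "zU - cscal l \<in> J"
    and C: "bC - cscal (casimir_value n l) \<in> J"
  shows "sl2_cong J (cscal (inverse (2 * l)) * bH) bE bF (casimir_poly n l 1) (casimir_poly n l (- 1))"
proof -
  interpret ideal_cong J using J by unfold_locales
  define h where "h = cscal (inverse (2 * l)) * bH"
  have z: "zU \<simeq> cscal l" and C: "bC \<simeq> cscal (casimir_value n l)" using z C by (simp_all add: cong_def)
  have four: "cscal 4 * x = x + x + x + x" for x :: "schr uea"
  proof -
    have "(4 :: complex) = 1 + 1 + 1 + 1" by simp
    then show ?thesis by (simp only: cscal_add cscal_one distrib_right mult_1)
  qed
  have zx: "cscal (inverse (2 * l)) * (zU * x + zU * x + zU * x + zU * x) \<simeq> x * cscal 2" for x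
  proof -
    have "cscal (inverse (2 * l)) * (cscal 4 * (zU * x)) \<simeq> cscal (inverse (2 * l)) * (cscal 4 * (cscal l * x))"
      by (intro cong_left cong_right z)
    also have "\<dots> = cscal 2 * x" using l by (simp add: field_simps flip: mult.assoc cscal_mult)
    finally show ?thesis unfolding four by (simp only: cscal_commute[of 2 x])
  qed
  have bH: "bH = cscal (2 * l) * h" using l unfolding h_def by (simp add: cscal_one flip: mult.assoc cscal_mult)
  define A where "A = casimir_poly n l 1"
  define B where "B = casimir_poly n l (- 1)"
  have A: "cscal 4 * pev h A = cscal (casimir_value n l) - bH * bH - cscal (4 * l) * bH"
  proof -
    have p: "smult 4 A = [:casimir_value n l, - (8 * l\<^sup>2), - (4 * l\<^sup>2):]"
      by (simp add: A_def casimir_poly_def casimir_value_def power2_eq_square algebra_simps)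
    have "bH * bH = cscal (2 * l) * (cscal (2 * l) * (h * h))"
      unfolding bH by (simp add: mult.assoc cscal_left_commute[of h])
    then have bH2: "bH * bH = cscal (4 * l\<^sup>2) * (h * h)"
      by (simp add: power2_eq_square flip: mult.assoc cscal_mult)
    have bH1: "cscal (4 * l) * bH = cscal (8 * l\<^sup>2) * h"
      unfolding bH by (simp add: power2_eq_square flip: mult.assoc cscal_mult)
    show ?thesis unfolding pev_smult[symmetric] p bH2 bH1
      by (simp add: cscal_uminus right_diff_distrib distrib_left cscal_left_commute[of h]
          cscal_commute[of _ h, symmetric])
  qed
  have B: "pev h B = pev h A + cscal (2 * l) * bH"
  proof -
    have p: "B = A + smult (4 * l\<^sup>2) [:0, 1:]"
      by (simp add: A_def B_def casimir_poly_def power2_eq_square algebra_simps)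
    have "cscal (2 * l) * bH = cscal (4 * l\<^sup>2) * h"
      unfolding bH by (simp add: power2_eq_square flip: mult.assoc cscal_mult)
    then show ?thesis unfolding p pev_add pev_smult by (simp add: cscal_one)
  qed
  \<comment> \<open>Reordering \<open>bE * bF\<close> puts the Casimir element into the form
    \<open>bH^2 + 4 bF bE + 4 z bH\<close>.\<close>
  have "cscal 4 * (bF * bE) = bC - bH * bH - cscal 4 * (zU * bH)"
    by (simp add: four bC_def b_relations algebra_simps)
  also have "\<dots> \<simeq> cscal (casimir_value n l) - bH * bH - cscal 4 * (cscal l * bH)"
    by (intro cong_diff cong_left cong_right C z cong_refl)
  also have "\<dots> = cscal 4 * pev h A" by (simp add: A cscal_mult mult.assoc)
  finally have "cscal (inverse 4) * (cscal 4 * (bF * bE)) \<simeq> cscal (inverse 4) * (cscal 4 * pev h A)"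
    by (rule cong_left)
  then have FE: "bF * bE \<simeq> pev h A" by (simp only: cscal_inverse_cancel[of 4, OF zero_neq_numeral[symmetric]])
  have "bE * bF \<simeq> pev h A + (cscal l * bH + cscal l * bH)"
    unfolding b_relations by (intro cong_add FE cong_right z)
  then have EF: "bE * bF \<simeq> pev h B" by (simp add: B flip: distrib_right cscal_add)
  show ?thesis unfolding h_def[symmetric]
  proof unfold_locales
    have "h * bE = bE * h + cscal (inverse (2 * l)) * (zU * bE + zU * bE + zU * bE + zU * bE)"
      unfolding h_def by (simp only: mult.assoc b_relations distrib_left cscal_left_commute[of bE])
    also have "\<dots> \<simeq> bE * h + bE * cscal 2" by (intro cong_add zx cong_refl)
    finally show "h * bE \<simeq> bE * (h + cscal 2)" by (simp add: distrib_left)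
    have "h * bF = bF * h - cscal (inverse (2 * l)) * (zU * bF + zU * bF + zU * bF + zU * bF)"
      unfolding h_def by (simp only: mult.assoc b_relations right_diff_distrib cscal_left_commute[of bF])
    also have "\<dots> \<simeq> bF * h - bF * cscal 2" by (intro cong_diff zx cong_refl)
    finally show "h * bF \<simeq> bF * (h + cscal (- 2))" by (simp add: right_diff_distrib cscal_uminus)
    show "bF * bE \<simeq> pev h (casimir_poly n l 1)" using FE A_def by simp
    show "bE * bF \<simeq> pev h (casimir_poly n l (- 1))" using EF B_def by simp
  qed
qed

text \<open>The range of the coefficients \<open>a\<^sub>i\<^sub>j\<close> in the normal form \<open>\<Sum> q\<^sup>i p\<^sup>j a\<^sub>i\<^sub>j\<close>.\<close>

definition heis_centralizer :: "schr uea set \<Rightarrow> schr uea set" where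
  "heis_centralizer N = {a \<in> N. pU * a = a * pU \<and> qU * a = a * qU}"

text \<open>At \<open>i = 0\<close> the truncated exponent is harmless, its coefficient being
  zero.\<close>

lemma pU_qU_power: "pU * qU ^ i = qU ^ i * pU + cscal (of_nat i) * (zU * qU ^ (i - 1))"
proof (induction i)
  case (Suc i)
  have "pU * qU ^ Suc i = qU * (pU * qU ^ i) + zU * qU ^ i"
    by (simp add: schr_normalize distrib_right mult.assoc)
  also have "\<dots> = qU ^ Suc i * pU + cscal (of_nat i) * (qU * (zU * qU ^ (i - 1))) + zU * qU ^ i"
    unfolding Suc by (simp add: distrib_left mult.assoc cscal_left_commute[of qU])
  also have "cscal (of_nat i) * (qU * (zU * qU ^ (i - 1))) = cscal (of_nat i) * (zU * qU ^ i)"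
    by (cases i) (simp_all add: schr_normalize mult.assoc)
  finally show ?case by (simp add: cscal_add cscal_one distrib_left distrib_right add.assoc add.commute)
qed simp

text \<open>The elements congruent to some \<open>\<Sum> q^i p^j a_ij\<close> contain
  \<open>1\<close> and are stable under left multiplication by all generators, hence exhaust
  \<open>U\<close>. The coefficients commute with \<open>p\<close> and \<open>q\<close> exactly, not
  just modulo \<open>J\<close>, because the triple does.\<close>

lemma schr_normal_form:
  fixes u :: "schr uea"
  assumes l: "l \<noteq> 0" and J: "ideal_cong J" and z: "zU - cscal l \<in> J"
    and N: "0 \<in> N" "1 \<in> N" "\<And>a b. a \<in> N \<Longrightarrow> b \<in> N \<Longrightarrow> a + b \<in> N" "\<And>c a. a \<in> N \<Longrightarrow> cscal c * a \<in> N"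
      "\<And>a. a \<in> N \<Longrightarrow> zU * a \<in> N" "\<And>a. a \<in> N \<Longrightarrow> bE * a \<in> N" "\<And>a. a \<in> N \<Longrightarrow> bF * a \<in> N"
      "\<And>a. a \<in> N \<Longrightarrow> bH * a \<in> N"
  shows "\<exists>x \<in> pspan qU (pspan pU (heis_centralizer N)). u - x \<in> J"
proof -
  let ?S = "heis_centralizer N"
  interpret S: additive_span pU ?S
    using N by unfold_locales (auto simp: heis_centralizer_def distrib_left distrib_right)
  interpret T: additive_span qU "pspan pU ?S" by (rule S.additive_span_pspan)
  interpret ideal_cong J by fact
  let ?T = "pspan qU (pspan pU ?S)"
  have lift: "x * u \<in> ?T"
    if "x * pU = pU * x" "x * qU = qU * x" "\<And>a. a \<in> N \<Longrightarrow> x * a \<in> N" "u \<in> ?T" for x u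
  proof -
    have "x * a \<in> ?S" if "a \<in> ?S" for a
      using that \<open>x * pU = pU * x\<close> \<open>x * qU = qU * x\<close> \<open>\<And>a. a \<in> N \<Longrightarrow> x * a \<in> N\<close>
      unfolding heis_centralizer_def mem_Collect_eq by (metis mult.assoc)
    then show ?thesis using that by (intro T.pspan_commute_left S.pspan_commute_left)
  qed
  have p: "pU * u \<in> ?T" if "u \<in> ?T" for u
  proof (rule T.pspan_left[OF that])
    fix i s assume s: "s \<in> pspan pU ?S"
    have "pU * (qU ^ i * s) = qU ^ i * (pU * s) + cscal (of_nat i) * (zU * (qU ^ (i - 1) * s))"
      unfolding mult.assoc[symmetric] pU_qU_power by (simp add: distrib_right mult.assoc)
    also have "\<dots> \<in> ?T"
      using T.pspan_single[OF S.pspan_shift[OF s]] T.pspan_single[OF s]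
      by (intro T.pspan_add lift[of "cscal _"] lift[of zU]) (simp_all only: N zU_commute cscal_commute[of _ pU] cscal_commute[of _ qU])
    finally show "pU * (qU ^ i * s) \<in> ?T" .
  qed
  define X where "X = {u. \<exists>x\<in>?T. u \<simeq> x}"
  have X: "u * x \<in> X" if "x \<in> X" "\<And>t. t \<in> ?T \<Longrightarrow> u * t \<in> ?T" for u x
    using that cong_left unfolding X_def by blast
  have Xcong: "u \<in> X" if "u \<simeq> v" "v \<in> X" for u v using that cong_trans unfolding X_def by blast
  have Xadd: "u + v \<in> X" if "u \<in> X" "v \<in> X" for u v
    using that cong_add T.pspan_add unfolding X_def by blast
  have cX: "cscal c * x \<in> X" if "x \<in> X" for c x
    by (rule X[OF that]) (intro lift, simp_all only: N cscal_commute[of _ pU] cscal_commute[of _ qU])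
  have bX: "bE * x \<in> X" "bF * x \<in> X" "bH * x \<in> X" "zU * x \<in> X" "qU * x \<in> X" "pU * x \<in> X"
    if "x \<in> X" for x
    using that by (rule X; auto intro!: lift p T.pspan_shift simp: N b_commute_heisenberg zU_commute)+
  have nX: "- x \<in> X" if "x \<in> X" for x using cX[OF that, of "- 1"] by (simp add: cscal_uminus cscal_one)
  \<comment> \<open>Recovers \<open>g\<close> from \<open>v = 2z g\<close> by replacing
    \<open>z\<close> with the scalar \<open>l\<close>; used for \<open>e\<close>, \<open>f\<close>,
    \<open>h\<close> with \<open>v\<close> equal to \<open>bE + p^2\<close>,
    \<open>bF - q^2\<close>, \<open>bH - pq - qp\<close>.\<close>
  have halve: "g * x \<in> X" if "zU * g + zU * g = v" "v * x \<in> X" for g v x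
  proof -
    have "cscal (2 * l) * (g * x) = cscal l * g * x + cscal l * g * x"
      unfolding mult_2 cscal_add by (simp add: distrib_right mult.assoc)
    also have "\<dots> \<simeq> zU * g * x + zU * g * x" by (intro cong_add cong_right cong_sym[OF z[folded cong_def]])
    also have "\<dots> = v * x" using that(1) by (simp flip: distrib_right)
    finally have "cscal (inverse (2 * l)) * (cscal (2 * l) * (g * x)) \<simeq> cscal (inverse (2 * l)) * (v * x)"
      by (rule cong_left)
    moreover have "cscal (inverse (2 * l)) * (cscal (2 * l) * (g * x)) = g * x"
      using l by (intro cscal_inverse_cancel) simp
    ultimately have "g * x \<simeq> cscal (inverse (2 * l)) * (v * x)" by (simp only:)
    then show ?thesis using Xcong cX that(2) by blast
  qed
  have "\<forall>x\<in>X. u * x \<in> X"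
  proof (induction u rule: schr_uea_induct)
    case e
    have "(bE + pU * pU) * x \<in> X" if "x \<in> X" for x
      using that by (simp only: distrib_right mult.assoc) (intro Xadd bX)
    then show ?case using halve[of eU "bE + pU * pU"] by (simp add: bE_def)
  next
    case f
    have "(bF + - (qU * qU)) * x \<in> X" if "x \<in> X" for x
      using that by (simp only: distrib_right mult.assoc mult_minus_left) (intro Xadd bX nX)
    then show ?case using halve[of fU "bF + - (qU * qU)"] by (simp add: bF_def)
  next
    case h
    have "(bH + (- (pU * qU) + - (qU * pU))) * x \<in> X" if "x \<in> X" for x
      using that by (simp only: distrib_right mult.assoc mult_minus_left) (intro Xadd bX nX)
    then show ?case using halve[of hU "bH + (- (pU * qU) + - (qU * pU))"] by (simp add: bH_def)
  qed (auto simp: distrib_right mult.assoc intro: cX bX Xadd)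
  moreover have "1 \<in> X"
    unfolding X_def mem_Collect_eq
    using T.pspan_single[OF S.pspan_single, of 1 0 0] N
    by (intro bexI[of _ 1]) (simp_all add: heis_centralizer_def)
  ultimately have "u \<in> X" by force
  then show ?thesis by (simp add: X_def cong_def)
qed

section \<open>The ideal of a central character and its maximality\<close>

lemma central_diff_cscal: "(\<And>u. u * x = x * u) \<Longrightarrow> u * (x - cscal c) = (x - cscal c) * u"
  for x :: "'a::complex_algebra"
  by (simp only: left_diff_distrib right_diff_distrib cscal_commute)

definition schr_ideal :: "nat \<Rightarrow> complex \<Rightarrow> schr uea set" where
  "schr_ideal n l = ideal_gen {zU - cscal l, bC - cscal (casimir_value n l)}"

lemma two_sided_schr_ideal: "two_sided_ideal (schr_ideal n l)"
  unfolding schr_ideal_def by (rule two_sided_ideal_ideal_gen)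

lemma schr_ideal_generators:
  "zU - cscal l \<in> schr_ideal n l" "bC - cscal (casimir_value n l) \<in> schr_ideal n l"
  unfolding schr_ideal_def by (rule subsetD[OF ideal_gen_subset], simp)+

lemma schr_ideal_subsetI:
  assumes "two_sided_ideal J" "zU - cscal l \<in> J" "bC - cscal (casimir_value n l) \<in> J"
  shows "schr_ideal n l \<subseteq> J"
  unfolding schr_ideal_def using assms by (intro ideal_gen_least) simp_all

lemma centrally_generated_schr_ideal: "centrally_generated (schr_ideal n l)"
  unfolding centrally_generated_def
proof
  let ?C = "schr_ideal n l \<inter> ring_center"
  have center: "x - cscal c \<in> ring_center" if "\<And>u. u * x = x * u" for x :: "schr uea" and c
    using central_diff_cscal[OF that] by (simp add: ring_center_def)
  show "schr_ideal n l \<subseteq> ideal_gen ?C"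
  proof (rule schr_ideal_subsetI[OF two_sided_ideal_ideal_gen])
    show "zU - cscal l \<in> ideal_gen ?C"
      by (intro subsetD[OF ideal_gen_subset] IntI schr_ideal_generators center zU_commute)
    show "bC - cscal (casimir_value n l) \<in> ideal_gen ?C"
      by (intro subsetD[OF ideal_gen_subset] IntI schr_ideal_generators center bC_commute)
  qed
  show "ideal_gen ?C \<subseteq> schr_ideal n l"
    by (rule ideal_gen_least[OF two_sided_schr_ideal Int_lower1])
qed

lemma pspan_commutes:
  assumes "\<And>s. s \<in> S \<Longrightarrow> y * s = s * y" "u \<in> pspan y S"
  shows "y * u = u * y"
proof -
  obtain N b where b: "\<forall>i. b i \<in> S" "u = (\<Sum>i<N. y ^ i * b i)" using assms(2) unfolding pspan_def by blast
  have "y * (y ^ i * b i) = y ^ i * b i * y" for i :: nat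
  proof -
    have "y * b i = b i * y" using assms(1) b(1) by blast
    then have "y ^ i * (y * b i) = y ^ i * (b i * y)" by (rule arg_cong)
    then show ?thesis by (simp only: mult.assoc[symmetric] power_commutes)
  qed
  then have "(\<Sum>i<N. y * (y ^ i * b i)) = (\<Sum>i<N. y ^ i * b i * y)" by (rule sum.cong[OF refl])
  then show ?thesis unfolding b(2) sum_distrib_left sum_distrib_right .
qed

text \<open>An element of \<open>J\<close> has a normal form modulo \<open>I\<close>. Commutators
  with \<open>p\<close>, then with \<open>q\<close>, put each coefficient \<open>a_ij\<close> into
  \<open>J\<close>; being a ladder sum modulo \<open>I\<close>, it must then be zero modulo
  \<open>I\<close> itself.\<close>

theorem schr_ideal_maximal:
  assumes l: "l \<noteq> 0" and J: "two_sided_ideal J" and sub: "schr_ideal n l \<subseteq> J" and 1: "1 \<notin> J"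
  shows "J = schr_ideal n l"
proof
  show "J \<subseteq> schr_ideal n l"
  proof
    fix u assume "u \<in> J"
    define h where "h = cscal (inverse (2 * l)) * bH"
    let ?A = "casimir_poly n l 1" and ?B = "casimir_poly n l (- 1)"
    interpret I: sl2_cong "schr_ideal n l" h bE bF ?A ?B
      unfolding h_def by (intro schr_sl2_cong two_sided_schr_ideal l schr_ideal_generators)
    interpret J: sl2_cong J h bE bF ?A ?B
      unfolding h_def by (intro schr_sl2_cong J l) (use sub schr_ideal_generators in blast)+
    have zN: "zU * a \<in> I.nf" if "a \<in> I.nf" for a
      by (rule I.nf_cong[OF I.cong_right I.nf_scalar[OF that, of l]], unfold I.cong_def)
        (rule schr_ideal_generators)
    have HN: "bH * a \<in> I.nf" if "a \<in> I.nf" for a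
    proof -
      have "cscal (2 * l) * (h * a) = bH * a"
        using l unfolding h_def by (simp add: cscal_one flip: mult.assoc cscal_mult)
      then show ?thesis using I.nf_scalar[OF I.nf_h[OF that], of "2 * l"] by (simp only:)
    qed
    have 0: "0 \<in> I.nf" using I.nf_single[of 0 0] by simp
    obtain x where x: "x \<in> pspan qU (pspan pU (heis_centralizer I.nf))" "u - x \<in> schr_ideal n l"
      using schr_normal_form[OF l I.ideal_cong_axioms schr_ideal_generators(1) 0 I.nf_1 I.nf_add
          I.nf_scalar zN I.nf_E I.nf_F HN] by blast
    from x(1) obtain N b where b: "\<And>i. b i \<in> pspan pU (heis_centralizer I.nf)" "x = (\<Sum>i<N. qU ^ i * b i)"
      unfolding pspan_def by blast
    have "\<forall>i. \<exists>M a. (\<forall>j. a j \<in> heis_centralizer I.nf) \<and> b i = (\<Sum>j<M. pU ^ j * a j)"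
      using b(1) unfolding pspan_def by blast
    from choice[OF this] obtain M where
      "\<forall>i. \<exists>a. (\<forall>j. a j \<in> heis_centralizer I.nf) \<and> b i = (\<Sum>j<M i. pU ^ j * a j)" ..
    from choice[OF this] obtain a where
      "\<forall>i. (\<forall>j. a i j \<in> heis_centralizer I.nf) \<and> b i = (\<Sum>j<M i. pU ^ j * a i j)" ..
    then have a: "a i j \<in> heis_centralizer I.nf" "b i = (\<Sum>j<M i. pU ^ j * a i j)" for i j by blast+
    have "x \<in> J" using J.J_simps(6)[OF \<open>u \<in> J\<close> subsetD[OF sub x(2)]] by simp
    have z: "J.cong zU (cscal l)" unfolding J.cong_def by (rule subsetD[OF sub schr_ideal_generators(1)])
    have pb: "pU * b i = b i * pU" for i
      by (rule pspan_commutes[OF _ b(1)]) (simp add: heis_centralizer_def)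
    have "J.cong (pU * qU) (qU * pU + cscal l)"
      unfolding schr_relations(11) by (intro J.cong_add J.cong_refl z)
    note J.heisenberg_coefficients[OF this l pb \<open>x \<in> J\<close>[unfolded b(2)]]
    \<comment> \<open>For the inner sums the roles are exchanged: \<open>q\<close> differentiates
      powers of \<open>p\<close>, with constant \<open>- l\<close>.\<close>
    moreover have qp: "J.cong (qU * pU) (pU * qU + cscal (- l))"
    proof -
      have "J.cong (qU * pU + zU - zU) (qU * pU + zU - cscal l)" by (intro J.cong_diff J.cong_refl z)
      then show ?thesis by (simp add: schr_relations(11) cscal_uminus)
    qed
    have "a i j \<in> J" if "b i \<in> J" "j < M i" for i j
    proof (rule J.heisenberg_coefficients[OF qp _ _ _ that(2)])
      show "qU * a i j = a i j * qU" for j using a(1)[of i j] by (simp add: heis_centralizer_def)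
      show "(\<Sum>j<M i. pU ^ j * a i j) \<in> J" using that(1) unfolding a(2) .
    qed (simp add: l)
    ultimately have aJ: "a i j \<in> J" if "i < N" "j < M i" for i j using that by blast
    have "a i j \<in> schr_ideal n l" if ij: "i < N" "j < M i" for i j
    proof -
      obtain S g where S: "finite S" "I.cong (a i j) (\<Sum>k\<in>S. ladder bE bF k * pev h (g k))"
        using a(1)[of i j] unfolding heis_centralizer_def I.nf_def by blast
      then have "J.cong (a i j) (\<Sum>k\<in>S. ladder bE bF k * pev h (g k))"
        using sub unfolding I.cong_def J.cong_def by blast
      then have "(\<Sum>k\<in>S. ladder bE bF k * pev h (g k)) \<in> J"
        using aJ[OF ij] J.cong_mem by blast
      then have "g k = 0" if "k \<in> S" for k
        using J.ladder_sum_mem_zero[OF 1 casimir_poly_roots casimir_poly_nonzero casimir_poly_nonzero] l S(1) that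
        by blast
      \<comment> \<open>The polynomials vanish outright, so the congruence modulo the smaller ideal
        now gives membership in that ideal.\<close>
      then have "(\<Sum>k\<in>S. ladder bE bF k * pev h (g k)) = 0" by (intro sum.neutral) simp
      then show ?thesis using S(2) by (simp add: I.cong_0_iff)
    qed
    then have "I.cong (qU ^ i * b i) 0" if "i < N" for i
    proof -
      have "I.cong (\<Sum>j<M i. pU ^ j * a i j) (\<Sum>j<M i. 0)"
        by (intro I.cong_sum) (simp add: I.cong_0_iff I.J_simps(3) \<open>i < N\<close> \<open>\<And>i j. \<lbrakk>i < N; j < M i\<rbrakk> \<Longrightarrow> a i j \<in> schr_ideal n l\<close>)
      then show ?thesis unfolding a(2)[symmetric] by (simp add: I.cong_0_iff I.J_simps(3))
    qed
    then have "I.cong x (\<Sum>i<N. 0)" unfolding b(2) by (intro I.cong_sum) simp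
    then have "x \<in> schr_ideal n l" by (simp add: I.cong_0_iff)
    with x(2) I.J_simps(2) show "u \<in> schr_ideal n l" by (metis diff_add_cancel)
  qed
qed (rule sub)

section \<open>Tensor products\<close>

definition tens :: "('m::ab_group_add \<Rightarrow> 'r \<Rightarrow> 'm) \<Rightarrow> ('r, 'n) module \<Rightarrow> 'm \<Rightarrow> 'n \<Rightarrow> ('m \<times> 'n \<Rightarrow>\<^sub>0 int) set" where
  "tens R N x m = additive_coset (tensor_rels R N) (frag_of (x, m))"

lemma tensor_rels_closed:
  "0 \<in> tensor_rels R N"
  "a \<in> tensor_rels R N \<Longrightarrow> b \<in> tensor_rels R N \<Longrightarrow> a + b \<in> tensor_rels R N"
  "a \<in> tensor_rels R N \<Longrightarrow> b \<in> tensor_rels R N \<Longrightarrow> a - b \<in> tensor_rels R N"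
  unfolding tensor_rels_def by (rule additive_gen_closed additive_gen_plus; assumption)+

lemma tensor_rels_generators:
  "n \<in> carrier N \<Longrightarrow> frag_of (m + m', n) - frag_of (m, n) - frag_of (m', n) \<in> tensor_rels R N"
  "n \<in> carrier N \<Longrightarrow> n' \<in> carrier N \<Longrightarrow>
     frag_of (m, n \<oplus>\<^bsub>N\<^esub> n') - frag_of (m, n) - frag_of (m, n') \<in> tensor_rels R N"
  "n \<in> carrier N \<Longrightarrow> frag_of (R m r, n) - frag_of (m, r \<odot>\<^bsub>N\<^esub> n) \<in> tensor_rels R N"
  unfolding tensor_rels_def by (rule additive_gen_closed(3), blast)+

lemma tensor_coset_eq_iff:
  "additive_coset (tensor_rels R N) a = additive_coset (tensor_rels R N) b \<longleftrightarrow> a - b \<in> tensor_rels R N"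
  unfolding tensor_rels_def by (rule additive_coset_eq_iff)

lemma tensor_zero: "\<zero>\<^bsub>tensor_product L R N\<^esub> = additive_coset (tensor_rels R N) 0"
  by (simp add: tensor_product_def Let_def additive_coset_def)

lemma tensor_add:
  "additive_coset (tensor_rels R N) a \<oplus>\<^bsub>tensor_product L R N\<^esub> additive_coset (tensor_rels R N) b
     = additive_coset (tensor_rels R N) (a + b)"
  by (simp add: tensor_product_def Let_def tensor_rels_def additive_coset_add)

lemma tens_closed: "n \<in> carrier N \<Longrightarrow> tens R N m n \<in> carrier (tensor_product L R N)"
  by (auto simp: tens_def tensor_product_def Let_def intro!: exI[of _ "frag_of (m, n)"])

lemma tens_zero_iff: "tens R N m n = \<zero>\<^bsub>tensor_product L R N\<^esub> \<longleftrightarrow> frag_of (m, n) \<in> tensor_rels R N"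
  by (simp add: tens_def tensor_zero tensor_coset_eq_iff)

lemma tens_smult: "bimodule L R \<Longrightarrow> s \<odot>\<^bsub>tensor_product L R N\<^esub> tens R N m n = tens R N (L s m) n"
  by (simp add: tens_def tensor_product_smult)

lemma tens_balanced: "n \<in> carrier N \<Longrightarrow> tens R N (R m r) n = tens R N m (r \<odot>\<^bsub>N\<^esub> n)"
  by (simp add: tens_def tensor_coset_eq_iff tensor_rels_generators)

lemma tens_add_left:
  "n \<in> carrier N \<Longrightarrow> tens R N (m + m') n = tens R N m n \<oplus>\<^bsub>tensor_product L R N\<^esub> tens R N m' n"
  using tensor_rels_generators(1)[of n N m m' R]
  by (simp add: tens_def tensor_add tensor_coset_eq_iff diff_diff_eq)

lemma tensor_annihilatorI:
  assumes B: "bimodule L R"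
    and s: "\<And>m n. n \<in> carrier N \<Longrightarrow> s \<odot>\<^bsub>tensor_product L R N\<^esub> tens R N m n = \<zero>\<^bsub>tensor_product L R N\<^esub>"
  shows "s \<in> annihilator (tensor_product L R N)"
proof -
  have "act_first L s a \<in> tensor_rels R N" if "Poly_Mapping.keys a \<subseteq> UNIV \<times> carrier N" for a
    using that
  proof (induction a rule: frag_induction)
    case (one p)
    then show ?case using s[of "snd p" "fst p"] by (cases p) (simp add: tens_smult[OF B] tens_zero_iff)
  qed (simp_all add: tensor_rels_closed)
  then have "s \<odot>\<^bsub>tensor_product L R N\<^esub> additive_coset (tensor_rels R N) a = \<zero>\<^bsub>tensor_product L R N\<^esub>"
    if "Poly_Mapping.keys a \<subseteq> UNIV \<times> carrier N" for a
    using that by (simp add: tensor_product_smult[OF B] tensor_zero tensor_coset_eq_iff)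
  then show ?thesis by (auto simp: annihilator_def tensor_product_def Let_def)
qed

section \<open>Functionals on tensor products, detecting nonzero tensors\<close>

definition balanced_map :: "('m::ab_group_add \<Rightarrow> 'r \<Rightarrow> 'm) \<Rightarrow> ('r, 'n) module \<Rightarrow> ('m \<Rightarrow> 'n \<Rightarrow> complex) \<Rightarrow> bool" where
  "balanced_map R N \<beta> \<longleftrightarrow>
     (\<forall>m m'. \<forall>n\<in>carrier N. \<beta> (m + m') n = \<beta> m n + \<beta> m' n) \<and>
     (\<forall>m. \<forall>n\<in>carrier N. \<forall>n'\<in>carrier N. \<beta> m (n \<oplus>\<^bsub>N\<^esub> n') = \<beta> m n + \<beta> m n') \<and>
     (\<forall>m r. \<forall>n\<in>carrier N. \<beta> (R m r) n = \<beta> m (r \<odot>\<^bsub>N\<^esub> n))"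

definition frag_lift :: "('m \<Rightarrow> 'n \<Rightarrow> complex) \<Rightarrow> ('m \<times> 'n \<Rightarrow>\<^sub>0 int) \<Rightarrow> complex" where
  "frag_lift \<beta> a = (\<Sum>(m, n)\<in>Poly_Mapping.keys a. of_int (Poly_Mapping.lookup a (m, n)) * \<beta> m n)"

lemma frag_lift_superset:
  assumes "finite K" "Poly_Mapping.keys a \<subseteq> K"
  shows "frag_lift \<beta> a = (\<Sum>(m, n)\<in>K. of_int (Poly_Mapping.lookup a (m, n)) * \<beta> m n)"
  unfolding frag_lift_def using assms by (intro sum.mono_neutral_left) (auto simp: in_keys_iff)

lemma frag_lift_simps [simp]:
  "frag_lift \<beta> 0 = 0" "frag_lift \<beta> (frag_of (m, n)) = \<beta> m n"
  "frag_lift \<beta> (a - b) = frag_lift \<beta> a - frag_lift \<beta> b"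
proof -
  let ?K = "Poly_Mapping.keys a \<union> Poly_Mapping.keys b"
  have "Poly_Mapping.keys (a - b) \<subseteq> ?K" by (rule keys_diff)
  then show "frag_lift \<beta> (a - b) = frag_lift \<beta> a - frag_lift \<beta> b"
    by (simp add: frag_lift_superset[of ?K] lookup_minus left_diff_distrib case_prod_unfold sum_subtractf)
qed (simp_all add: frag_lift_def)

lemma frag_lift_add: "frag_lift \<beta> (a + b) = frag_lift \<beta> a + frag_lift \<beta> b"
  using frag_lift_simps(3)[of \<beta> "a + b" b] by simp

lemma frag_lift_rels:
  assumes "balanced_map R N \<beta>" "a \<in> tensor_rels R N"
  shows "frag_lift \<beta> a = 0"
proof -
  have "tensor_rels R N \<subseteq> {a. frag_lift \<beta> a = 0}"
    unfolding tensor_rels_def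
    by (rule additive_gen_least) (use assms(1) in \<open>auto simp: balanced_map_def\<close>)
  then show ?thesis using assms(2) by blast
qed

definition tensor_lift :: "('m \<Rightarrow> 'n \<Rightarrow> complex) \<Rightarrow> ('m \<times> 'n \<Rightarrow>\<^sub>0 int) set \<Rightarrow> complex" where
  "tensor_lift \<beta> A = frag_lift \<beta> (SOME a. a \<in> A)"

lemma tensor_lift_coset:
  assumes "balanced_map R N \<beta>"
  shows "tensor_lift \<beta> (additive_coset (tensor_rels R N) a) = frag_lift \<beta> a"
proof -
  have "a \<in> additive_coset (tensor_rels R N) a" by (simp add: additive_coset_def tensor_rels_closed)
  then have "(SOME b. b \<in> additive_coset (tensor_rels R N) a) \<in> additive_coset (tensor_rels R N) a"
    by (rule someI)
  then have "(SOME b. b \<in> additive_coset (tensor_rels R N) a) - a \<in> tensor_rels R N"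
    by (simp add: additive_coset_def)
  from frag_lift_rels[OF assms this] show ?thesis by (simp add: tensor_lift_def)
qed

lemma tens_nonzero: "balanced_map R N \<beta> \<Longrightarrow> \<beta> m n \<noteq> 0 \<Longrightarrow> tens R N m n \<noteq> \<zero>\<^bsub>tensor_product L R N\<^esub>"
  using frag_lift_rels[of R N \<beta> "frag_of (m, n)"] by (auto simp: tens_zero_iff)

context left_module
begin

lemma smult_zero_right: "r \<odot> \<zero> = \<zero>"
proof -
  have "r \<odot> \<zero> \<oplus> r \<odot> \<zero> = r \<odot> \<zero>"
    using smult_add_right[OF zero_closed zero_closed, of r] by simp
  then show ?thesis by (simp only: add.l_cancel_one smult_closed zero_closed)
qed

lemma smult_zero_left: "x \<in> carrier M \<Longrightarrow> 0 \<odot> x = \<zero>"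
proof -
  assume x: "x \<in> carrier M"
  have "0 \<odot> x \<oplus> 0 \<odot> x = 0 \<odot> x"
    using smult_add_left[OF x, of 0 0] by simp
  then show ?thesis using x by (simp only: add.l_cancel_one smult_closed)
qed

text \<open>Stability of \<open>X\<close> under the action gives closure under right multiplication.
  Besides annihilators of whole modules this serves the set of vectors killed by a power of
  \<open>e\<close>.\<close>

lemma two_sided_ideal_kill:
  assumes "X \<subseteq> carrier M" "\<And>r x. x \<in> X \<Longrightarrow> r \<odot> x \<in> X"
  shows "two_sided_ideal {r. \<forall>x\<in>X. r \<odot> x = \<zero>}"
  unfolding two_sided_ideal_def using assms subsetD[OF assms(1)]
  by (auto simp: smult_zero_left smult_zero_right smult_add_left smult_mult)

lemma two_sided_annihilator: "two_sided_ideal (annihilator M)"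
  unfolding annihilator_def by (rule two_sided_ideal_kill) (auto intro: smult_closed)

end

section \<open>Verma modules\<close>

abbreviation verma_vec :: "complex \<Rightarrow> complex \<Rightarrow> schr uea \<Rightarrow> complex \<Rightarrow> (schr uea \<times> complex \<Rightarrow>\<^sub>0 int) set" where
  "verma_vec l1 l2 \<equiv> tens (\<lambda>u b. u * borel_incl b) (weight_module l1 l2)"

lemma left_module_verma: "left_module (verma l1 l2)"
  unfolding verma_def by (rule left_module_tensor_product[OF bimodule_verma])

lemma verma_vec_closed: "verma_vec l1 l2 u x \<in> carrier (verma l1 l2)"
  unfolding verma_def by (rule tens_closed) (simp add: weight_module_def)

lemma verma_smult: "s \<odot>\<^bsub>verma l1 l2\<^esub> verma_vec l1 l2 u x = verma_vec l1 l2 (s * u) x"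
  unfolding verma_def by (rule tens_smult[OF bimodule_verma])

text \<open>The left ideal annihilating the highest weight vector; identities between vectors become
  membership statements in \<open>U\<close>.\<close>

definition verma_kernel :: "complex \<Rightarrow> complex \<Rightarrow> schr uea set" where
  "verma_kernel l1 l2 = {u. \<forall>x. verma_vec l1 l2 u x = \<zero>\<^bsub>verma l1 l2\<^esub>}"

lemma verma_kernel_add: "u \<in> verma_kernel l1 l2 \<Longrightarrow> v \<in> verma_kernel l1 l2 \<Longrightarrow> u + v \<in> verma_kernel l1 l2"
proof -
  interpret left_module "verma l1 l2" by (rule left_module_verma)
  have "verma_vec l1 l2 (u + v) x = verma_vec l1 l2 u x \<oplus>\<^bsub>verma l1 l2\<^esub> verma_vec l1 l2 v x" for x
    unfolding verma_def by (rule tens_add_left) (simp add: weight_module_def)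
  then show "u \<in> verma_kernel l1 l2 \<Longrightarrow> v \<in> verma_kernel l1 l2 \<Longrightarrow> u + v \<in> verma_kernel l1 l2"
    by (simp add: verma_kernel_def)
qed

lemma verma_kernel_left: "u \<in> verma_kernel l1 l2 \<Longrightarrow> s * u \<in> verma_kernel l1 l2"
  using left_module.smult_zero_right[OF left_module_verma[of l1 l2], of s]
  by (simp add: verma_kernel_def flip: verma_smult)

lemma verma_kernel_diff: "u \<in> verma_kernel l1 l2 \<Longrightarrow> v \<in> verma_kernel l1 l2 \<Longrightarrow> u - v \<in> verma_kernel l1 l2"
  using verma_kernel_add[of u l1 l2 "- 1 * v"] verma_kernel_left[of v l1 l2 "- 1"] by simp

text \<open>Balancing moves the Borel element to the one-dimensional factor, where subtracting its
  weight makes it act by zero.\<close>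

lemma verma_kernel_borel:
  assumes "f_co x = 0" "q_co x = 0"
  shows "uea_gen x - cscal (l1 * h_co x + l2 * z_co x) \<in> verma_kernel l1 l2"
proof -
  define b where "b = Abs_schr_borel x"
  define w where "w = l1 * h_co x + l2 * z_co x"
  have Rep: "Rep_schr_borel b = x" using assms by (simp add: b_def Abs_schr_borel_inverse)
  have "borel_incl (uea_gen b - cscal w) = uea_gen x - cscal w"
  proof -
    have "borel_incl (uea_gen b - cscal w) = borel_incl (uea_gen b + cscal (- w))"
      by (simp add: cscal_uminus)
    also have "\<dots> = uea_gen x + cscal (- w)"
      unfolding borel_incl_def by (simp only: uea_lift_hom[OF lie_morphism_borel_incl] Rep)
    finally show ?thesis by (simp add: cscal_uminus)
  qed
  moreover have "uea_lift (borel_weight l1 l2) (uea_gen b - cscal w) = 0"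
  proof -
    have "uea_lift (borel_weight l1 l2) (uea_gen b + cscal (- w)) = 0"
      by (simp only: uea_lift_hom[OF lie_morphism_borel_weight])
        (simp add: borel_weight_def Rep w_def cscal_complex_def)
    then show ?thesis by (simp add: cscal_uminus)
  qed
  ultimately have "verma_vec l1 l2 (uea_gen x - cscal w) y = verma_vec l1 l2 1 0" for y
    using tens_balanced[of y "weight_module l1 l2" "\<lambda>u b. u * borel_incl b" 1 "uea_gen b - cscal w"]
    by (simp add: weight_module_def)
  moreover have "verma_vec l1 l2 1 0 = \<zero>\<^bsub>verma l1 l2\<^esub>"
  proof -
    let ?K = "tensor_rels (\<lambda>u b. u * borel_incl b) (weight_module l1 l2)"
    have "frag_of (1, 0 + 0) - frag_of (1, 0) - frag_of (1, 0) \<in> ?K"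
      using tensor_rels_generators(2)[of 0 "weight_module l1 l2" 0 1 "\<lambda>u b. u * borel_incl b"]
      by (simp add: weight_module_def)
    from tensor_rels_closed(3)[OF tensor_rels_closed(1) this]
    show ?thesis by (simp add: verma_def tens_zero_iff)
  qed
  ultimately show ?thesis by (simp add: verma_kernel_def w_def)
qed

lemma verma_kernel_generators:
  "eU \<in> verma_kernel l1 l2" "pU \<in> verma_kernel l1 l2"
  "hU - cscal l1 \<in> verma_kernel l1 l2" "zU - cscal l2 \<in> verma_kernel l1 l2"
  using verma_kernel_borel[of sE l1 l2] verma_kernel_borel[of sP l1 l2] verma_kernel_borel[of sH l1 l2]
    verma_kernel_borel[of sZ l1 l2]
  by (simp_all add: schr_defs)

text \<open>In \<open>c * u \<otimes> x\<close> centrality moves \<open>c\<close> next to the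
  highest weight vector.\<close>

lemma verma_kernel_central:
  assumes "\<And>u. u * c = c * u" "c \<in> verma_kernel l1 l2"
  shows "c \<in> annihilator (verma l1 l2)"
  unfolding verma_def
proof (rule tensor_annihilatorI[OF bimodule_verma], fold verma_def)
  fix u x
  have "c * u \<in> verma_kernel l1 l2" using verma_kernel_left[OF assms(2), of u] unfolding assms(1) .
  then show "c \<odot>\<^bsub>verma l1 l2\<^esub> verma_vec l1 l2 u x = \<zero>\<^bsub>verma l1 l2\<^esub>"
    by (simp add: verma_smult verma_kernel_def)
qed

text \<open>With \<open>m = l1 + 1/2\<close> the hypothesis reads
  \<open>(m + 1)^2 = (n + 1/2)^2\<close>. The Casimir element of sl2 takes the value
  \<open>(m + 1)^2 - 1\<close> at highest weight \<open>m\<close>, and \<open>bC\<close> is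
  \<open>4 z^2\<close> times it.\<close>

lemma verma_kernel_casimir:
  assumes "(2 * l1 + 3)\<^sup>2 = (2 * of_nat n + 1)\<^sup>2"
  shows "bC - cscal (casimir_value n l2) \<in> verma_kernel l1 l2"
proof -
  \<comment> \<open>The eigenvalue of \<open>bH\<close> on the highest weight vector,
    \<open>2 l2\<close> times the sl2-weight \<open>l1 + 1/2\<close>.\<close>
  define c where "c = (l1 + l1 + 1) * l2"
  note closed = verma_kernel_diff verma_kernel_add verma_kernel_left verma_kernel_generators
  have H: "bH - cscal c \<in> verma_kernel l1 l2"
  proof -
    have "bH - cscal c = zU * (hU - cscal l1) + zU * (hU - cscal l1) + (qU * pU + qU * pU)
        + cscal (l1 + l1 + 1) * (zU - cscal l2)"
      unfolding bH_def c_def cscal_mult cscal_add cscal_one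
      by (simp add: schr_normalize algebra_simps cscal_commute[of _ zU, symmetric])
    also have "\<dots> \<in> verma_kernel l1 l2" by (intro closed)
    finally show ?thesis .
  qed
  have E: "bE \<in> verma_kernel l1 l2" unfolding bE_def by (intro closed)
  let ?X = "zU * (bH - cscal c) + cscal c * (zU - cscal l2)"
  have "casimir_value n l2 = c * c + (c * l2 + c * l2 + c * l2 + c * l2)"
    unfolding casimir_value_def assms[symmetric] c_def by (simp add: power2_eq_square algebra_simps)
  then have v: "cscal (casimir_value n l2) = cscal c * cscal c + (cscal c * cscal l2 + cscal c * cscal l2
      + cscal c * cscal l2 + cscal c * cscal l2 :: schr uea)"
    by (simp only: cscal_add cscal_mult)
  have "bC - cscal (casimir_value n l2)
      = (bH + cscal c) * (bH - cscal c) + (?X + ?X + ?X + ?X) + (bF * bE + bF * bE + bF * bE + bF * bE)"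
    unfolding v by (simp add: bC_def b_relations algebra_simps
        cscal_commute[of c bH, symmetric] cscal_commute[of c zU, symmetric])
  also have "\<dots> \<in> verma_kernel l1 l2" by (intro closed E H)
  finally show ?thesis .
qed

section \<open>A model of the Verma modules and of their localization\<close>

text \<open>A function on \<open>\<int> \<times> \<int>\<close> stands for the formal combination of the monomials \<open>f\<^sup>i q\<^sup>j\<close> with these
  coefficients. Allowing negative exponents of \<open>f\<close> and of \<open>q\<close> makes the formulas uniform and \<open>f\<close>
  invertible.\<close>

type_synonym coeffs = "int \<Rightarrow> int \<Rightarrow> complex"

text \<open>Linear endomorphisms as a type of class \<open>complex_algebra\<close>, the form of
  target that \<open>uea_lift\<close> requires.\<close>

typedef lin = "{T :: coeffs \<Rightarrow> coeffs. \<forall>c \<phi> \<psi>.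
    T (\<lambda>i j. c * \<phi> i j + \<psi> i j) = (\<lambda>i j. c * T \<phi> i j + T \<psi> i j)}"
  by (rule exI[of _ id]) simp

setup_lifting type_definition_lin

instantiation lin :: ring_1
begin

lift_definition zero_lin :: lin is "\<lambda>\<phi> i j. 0" by simp
lift_definition one_lin :: lin is "\<lambda>\<phi>. \<phi>" by simp
lift_definition plus_lin :: "lin \<Rightarrow> lin \<Rightarrow> lin" is "\<lambda>S T \<phi> i j. S \<phi> i j + T \<phi> i j"
  by (simp add: algebra_simps)
lift_definition uminus_lin :: "lin \<Rightarrow> lin" is "\<lambda>S \<phi> i j. - S \<phi> i j" by simp
lift_definition minus_lin :: "lin \<Rightarrow> lin \<Rightarrow> lin" is "\<lambda>S T \<phi> i j. S \<phi> i j - T \<phi> i j"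
  by (simp add: algebra_simps)
lift_definition times_lin :: "lin \<Rightarrow> lin \<Rightarrow> lin" is "\<lambda>S T \<phi>. S (T \<phi>)" by simp

instance
proof
  fix R S T :: lin
  show "R * (S + T) = R * S + R * T"
  proof transfer
    fix R S T :: "coeffs \<Rightarrow> coeffs"
    assume "\<forall>c \<phi> \<psi>. R (\<lambda>i j. c * \<phi> i j + \<psi> i j) = (\<lambda>i j. c * R \<phi> i j + R \<psi> i j)"
    then have "R (\<lambda>i j. 1 * S \<phi> i j + T \<phi> i j) = (\<lambda>i j. 1 * R (S \<phi>) i j + R (T \<phi>) i j)" for \<phi> by blast
    then show "(\<lambda>\<phi>. R (\<lambda>i j. S \<phi> i j + T \<phi> i j)) = (\<lambda>\<phi> i j. R (S \<phi>) i j + R (T \<phi>) i j)" by simp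
  qed
  show "(0 :: lin) \<noteq> 1"
  proof transfer
    show "(\<lambda>(\<phi> :: coeffs) (i :: int) (j :: int). 0 :: complex) \<noteq> (\<lambda>\<phi>. \<phi>)"
    proof
      assume "(\<lambda>(\<phi> :: coeffs) (i :: int) (j :: int). 0 :: complex) = (\<lambda>\<phi>. \<phi>)"
      from fun_cong[OF this, where x = "\<lambda>i j. 1"] show False by (simp add: fun_eq_iff)
    qed
  qed
qed (transfer, simp add: algebra_simps)+

end

instantiation lin :: complex_algebra
begin

lift_definition cscal_lin :: "complex \<Rightarrow> lin" is "\<lambda>c \<phi> i j. c * \<phi> i j" by (simp add: algebra_simps)

instance
proof
  fix c d :: complex and T :: lin
  show "cscal c * T = T * cscal c"
  proof transfer
    fix c and T :: "coeffs \<Rightarrow> coeffs"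
    assume lin: "\<forall>c \<phi> \<psi>. T (\<lambda>i j. c * \<phi> i j + \<psi> i j) = (\<lambda>i j. c * T \<phi> i j + T \<psi> i j)"
    note lin[rule_format, of 1 "\<lambda>i j. 0" "\<lambda>i j. 0"]
    then have "T (\<lambda>i j. 0) i j = T (\<lambda>i j. 0) i j + T (\<lambda>i j. 0) i j" for i j by (simp add: fun_eq_iff)
    then have "T (\<lambda>i j. 0) i j = 0" for i j by simp
    moreover note lin[rule_format, of c _ "\<lambda>i j. 0"]
    ultimately show "(\<lambda>\<phi> i j. c * T \<phi> i j) = (\<lambda>\<phi>. T (\<lambda>i j. c * \<phi> i j))" by simp
  qed
qed (transfer, simp add: algebra_simps)+

end

abbreviation app :: "lin \<Rightarrow> coeffs \<Rightarrow> coeffs" where "app \<equiv> Rep_lin"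

lemma app_simps [simp]:
  "app (S + T) \<phi> i j = app S \<phi> i j + app T \<phi> i j"
  "app (S - T) \<phi> i j = app S \<phi> i j - app T \<phi> i j"
  "app (S * T) \<phi> = app S (app T \<phi>)" "app 0 \<phi> i j = 0" "app 1 \<phi> = \<phi>" "app (cscal c) \<phi> i j = c * \<phi> i j"
  by (simp_all add: zero_lin.rep_eq plus_lin.rep_eq minus_lin.rep_eq times_lin.rep_eq one_lin.rep_eq cscal_lin.rep_eq)

lemma app_linear: "app T (\<lambda>i j. c * \<phi> i j + \<psi> i j) = (\<lambda>i j. c * app T \<phi> i j + app T \<psi> i j)"
  using Rep_lin[of T] by blast

lemma app_scale: "app T (\<lambda>i j. c * \<phi> i j) = (\<lambda>i j. c * app T \<phi> i j)"
proof -
  have "app (T * cscal c) \<phi> = app (cscal c * T) \<phi>" by (simp only: cscal_commute)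
  then show ?thesis by (simp add: cscal_lin.rep_eq)
qed

lemma app_zero: "app T (\<lambda>i j. 0) = (\<lambda>i j. 0)"
  using app_scale[of T 0] by simp

lemma app_diff: "app T (\<lambda>i j. \<phi> i j - \<psi> i j) = (\<lambda>i j. app T \<phi> i j - app T \<psi> i j)"
  using app_linear[of T "- 1" \<psi> \<phi>] by simp

lemma lin_eqI: "(\<And>\<phi> i j. app S \<phi> i j = app T \<phi> i j) \<Longrightarrow> S = T"
  by (simp add: Rep_lin_inject[symmetric] fun_eq_iff)

text \<open>Obtained from \<open>e f^i q^j v = i (l1 - j - i + 1) f^(i-1) q^j v + l2 j (j-1)/2 f^i
  q^(j-2) v\<close> and \<open>p f^i q^j v = j l2 f^i q^(j-1) v - i f^(i-1) q^(j+1) v\<close> by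
  collecting the coefficient at the target monomial, whence the index shifts.\<close>

lift_definition model_op :: "complex \<Rightarrow> complex \<Rightarrow> schr \<Rightarrow> lin" is
  "\<lambda>l1 l2 x \<phi> i j.
     e_co x * ((of_int i + 1) * (l1 - of_int j - of_int i) * \<phi> (i + 1) j
       + l2 * (of_int j + 2) * (of_int j + 1) / 2 * \<phi> i (j + 2))
     + h_co x * (l1 - 2 * of_int i - of_int j) * \<phi> i j + f_co x * \<phi> (i - 1) j
     + p_co x * ((of_int j + 1) * l2 * \<phi> i (j + 1) - (of_int i + 1) * \<phi> (i + 1) (j - 1))
     + q_co x * \<phi> i (j - 1) + z_co x * l2 * \<phi> i j"
  by (intro allI ext) (simp add: field_simps)

lemma model_op_linear:
  "model_op l1 l2 (x + y) = model_op l1 l2 x + model_op l1 l2 y"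
  "model_op l1 l2 (lscale c x) = cscal c * model_op l1 l2 x"
  by (rule lin_eqI, simp add: model_op.rep_eq schr_defs field_simps)+

lemma model_op_basis:
  assumes "s \<in> {sE, sH, sF, sP, sQ, sZ}" "t \<in> {sE, sH, sF, sP, sQ, sZ}"
  shows "model_op l1 l2 (lbr s t) = model_op l1 l2 s * model_op l1 l2 t - model_op l1 l2 t * model_op l1 l2 s"
proof (rule lin_eqI)
  fix \<phi> i j
  show "app (model_op l1 l2 (lbr s t)) \<phi> i j
      = app (model_op l1 l2 s * model_op l1 l2 t - model_op l1 l2 t * model_op l1 l2 s) \<phi> i j"
    using assms
    by (elim insertE emptyE; hypsubst; simp add: model_op.rep_eq schr_defs; simp add: field_simps)
qed

lemma lie_morphism_model_op: "lie_morphism (model_op l1 l2)"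
proof -
  define P where "P x y \<longleftrightarrow>
    model_op l1 l2 (lbr x y) = model_op l1 l2 x * model_op l1 l2 y - model_op l1 l2 y * model_op l1 l2 x" for x y
  have add: "P (x + x') y" if "P x y" "P x' y" for x x' y
    using that by (simp add: P_def lbr_add_left model_op_linear algebra_simps)
  have scale: "P (lscale c x) y" if "P x y" for c x y
    using that by (simp add: P_def lbr_scale_left model_op_linear right_diff_distrib mult.assoc
        cscal_left_commute[of "model_op _ _ _"])
  have add': "P x (y + y')" if "P x y" "P x y'" for x y y'
    using that by (simp add: P_def lbr_add_right model_op_linear algebra_simps)
  have scale': "P x (lscale c y)" if "P x y" for c x y
    using that by (simp add: P_def lbr_scale_right model_op_linear right_diff_distrib mult.assoc
        cscal_left_commute[of "model_op _ _ _"])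
  have basis: "P s t" if "s \<in> {sE, sH, sF, sP, sQ, sZ}" "t \<in> {sE, sH, sF, sP, sQ, sZ}" for s t
    using model_op_basis[OF that] by (simp add: P_def)
  have left: "P x t" if "t \<in> {sE, sH, sF, sP, sQ, sZ}" for x t
    by (subst schr_span[of x], intro add scale basis that) simp_all
  have "P x y" for x y
    by (subst schr_span[of y], intro add' scale' left) simp_all
  then show ?thesis unfolding lie_morphism_def P_def by (simp add: model_op_linear)
qed

definition model_act :: "complex \<Rightarrow> complex \<Rightarrow> schr uea \<Rightarrow> coeffs \<Rightarrow> coeffs" where
  "model_act l1 l2 u = app (uea_lift (model_op l1 l2) u)"

lemma model_act_simps:
  "model_act l1 l2 (uea_gen x) = app (model_op l1 l2 x)"
  "model_act l1 l2 (cscal c) \<phi> i j = c * \<phi> i j"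
  "model_act l1 l2 1 \<phi> = \<phi>"
  "model_act l1 l2 (u + v) \<phi> i j = model_act l1 l2 u \<phi> i j + model_act l1 l2 v \<phi> i j"
  "model_act l1 l2 (u * v) \<phi> = model_act l1 l2 u (model_act l1 l2 v \<phi>)"
  by (simp_all add: model_act_def uea_lift_hom[OF lie_morphism_model_op])

lemma model_act_linear:
  "model_act l1 l2 u (\<lambda>i j. 0) = (\<lambda>i j. 0)"
  "model_act l1 l2 u (\<lambda>i j. c * \<phi> i j) = (\<lambda>i j. c * model_act l1 l2 u \<phi> i j)"
  "model_act l1 l2 u (\<lambda>i j. \<phi> i j - \<psi> i j) = (\<lambda>i j. model_act l1 l2 u \<phi> i j - model_act l1 l2 u \<psi> i j)"
  by (simp_all add: model_act_def app_zero app_scale app_diff)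

lemma model_act_add:
  "model_act l1 l2 u (\<lambda>i j. \<phi> i j + \<psi> i j) = (\<lambda>i j. model_act l1 l2 u \<phi> i j + model_act l1 l2 u \<psi> i j)"
  using app_linear[of _ 1 \<phi> \<psi>] by (simp add: model_act_def)

lemma model_act_fU_power: "model_act l1 l2 (fU ^ k * u) \<phi> i j = model_act l1 l2 u \<phi> (i - int k) j"
proof (induction k arbitrary: i)
  case (Suc k)
  have "model_act l1 l2 (fU ^ Suc k * u) \<phi> i j = model_act l1 l2 fU (model_act l1 l2 (fU ^ k * u) \<phi>) i j"
    by (simp only: power_Suc mult.assoc model_act_simps)
  also have "\<dots> = model_act l1 l2 (fU ^ k * u) \<phi> (i - 1) j"
    by (simp add: fU_def model_act_simps model_op.rep_eq sF_def)
  finally show ?case using Suc by (simp add: algebra_simps)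
qed simp

text \<open>Only \<open>e\<close> and \<open>p\<close> carry row \<open>i + 1\<close> into row
  \<open>i\<close>, and there the factor \<open>i + 1\<close> vanishes at the boundary
  \<open>i = -1\<close>.\<close>

lemma model_act_support:
  assumes "\<And>i j. i < 0 \<Longrightarrow> \<phi> i j = 0"
  shows "i < 0 \<Longrightarrow> model_act l1 l2 u \<phi> i j = 0"
  using assms
proof (induction u arbitrary: \<phi> i j rule: uea_gen_induct)
  case (gen x)
  then show ?case by (cases "i = - 1") (simp_all add: model_act_simps model_op.rep_eq)
qed (simp_all add: model_act_simps)

definition model_vac :: coeffs where
  "model_vac i j = (if i = 0 \<and> j = 0 then 1 else 0)"

lemma model_act_borel: "model_act l1 l2 (borel_incl b) model_vac = (\<lambda>i j. uea_lift (borel_weight l1 l2) b * model_vac i j)"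
proof (induction b rule: uea_gen_induct)
  case (gen x)
  have x: "f_co (Rep_schr_borel x) = 0" "q_co (Rep_schr_borel x) = 0" using Rep_schr_borel[of x] by simp_all
  have w: "uea_lift (borel_weight l1 l2) (uea_gen x)
      = l1 * h_co (Rep_schr_borel x) + l2 * z_co (Rep_schr_borel x)"
    unfolding uea_lift_gen[OF lie_morphism_borel_weight] borel_weight_def ..
  \<comment> \<open>Each term reaches the single nonzero entry of \<open>model_vac\<close> exactly
    where its numerical factor is zero.\<close>
  have vanish: "(of_int i + 1) * (l1 - of_int j - of_int i) * model_vac (i + 1) j = 0"
    "l2 * (of_int j + 2) * (of_int j + 1) / 2 * model_vac i (j + 2) = 0"
    "(of_int j + 1) * l2 * model_vac i (j + 1) = 0" "(of_int i + 1) * model_vac (i + 1) (j - 1) = 0" for i j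
    by (cases "i = - 1"; cases "j = - 1"; cases "j = - 2"; simp add: model_vac_def)+
  show ?case
    unfolding borel_incl_def uea_lift_gen[OF lie_morphism_borel_incl] w model_act_simps model_op.rep_eq x vanish
    by (intro ext) (simp add: model_vac_def algebra_simps)
next
  case (mult u v)
  then show ?case
    by (simp add: borel_incl_def uea_lift_hom[OF lie_morphism_borel_incl] uea_lift_hom[OF lie_morphism_borel_weight]
        model_act_simps model_act_linear mult.assoc mult.left_commute)
next
  case (add u v)
  then show ?case
    by (simp add: borel_incl_def uea_lift_hom[OF lie_morphism_borel_incl] uea_lift_hom[OF lie_morphism_borel_weight]
        model_act_simps fun_eq_iff distrib_right)
next
  case (scal c)
  show ?case
    by (simp add: borel_incl_def uea_lift_hom[OF lie_morphism_borel_incl] uea_lift_hom[OF lie_morphism_borel_weight]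
        model_act_simps fun_eq_iff cscal_complex_def)
qed

definition verma_pairing :: "complex \<Rightarrow> complex \<Rightarrow> int \<Rightarrow> int \<Rightarrow> schr uea \<Rightarrow> complex \<Rightarrow> complex" where
  "verma_pairing l1 l2 i j u x = x * model_act l1 l2 u model_vac i j"

lemma balanced_verma_pairing:
  "balanced_map (\<lambda>u b. u * borel_incl b) (weight_module l1 l2) (verma_pairing l1 l2 i j)"
  unfolding balanced_map_def verma_pairing_def
  by (simp add: weight_module_def model_act_simps model_act_borel model_act_linear distrib_left distrib_right
      mult.assoc mult.left_commute)

lemma one_notin_annihilator_verma: "1 \<notin> annihilator (verma l1 l2)"
proof
  assume "1 \<in> annihilator (verma l1 l2)"
  then have "1 \<odot>\<^bsub>verma l1 l2\<^esub> verma_vec l1 l2 1 1 = \<zero>\<^bsub>verma l1 l2\<^esub>"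
    using verma_vec_closed by (simp add: annihilator_def)
  then have "verma_vec l1 l2 1 1 = \<zero>\<^bsub>verma l1 l2\<^esub>" by (simp add: verma_smult)
  moreover have "verma_vec l1 l2 1 1 \<noteq> \<zero>\<^bsub>verma l1 l2\<^esub>"
    unfolding verma_def
    by (rule tens_nonzero[OF balanced_verma_pairing[of _ _ 0 0]])
      (simp add: verma_pairing_def model_act_simps model_vac_def)
  ultimately show False by contradiction
qed

text \<open>Together the functionals form a \<open>U\<close>-equivariant map from the Verma module
  to arrays, see \<open>verma_coeffs_smult\<close>.\<close>

definition verma_coeffs :: "complex \<Rightarrow> complex \<Rightarrow> (schr uea \<times> complex \<Rightarrow>\<^sub>0 int) set \<Rightarrow> coeffs" where
  "verma_coeffs l1 l2 A i j = tensor_lift (verma_pairing l1 l2 i j) A"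

lemma verma_coset_cases:
  assumes "A \<in> carrier (verma l1 l2)"
  obtains a where "A = additive_coset (tensor_rels (\<lambda>u b. u * borel_incl b) (weight_module l1 l2)) a"
  using assms by (auto simp: verma_def tensor_product_def Let_def)

lemma verma_coeffs_coset:
  "verma_coeffs l1 l2 (additive_coset (tensor_rels (\<lambda>u b. u * borel_incl b) (weight_module l1 l2)) a)
     = (\<lambda>i j. frag_lift (verma_pairing l1 l2 i j) a)"
  by (simp add: verma_coeffs_def fun_eq_iff tensor_lift_coset[OF balanced_verma_pairing])

lemma verma_coeffs_vec: "verma_coeffs l1 l2 (verma_vec l1 l2 u x) = (\<lambda>i j. x * model_act l1 l2 u model_vac i j)"
  unfolding tens_def verma_coeffs_coset by (simp add: verma_pairing_def)

lemma verma_coeffs_add: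
  assumes "A \<in> carrier (verma l1 l2)" "B \<in> carrier (verma l1 l2)"
  shows "verma_coeffs l1 l2 (A \<oplus>\<^bsub>verma l1 l2\<^esub> B) = (\<lambda>i j. verma_coeffs l1 l2 A i j + verma_coeffs l1 l2 B i j)"
proof -
  let ?K = "tensor_rels (\<lambda>u b. u * borel_incl b) (weight_module l1 l2)"
  obtain a b where "A = additive_coset ?K a" "B = additive_coset ?K b"
    using assms verma_coset_cases by metis
  moreover have "additive_coset ?K a \<oplus>\<^bsub>verma l1 l2\<^esub> additive_coset ?K b = additive_coset ?K (a + b)"
    unfolding verma_def by (rule tensor_add)
  ultimately show ?thesis by (simp add: verma_coeffs_coset frag_lift_add)
qed

lemma verma_coeffs_smult:
  assumes "A \<in> carrier (verma l1 l2)"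
  shows "verma_coeffs l1 l2 (s \<odot>\<^bsub>verma l1 l2\<^esub> A) = model_act l1 l2 s (verma_coeffs l1 l2 A)"
proof -
  let ?K = "tensor_rels (\<lambda>u b. u * borel_incl b) (weight_module l1 l2)"
  obtain a where a: "A = additive_coset ?K a" using assms by (rule verma_coset_cases)
  have "(\<lambda>i j. frag_lift (verma_pairing l1 l2 i j) (act_first (*) s a))
      = model_act l1 l2 s (\<lambda>i j. frag_lift (verma_pairing l1 l2 i j) a)"
  proof (rule frag_induction[of a UNIV])
    fix p
    show "(\<lambda>i j. frag_lift (verma_pairing l1 l2 i j) (act_first (*) s (frag_of p)))
      = model_act l1 l2 s (\<lambda>i j. frag_lift (verma_pairing l1 l2 i j) (frag_of p))"
      by (cases p) (simp add: verma_pairing_def model_act_simps model_act_linear)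
  qed (simp_all add: model_act_linear fun_eq_iff)
  moreover have "s \<odot>\<^bsub>verma l1 l2\<^esub> A = additive_coset ?K (act_first (*) s a)"
    unfolding a verma_def by (rule tensor_product_smult[OF bimodule_verma])
  ultimately show ?thesis unfolding a by (simp add: verma_coeffs_coset)
qed

lemma verma_coeffs_support:
  assumes "A \<in> carrier (verma l1 l2)" "i < 0"
  shows "verma_coeffs l1 l2 A i j = 0"
proof -
  obtain a where a: "A = additive_coset (tensor_rels (\<lambda>u b. u * borel_incl b) (weight_module l1 l2)) a"
    using assms(1) by (rule verma_coset_cases)
  have "model_act l1 l2 u model_vac i j = 0" for u
    using assms(2) by (intro model_act_support) (simp_all add: model_vac_def)
  then show ?thesis unfolding a verma_coeffs_coset by (simp add: frag_lift_def verma_pairing_def)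
qed

text \<open>On arrays \<open>f\<close> is an invertible row shift, so the action extends to the
  localization. The choice ranges over presentations as a fraction, which
  \<open>loc_act_frac\<close> shows to agree.\<close>

definition loc_act :: "complex \<Rightarrow> complex \<Rightarrow> f_loc \<Rightarrow> coeffs \<Rightarrow> coeffs" where
  "loc_act l1 l2 x \<phi> = (SOME g. \<exists>k u. x = lfrac k u \<and> g = (\<lambda>i j. model_act l1 l2 u \<phi> (i + int k) j))"

lemma loc_act_frac: "loc_act l1 l2 (lfrac k u) \<phi> = (\<lambda>i j. model_act l1 l2 u \<phi> (i + int k) j)"
proof -
  have unique: "g = (\<lambda>i j. model_act l1 l2 u \<phi> (i + int k) j)"
    if "\<exists>k' u'. lfrac k u = lfrac k' u' \<and> g = (\<lambda>i j. model_act l1 l2 u' \<phi> (i + int k') j)" for g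
    using that
  proof (elim exE conjE)
    fix k' u' assume "lfrac k u = lfrac k' u'" and g: "g = (\<lambda>i j. model_act l1 l2 u' \<phi> (i + int k') j)"
    then obtain a b where ab: "a + k = b + k'" "fU ^ a * u = fU ^ b * u'" by (auto simp: frac_eq_iff)
    have eq: "model_act l1 l2 u' \<phi> (i + int k') j = model_act l1 l2 u \<phi> (i + int k) j" for i j
    proof -
      have "model_act l1 l2 u' \<phi> (i + int k') j = model_act l1 l2 (fU ^ b * u') \<phi> (i + int (b + k')) j"
        by (simp add: model_act_fU_power)
      also have "\<dots> = model_act l1 l2 u \<phi> (i + int k) j"
        unfolding ab[symmetric] by (simp add: model_act_fU_power)
      finally show ?thesis .
    qed
    show "g = (\<lambda>i j. model_act l1 l2 u \<phi> (i + int k) j)" unfolding g by (intro ext) (rule eq)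
  qed
  show ?thesis unfolding loc_act_def by (rule some_equality[OF _ unique]) (rule exI[of _ k], rule exI[of _ u], simp)
qed

lemma loc_act_add: "loc_act l1 l2 (x + y) \<phi> i j = loc_act l1 l2 x \<phi> i j + loc_act l1 l2 y \<phi> i j"
  by (rule frac_common[of x y]) (simp add: frac_add_same loc_act_frac model_act_simps)

lemma loc_act_mult: "loc_act l1 l2 (x * lfrac 0 r) \<phi> = loc_act l1 l2 x (model_act l1 l2 r \<phi>)"
proof (cases x)
  case (1 k u)
  have "x * lfrac 0 r = lfrac k (u * r)" unfolding 1 using frac_mult[of 0 u u 0 k r] by simp
  then show ?thesis by (simp add: 1 loc_act_frac model_act_simps)
qed

lemma loc_act_add_right:
  "loc_act l1 l2 x (\<lambda>i j. \<phi> i j + \<psi> i j) i j = loc_act l1 l2 x \<phi> i j + loc_act l1 l2 x \<psi> i j"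
  by (cases x) (simp add: loc_act_frac model_act_add)

text \<open>The coefficients in rows \<open>i < 0\<close> of \<open>x \<cdot> \<phi>\<close>, for \<open>\<phi>\<close> in the Verma module, depend only on the
  class of \<open>x\<close> in \<open>S\<^sub>f\<close>; one of them detects the vector of \<open>V(n,\<lambda>\<^sub>2)\<close> constructed below.\<close>

definition sf_pairing ::
    "complex \<Rightarrow> complex \<Rightarrow> int \<Rightarrow> sf \<Rightarrow> (schr uea \<times> complex \<Rightarrow>\<^sub>0 int) set \<Rightarrow> complex" where
  "sf_pairing l1 l2 j s A = loc_act l1 l2 (rep_sf s) (verma_coeffs l1 l2 A) (- 1) j"

lemma sf_pairing_abs:
  assumes "A \<in> carrier (verma l1 l2)"
  shows "sf_pairing l1 l2 j (abs_sf x) A = loc_act l1 l2 x (verma_coeffs l1 l2 A) (- 1) j"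
proof -
  have "sf_rel (rep_sf (abs_sf x)) x"
    using Quotient3_rep_abs[OF Quotient3_sf] sf_rel_refl by blast
  then obtain u where u: "rep_sf (abs_sf x) - x = lfrac 0 u" by (auto simp: sf_rel_def)
  then have "rep_sf (abs_sf x) = lfrac 0 u + x" by (simp add: algebra_simps)
  moreover have "loc_act l1 l2 (lfrac 0 u) (verma_coeffs l1 l2 A) (- 1) j = 0"
    unfolding loc_act_frac using assms by (intro model_act_support verma_coeffs_support) simp_all
  ultimately show ?thesis by (simp add: sf_pairing_def loc_act_add)
qed

lemma sf_cases: obtains x where "s = abs_sf x"
  using Quotient3_abs_rep[OF Quotient3_sf] by metis

lemma balanced_sf_pairing: "balanced_map sf_right (verma l1 l2) (sf_pairing l1 l2 j)"
  unfolding balanced_map_def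
proof (intro conjI allI ballI)
  interpret left_module "verma l1 l2" by (rule left_module_verma)
  fix s s' :: sf and A B and r :: "schr uea"
  assume A: "A \<in> carrier (verma l1 l2)"
  obtain x where x: "s = abs_sf x" by (rule sf_cases)
  obtain y where y: "s' = abs_sf y" by (rule sf_cases)
  show "sf_pairing l1 l2 j (s + s') A = sf_pairing l1 l2 j s A + sf_pairing l1 l2 j s' A"
    unfolding x y plus_sf.abs_eq sf_pairing_abs[OF A] by (rule loc_act_add)
  show "sf_pairing l1 l2 j (sf_right s r) A = sf_pairing l1 l2 j s (r \<odot>\<^bsub>verma l1 l2\<^esub> A)"
    unfolding x sf_right.abs_eq sf_pairing_abs[OF A] sf_pairing_abs[OF smult_closed[OF A]]
      loc_act_mult verma_coeffs_smult[OF A] ..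
  show "sf_pairing l1 l2 j s (A \<oplus>\<^bsub>verma l1 l2\<^esub> B) = sf_pairing l1 l2 j s A + sf_pairing l1 l2 j s B"
    if B: "B \<in> carrier (verma l1 l2)"
    unfolding x sf_pairing_abs[OF A] sf_pairing_abs[OF B] sf_pairing_abs[OF a_closed[OF A B]]
      verma_coeffs_add[OF A B] by (rule loc_act_add_right)
qed

section \<open>A vector in the completion\<close>

lemma verma_vec_cong:
  assumes "u - v \<in> verma_kernel l1 l2"
  shows "verma_vec l1 l2 u x = verma_vec l1 l2 v x"
proof -
  interpret left_module "verma l1 l2" by (rule left_module_verma)
  have "verma_vec l1 l2 ((u - v) + v) x = verma_vec l1 l2 (u - v) x \<oplus>\<^bsub>verma l1 l2\<^esub> verma_vec l1 l2 v x"
    unfolding verma_def by (rule tens_add_left) (simp add: weight_module_def)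
  also have "\<dots> = verma_vec l1 l2 v x"
    using assms verma_vec_closed by (simp add: verma_kernel_def)
  finally show ?thesis by simp
qed

section \<open>Action of \<open>h\<close>, \<open>p\<close>, \<open>e\<close> on monomials in
  \<open>f\<close> and \<open>q\<close>\<close>

lemma hU_qU_power: "hU * qU ^ j = qU ^ j * hU - cscal (of_nat j) * qU ^ j"
proof (induction j)
  case (Suc j)
  have "hU * qU ^ Suc j = qU * (hU * qU ^ j) - qU ^ Suc j"
    by (simp add: schr_normalize left_diff_distrib mult.assoc)
  also have "\<dots> = qU ^ Suc j * hU - cscal (of_nat (Suc j)) * qU ^ Suc j"
    unfolding Suc by (simp add: cscal_add cscal_one algebra_simps cscal_left_commute[of qU])
  finally show ?case .
qed simp

lemma hU_fU_power: "hU * fU ^ i = fU ^ i * hU - (cscal (of_nat i) + cscal (of_nat i)) * fU ^ i"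
proof (induction i)
  case (Suc i)
  have "hU * fU ^ Suc i = fU * (hU * fU ^ i) - (fU ^ Suc i + fU ^ Suc i)"
    by (simp add: schr_normalize left_diff_distrib distrib_right mult.assoc)
  also have "\<dots> = fU ^ Suc i * hU - (cscal (of_nat (Suc i)) + cscal (of_nat (Suc i))) * fU ^ Suc i"
    unfolding Suc by (simp add: cscal_add cscal_one algebra_simps cscal_left_commute[of fU])
  finally show ?case .
qed simp

lemma eU_fU_power: "eU * fU ^ i = fU ^ i * eU + cscal (of_nat i) * (fU ^ (i - 1) * (hU - cscal (of_nat i - 1)))"
proof (induction i)
  case (Suc i)
  define a F where "a = (cscal (of_nat i) :: schr uea)" and "F = fU ^ i"
  have aF: "F * a = a * F" by (simp only: a_def cscal_commute)
  have "cscal (of_nat i) * (fU ^ Suc (i - 1) * x) = a * (F * x)" for x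
    by (cases i) (simp_all add: a_def F_def)
  then have shift: "fU * (cscal (of_nat i) * (fU ^ (i - 1) * x)) = a * (F * x)" for x
    by (simp add: cscal_left_commute[of fU] mult.assoc)
  have "eU * fU ^ Suc i = fU * (eU * F) + hU * F"
    by (simp add: schr_normalize distrib_right mult.assoc F_def)
  also have "\<dots> = fU * (F * eU) + a * (F * (hU - (a - 1))) + (F * hU - (a + a) * F)"
    unfolding F_def Suc hU_fU_power distrib_left shift
    by (simp only: cscal_diff cscal_one F_def a_def)
  also have "\<dots> = fU * (F * eU) + (a + 1) * (F * (hU - a))"
    by (simp add: algebra_simps aF)
  finally show ?case by (simp add: F_def a_def cscal_add cscal_one mult.assoc add.commute)
qed simp

text \<open>The Ore witness for \<open>e f^-k = f^-(k+1) (f e - k (h + k + 1))\<close>, in the shape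
  consumed by \<open>frac_mult\<close>.\<close>

lemma fU_power_eU:
  "fU ^ Suc k * eU = (fU * eU - cscal (of_nat k) * (hU + cscal (of_nat k + 1))) * fU ^ k"
proof (induction k)
  case (Suc k)
  define a where "a = (cscal (of_nat k) :: schr uea)"
  have af: "fU * a = a * fU" by (simp only: a_def cscal_commute)
  have "fU * (fU * eU - a * (hU + (a + 1))) = (fU * eU - (a + 1) * (hU + (a + 1 + 1))) * fU"
    by (simp add: schr_normalize algebra_simps af af[THEN mult_rewrite_assoc])
  then have "fU * ((fU * eU - a * (hU + (a + 1))) * fU ^ k)
      = (fU * eU - (a + 1) * (hU + (a + 1 + 1))) * fU ^ Suc k"
    by (simp only: power_Suc mult.assoc[symmetric])
  moreover have "fU ^ Suc (Suc k) * eU = fU * (fU ^ Suc k * eU)" by (simp only: power_Suc mult.assoc)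
  moreover have "cscal (of_nat (Suc k)) = a + 1"
    by (simp only: of_nat_Suc a_def cscal_add cscal_one add.commute)
  ultimately show ?case
    unfolding Suc by (simp only: cscal_add[of "of_nat _" 1] cscal_one a_def[symmetric])
qed simp

lemma verma_kernel_zU: "zU * u - cscal l2 * u \<in> verma_kernel l1 l2"
proof -
  have "zU * u - cscal l2 * u = u * (zU - cscal l2)"
    by (simp add: right_diff_distrib zU_commute[of u] cscal_commute)
  then show ?thesis by (simp add: verma_kernel_left verma_kernel_generators)
qed

lemma verma_hU_monomial:
  "hU * (fU ^ i * qU ^ j) - cscal (l1 - 2 * of_nat i - of_nat j) * (fU ^ i * qU ^ j) \<in> verma_kernel l1 l2"
proof -
  define a b c F Q where "a = (cscal (of_nat i) :: schr uea)" and "b = (cscal (of_nat j) :: schr uea)"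
    and "c = (cscal l1 :: schr uea)" and "F = fU ^ i" and "Q = qU ^ j"
  have comm: "F * b = b * F" "Q * c = c * Q" "F * c = c * F" by (simp_all only: b_def c_def cscal_commute)
  have h: "hU * F = F * hU - (a + a) * F" "hU * Q = Q * hU - b * Q"
    unfolding F_def Q_def a_def b_def by (rule hU_fU_power hU_qU_power)+
  have "hU * (F * Q) - (c - (a + a) - b) * (F * Q) = (F * Q) * (hU - c)"
    by (simp add: algebra_simps comm comm[THEN mult_rewrite_assoc] h h[THEN mult_rewrite_assoc])
  moreover have "cscal (l1 - 2 * of_nat i - of_nat j) = c - (a + a) - b"
    by (simp only: cscal_diff mult_2 cscal_add a_def b_def c_def)
  ultimately show ?thesis
    using verma_kernel_left[OF verma_kernel_generators(3), of "F * Q" l1 l2] by (simp only: F_def Q_def c_def)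
qed

lemma verma_pU_qU: "pU * qU ^ j - cscal (of_nat j * l2) * qU ^ (j - 1) \<in> verma_kernel l1 l2"
proof -
  have "pU * qU ^ j - cscal (of_nat j * l2) * qU ^ (j - 1)
      = qU ^ j * pU + cscal (of_nat j) * (zU * qU ^ (j - 1) - cscal l2 * qU ^ (j - 1))"
    unfolding pU_qU_power by (simp add: right_diff_distrib cscal_mult mult.assoc)
  then show ?thesis
    by (simp only: verma_kernel_add verma_kernel_left verma_kernel_generators verma_kernel_zU)
qed

lemma verma_eU_qU:
  "eU * qU ^ j - cscal (l2 * of_nat j * (of_nat j - 1) / 2) * qU ^ (j - 2) \<in> verma_kernel l1 l2"
proof (induction j)
  case 0
  show ?case by (simp add: verma_kernel_generators)
next
  case (Suc j)
  define c where "c j = l2 * of_nat j * (of_nat j - 1) / 2" for j :: nat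
  have c: "c (Suc j) = c j + of_nat j * l2" by (simp add: c_def field_simps)
  \<comment> \<open>Truncated exponents occur only for \<open>j \<le> 1\<close>, where
    \<open>c j\<close> is zero.\<close>
  have "qU * (cscal (c j) * qU ^ (j - 2)) = cscal (c j) * qU ^ (j - 1)"
  proof (cases "j \<le> 1")
    case True
    then have "c j = 0" by (cases j) (simp_all add: c_def)
    then show ?thesis by simp
  next
    case False
    then have "j - 1 = Suc (j - 2)" by simp
    then show ?thesis by (simp only: power_Suc cscal_left_commute)
  qed
  moreover have "eU * qU ^ Suc j = qU * (eU * qU ^ j) + pU * qU ^ j"
    by (simp add: schr_normalize distrib_right mult.assoc)
  ultimately have "eU * qU ^ Suc j - cscal (c (Suc j)) * qU ^ (j - 1)
      = qU * (eU * qU ^ j - cscal (c j) * qU ^ (j - 2))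
        + (pU * qU ^ j - cscal (of_nat j * l2) * qU ^ (j - 1))"
    unfolding c by (simp add: cscal_add algebra_simps)
  also have "\<dots> \<in> verma_kernel l1 l2"
    using Suc unfolding c_def by (intro verma_kernel_add verma_kernel_left verma_pU_qU)
  finally show ?case by (simp add: c_def diff_diff_eq)
qed

lemma verma_eU_monomial:
  "eU * (fU ^ i * qU ^ j) - (cscal (of_nat i * (l1 - of_nat j - of_nat i + 1)) * (fU ^ (i - 1) * qU ^ j)
     + cscal (l2 * of_nat j * (of_nat j - 1) / 2) * (fU ^ i * qU ^ (j - 2))) \<in> verma_kernel l1 l2"
proof -
  define d c where "d = l1 - of_nat j - of_nat i + 1" and "c = l2 * of_nat j * (of_nat j - 1) / 2"
  have h: "(hU - cscal (of_nat i - 1)) * qU ^ j - cscal d * qU ^ j \<in> verma_kernel l1 l2"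
  proof -
    have "(hU - cscal (of_nat i - 1)) * qU ^ j - cscal d * qU ^ j
        = hU * (fU ^ 0 * qU ^ j) - cscal (l1 - 2 * of_nat 0 - of_nat j) * (fU ^ 0 * qU ^ j)"
      by (simp add: d_def left_diff_distrib cscal_diff cscal_add distrib_right)
    then show ?thesis using verma_hU_monomial[of 0 j l1 l2] by (simp only:)
  qed
  have "eU * (fU ^ i * qU ^ j) - (cscal (of_nat i * d) * (fU ^ (i - 1) * qU ^ j) + cscal c * (fU ^ i * qU ^ (j - 2)))
      = fU ^ i * (eU * qU ^ j - cscal c * qU ^ (j - 2))
        + cscal (of_nat i) * (fU ^ (i - 1) * ((hU - cscal (of_nat i - 1)) * qU ^ j - cscal d * qU ^ j))"
  proof -
    have "eU * (fU ^ i * qU ^ j) = fU ^ i * (eU * qU ^ j)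
        + cscal (of_nat i) * (fU ^ (i - 1) * ((hU - cscal (of_nat i - 1)) * qU ^ j))"
      unfolding mult.assoc[symmetric] eU_fU_power by (simp only: distrib_right mult.assoc)
    then show ?thesis
      by (simp add: right_diff_distrib cscal_left_commute[of "fU ^ _"] cscal_mult mult.assoc)
  qed
  also have "\<dots> \<in> verma_kernel l1 l2"
    unfolding c_def by (intro verma_kernel_add verma_kernel_left verma_eU_qU h)
  finally show ?thesis unfolding d_def c_def .
qed

lemma verma_kernel_sum: "(\<And>i. i \<in> S \<Longrightarrow> g i \<in> verma_kernel l1 l2) \<Longrightarrow> sum g S \<in> verma_kernel l1 l2"
  using verma_kernel_left[OF verma_kernel_generators(1), of 0 l1 l2]
  by (induction S rule: infinite_finite_induct) (auto intro: verma_kernel_add)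

text \<open>The vector \<open>\<Sum> c\<^sub>i f\<^sup>i q\<^bsup>2n+1-2i\<^esup> v\<close> of weight \<open>-n-2\<close> in \<open>\<Delta>(n-1,\<lambda>\<^sub>2)\<close> is killed by \<open>e\<close>; in
  \<open>S\<^sub>f \<otimes> \<Delta>(n-1,\<lambda>\<^sub>2)\<close> it becomes divisible by \<open>f\<close> and yields the \<open>(n+1)\<close>-dimensional simple
  \<open>sl\<^sub>2\<close>-module.\<close>

definition singular_coeff :: "nat \<Rightarrow> complex \<Rightarrow> nat \<Rightarrow> complex" where
  "singular_coeff n l i = l ^ i * (\<Prod>t<i. (2 * of_nat n + 1 - 2 * of_nat t) / of_nat (Suc t))"

definition singular :: "nat \<Rightarrow> complex \<Rightarrow> schr uea" where
  "singular n l = (\<Sum>i\<le>n. cscal (singular_coeff n l i) * (fU ^ i * qU ^ (2 * n + 1 - 2 * i)))"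

text \<open>The recurrence under which the two terms of \<open>e\<close> acting on neighbouring
  summands cancel.\<close>

lemma singular_coeff_Suc:
  "of_nat (Suc i) * singular_coeff n l (Suc i) = l * (2 * of_nat n + 1 - 2 * of_nat i) * singular_coeff n l i"
  by (simp add: singular_coeff_def field_simps del: of_nat_Suc)

lemma singular_exponent: "i \<le> n \<Longrightarrow> complex_of_nat (2 * n + 1 - 2 * i) = 2 * of_nat n + 1 - 2 * of_nat i"
  by (simp add: of_nat_diff)

lemma hU_singular: "hU * singular n l - cscal (- of_nat n - 2) * singular n l \<in> verma_kernel (of_nat n - 1) l"
proof -
  let ?c = "singular_coeff n l" and ?B = "\<lambda>i. fU ^ i * qU ^ (2 * n + 1 - 2 * i)"
  have "hU * ?B i - cscal (- of_nat n - 2) * ?B i \<in> verma_kernel (of_nat n - 1) l" if "i \<le> n" for i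
  proof -
    have "of_nat n - 1 - 2 * of_nat i - of_nat (2 * n + 1 - 2 * i) = - of_nat n - (2 :: complex)"
      unfolding singular_exponent[OF that] by simp
    from verma_hU_monomial[of i "2 * n + 1 - 2 * i" "of_nat n - 1" l, unfolded this] show ?thesis .
  qed
  then have "(\<Sum>i\<le>n. cscal (?c i) * (hU * ?B i - cscal (- of_nat n - 2) * ?B i)) \<in> verma_kernel (of_nat n - 1) l"
    by (intro verma_kernel_sum verma_kernel_left) simp
  also have "(\<Sum>i\<le>n. cscal (?c i) * (hU * ?B i - cscal (- of_nat n - 2) * ?B i))
      = hU * singular n l - cscal (- of_nat n - 2) * singular n l"
    unfolding singular_def sum_distrib_left sum_subtractf[symmetric] right_diff_distrib cscal_left_commute[of hU]
    by (intro sum.cong refl arg_cong2[where f = "(-)"] cscal_left_commute[symmetric])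
  finally show ?thesis .
qed

lemma eU_singular: "eU * singular n l \<in> verma_kernel (of_nat n - 1) l"
proof -
  let ?c = "singular_coeff n l" and ?j = "\<lambda>i. 2 * n + 1 - 2 * i"
  define a b :: "nat \<Rightarrow> complex"
    where "a = (\<lambda>i. of_nat i * (of_nat i - of_nat n - 1))"
      and "b = (\<lambda>i. l * (2 * of_nat n + 1 - 2 * of_nat i) * (of_nat n - of_nat i))"
  let ?X = "\<lambda>i. cscal (?c i * a i) * (fU ^ (i - 1) * qU ^ ?j i)"
  let ?Y = "\<lambda>i. cscal (?c i * b i) * (fU ^ i * qU ^ (?j i - 2))"
  let ?M = "\<lambda>i. cscal (?c i) * (eU * (fU ^ i * qU ^ ?j i)) - (?X i + ?Y i)"
  have M: "?M i \<in> verma_kernel (of_nat n - 1) l" if "i \<le> n" for i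
  proof -
    have "of_nat i * (of_nat n - 1 - of_nat (?j i) - of_nat i + 1) = a i"
      "l * of_nat (?j i) * (of_nat (?j i) - 1) / 2 = b i"
      unfolding singular_exponent[OF that] a_def b_def by (simp_all add: field_simps)
    then have "eU * (fU ^ i * qU ^ ?j i) - (cscal (a i) * (fU ^ (i - 1) * qU ^ ?j i)
        + cscal (b i) * (fU ^ i * qU ^ (?j i - 2))) \<in> verma_kernel (of_nat n - 1) l"
      using verma_eU_monomial[of i "?j i" "of_nat n - 1" l] by simp
    from verma_kernel_left[OF this, of "cscal (?c i)"] show ?thesis
      by (simp add: right_diff_distrib distrib_left cscal_mult mult.assoc)
  qed
  have "sum ?X {..n} + sum ?Y {..n} = (\<Sum>i<n. ?X (Suc i) + ?Y i)"
  proof -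
    have "sum ?X {..n} = (\<Sum>i<n. ?X (Suc i))" unfolding sum.atMost_shift by (simp add: a_def)
    \<comment> \<open>The factor \<open>n - i\<close> of \<open>b\<close> vanishes at
      \<open>i = n\<close>, so the combination closes up at its last summand.\<close>
    moreover have "sum ?Y {..n} = sum ?Y {..<n}"
      unfolding lessThan_Suc_atMost[symmetric] sum.lessThan_Suc by (simp add: b_def)
    ultimately show ?thesis by (simp add: sum.distrib)
  qed
  also have "\<dots> = 0"
  proof (rule sum.neutral, rule ballI)
    fix i assume "i \<in> {..<n}"
    have "?c (Suc i) * a (Suc i) + ?c i * b i
        = (of_nat (Suc i) * ?c (Suc i) - l * (2 * of_nat n + 1 - 2 * of_nat i) * ?c i) * (of_nat i - of_nat n)"
      by (simp add: a_def b_def algebra_simps)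
    then have "?c (Suc i) * a (Suc i) + ?c i * b i = 0" unfolding singular_coeff_Suc by simp
    moreover have "?X (Suc i) + ?Y i
        = cscal (?c (Suc i) * a (Suc i) + ?c i * b i) * (fU ^ i * qU ^ (?j i - 2))"
      by (simp add: cscal_add distrib_right)
    ultimately show "?X (Suc i) + ?Y i = 0" by simp
  qed
  finally have "sum ?M {..n} = eU * singular n l"
    unfolding singular_def sum_subtractf sum.distrib sum_distrib_left
    by (simp add: cscal_left_commute[of eU])
  moreover have "sum ?M {..n} \<in> verma_kernel (of_nat n - 1) l"
    by (intro verma_kernel_sum M) simp
  ultimately show ?thesis by simp
qed

definition ladder_numerator :: "nat \<Rightarrow> schr uea" where
  "ladder_numerator k = fU * eU - cscal (of_nat k) * (hU + cscal (of_nat k + 1))"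

text \<open>With \<open>e w = 0\<close> and \<open>h w = (-n - 2) w\<close> the numerator acts on
  \<open>w\<close> by \<open>-k (-n - 2 + k + 1) = k (n + 1 - k)\<close>.\<close>

lemma ladder_numerator_singular:
  "ladder_numerator k * (cscal c * singular n l)
     - cscal (c * (of_nat k * (of_nat n + 1 - of_nat k))) * singular n l \<in> verma_kernel (of_nat n - 1) l"
proof -
  define w C K where "w = singular n l" and "C = (cscal c :: schr uea)" and "K = (cscal (of_nat k) :: schr uea)"
  define D where "D = (cscal (- of_nat n - 2) :: schr uea)"
  have comm: "fU * C = C * fU" "eU * C = C * eU" "hU * C = C * hU" "K * C = C * K"
    unfolding C_def by (simp_all only: cscal_commute)
  have "of_nat n + 1 - of_nat k = - (- of_nat n - 2) - of_nat k - (1 :: complex)" by simp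
  then have D: "(cscal (of_nat n + 1 - of_nat k) :: schr uea) = - D - K - 1"
    by (simp only: cscal_diff cscal_uminus cscal_one D_def K_def)
  have "ladder_numerator k * (C * w) - C * (K * (- D - K - 1)) * w
      = C * (fU * (eU * w)) - C * (K * (hU * w - D * w))"
    unfolding ladder_numerator_def cscal_add cscal_one K_def[symmetric]
    by (simp add: algebra_simps comm comm[THEN mult_rewrite_assoc])
  also have "\<dots> \<in> verma_kernel (of_nat n - 1) l"
    unfolding w_def D_def by (intro verma_kernel_diff verma_kernel_left hU_singular eU_singular)
  finally show ?thesis unfolding w_def[symmetric] cscal_mult D by (simp only: C_def K_def)
qed

lemma tens_zero_right:
  assumes "abelian_group N"
  shows "tens R N m \<zero>\<^bsub>N\<^esub> = \<zero>\<^bsub>tensor_product L R N\<^esub>"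
proof -
  interpret abelian_group N by fact
  have "frag_of (m, \<zero>\<^bsub>N\<^esub> \<oplus>\<^bsub>N\<^esub> \<zero>\<^bsub>N\<^esub>) - frag_of (m, \<zero>\<^bsub>N\<^esub>) - frag_of (m, \<zero>\<^bsub>N\<^esub>) \<in> tensor_rels R N"
    by (rule tensor_rels_generators) simp_all
  from tensor_rels_closed(3)[OF tensor_rels_closed(1) this] show ?thesis by (simp add: tens_zero_iff)
qed

abbreviation sf_verma ::
    "complex \<Rightarrow> complex \<Rightarrow> (schr uea, (sf \<times> (schr uea \<times> complex \<Rightarrow>\<^sub>0 int) set \<Rightarrow>\<^sub>0 int) set) module" where
  "sf_verma l1 l2 \<equiv> tensor_product sf_left sf_right (verma l1 l2)"

lemma left_module_sf_verma: "left_module (sf_verma l1 l2)"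
  by (rule left_module_tensor_product[OF bimodule_sf])

definition ladder_vec :: "nat \<Rightarrow> complex \<Rightarrow> nat \<Rightarrow> complex \<Rightarrow> (sf \<times> (schr uea \<times> complex \<Rightarrow>\<^sub>0 int) set \<Rightarrow>\<^sub>0 int) set" where
  "ladder_vec n l k c = tens sf_right (verma (of_nat n - 1) l) (abs_sf (lfrac k 1))
     (verma_vec (of_nat n - 1) l (cscal c * singular n l) 1)"

lemma ladder_vec_closed: "ladder_vec n l k c \<in> carrier (sf_verma (of_nat n - 1) l)"
  unfolding ladder_vec_def by (rule tens_closed[OF verma_vec_closed])

lemma eU_ladder_vec:
  "eU \<odot>\<^bsub>sf_verma (of_nat n - 1) l\<^esub> ladder_vec n l k c
     = ladder_vec n l (Suc k) (c * (of_nat k * (of_nat n + 1 - of_nat k)))"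
proof -
  have "lfrac 0 eU * lfrac k 1 = lfrac (Suc k) (ladder_numerator k)"
    using frac_mult[OF fU_power_eU, of 0 k 1] by (simp add: ladder_numerator_def)
  also have "\<dots> = lfrac (Suc k) 1 * lfrac 0 (ladder_numerator k)"
    using frac_mult[of 0 1 1 0 "Suc k" "ladder_numerator k"] by simp
  finally have "sf_left eU (abs_sf (lfrac k 1)) = sf_right (abs_sf (lfrac (Suc k) 1)) (ladder_numerator k)"
    by (simp add: sf_left.abs_eq sf_right.abs_eq)
  then show ?thesis
    unfolding ladder_vec_def tens_smult[OF bimodule_sf]
    by (simp add: tens_balanced[OF verma_vec_closed] verma_smult verma_vec_cong[OF ladder_numerator_singular])
qed

text \<open>Each \<open>e\<close> raises the power of \<open>f^-1\<close> by one with factor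
  \<open>k (n + 1 - k)\<close>, which is zero at \<open>k = n + 1\<close>. The start
  \<open>f^-1 \<otimes> w\<close> has weight \<open>-n\<close>, the lowest weight of the
  \<open>(n+1)\<close>-dimensional module.\<close>

lemma ladder_vec_e_nilpotent:
  "eU ^ Suc n \<odot>\<^bsub>sf_verma (of_nat n - 1) l\<^esub> ladder_vec n l 1 1 = \<zero>\<^bsub>sf_verma (of_nat n - 1) l\<^esub>"
proof -
  let ?T = "sf_verma (of_nat n - 1) l"
  interpret left_module ?T by (rule left_module_sf_verma)
  have "\<exists>c. eU ^ m \<odot>\<^bsub>?T\<^esub> ladder_vec n l 1 1 = ladder_vec n l (Suc m) c" for m
  proof (induction m)
    case 0
    then show ?case using smult_one[OF ladder_vec_closed] by auto
  next
    case (Suc m)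
    then show ?case using smult_mult[OF ladder_vec_closed, of eU "eU ^ m"] eU_ladder_vec by auto
  qed
  then obtain c where c: "eU ^ n \<odot>\<^bsub>?T\<^esub> ladder_vec n l 1 1 = ladder_vec n l (Suc n) c" by blast
  have "eU ^ Suc n \<odot>\<^bsub>?T\<^esub> ladder_vec n l 1 1 = eU \<odot>\<^bsub>?T\<^esub> ladder_vec n l (Suc n) c"
    unfolding power_Suc smult_mult[OF ladder_vec_closed] c ..
  also have "\<dots> = ladder_vec n l (Suc (Suc n)) 0" unfolding eU_ladder_vec by (simp add: add.commute)
  also have "\<dots> = \<zero>\<^bsub>?T\<^esub>"
  proof -
    have "0 \<in> verma_kernel (of_nat n - 1) l"
      using verma_kernel_left[OF verma_kernel_generators(1), of 0] by simp
    then have "verma_vec (of_nat n - 1) l 0 1 = \<zero>\<^bsub>verma (of_nat n - 1) l\<^esub>" by (simp add: verma_kernel_def)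
    then show ?thesis
      unfolding ladder_vec_def
      by (simp add: tens_zero_right[OF left_module.axioms(1)[OF left_module_verma]])
  qed
  finally show ?thesis .
qed

lemma model_act_sum: "model_act l1 l2 (sum g S) \<phi> i j = (\<Sum>k\<in>S. model_act l1 l2 (g k) \<phi> i j)"
  using model_act_simps(2)[of l1 l2 0 \<phi> i j]
  by (induction S rule: infinite_finite_induct) (simp_all add: model_act_simps(4))

lemma model_act_qU_power: "model_act l1 l2 (qU ^ k) \<phi> i j = \<phi> i (j - int k)"
proof (induction k arbitrary: j)
  case (Suc k)
  have "model_act l1 l2 (qU ^ Suc k) \<phi> i j = model_act l1 l2 (qU ^ k) \<phi> i (j - 1)"
    unfolding power_Suc model_act_simps by (simp add: model_op.rep_eq sQ_def)
  then show ?case using Suc by (simp add: algebra_simps)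
qed (simp add: model_act_simps)

lemma model_act_scale: "model_act l1 l2 (cscal c * u) \<phi> i j = c * model_act l1 l2 u \<phi> i j"
  by (simp add: model_act_simps)

text \<open>Row \<open>-1\<close> of \<open>f^-1 w\<close> is row \<open>0\<close> of
  \<open>w\<close>, whose entry in column \<open>2n + 1\<close> is the leading coefficient
  \<open>1\<close>.\<close>

lemma ladder_vec_nonzero: "ladder_vec n l 1 1 \<noteq> \<zero>\<^bsub>sf_verma (of_nat n - 1) l\<^esub>"
proof -
  let ?j = "2 * int n + 1"
  have "model_act (of_nat n - 1) l (singular n l) model_vac 0 ?j = (\<Sum>i\<le>n. if i = 0 then 1 else 0)"
    unfolding singular_def model_act_sum model_act_scale model_act_fU_power model_act_qU_power
    by (intro sum.cong refl) (auto simp: model_vac_def singular_coeff_def)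
  then have "sf_pairing (of_nat n - 1) l ?j (abs_sf (lfrac 1 1)) (verma_vec (of_nat n - 1) l (cscal 1 * singular n l) 1) \<noteq> 0"
    unfolding sf_pairing_abs[OF verma_vec_closed] loc_act_frac verma_coeffs_vec
    by (simp add: model_act_simps cscal_one)
  from tens_nonzero[OF balanced_sf_pairing this] show ?thesis unfolding ladder_vec_def .
qed

section \<open>Vectors killed by a power of \<open>e\<close>\<close>

lemma e_ore_step:
  fixes e v :: "'a::ring_1"
  assumes "\<And>k. \<exists>m w. e ^ m * (e * v - v * e) = w * e ^ k"
  shows "\<exists>m w. e ^ m * v = w * e ^ k"
proof (induction k)
  case 0
  show ?case by (intro exI[of _ 0] exI[of _ v]) simp
next
  case (Suc k)
  then obtain m w where w: "e ^ m * v = w * e ^ k" by blast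
  obtain m' w' where w': "e ^ m' * (e * v - v * e) = w' * e ^ Suc k" using assms by blast
  have pow: "e ^ a * (e ^ b * x) = e ^ b * (e ^ a * x)" for a b x
    by (simp only: mult.assoc[symmetric] power_add[symmetric] add.commute)
  have "e ^ (m' + m + 1) * v = e ^ m' * (e ^ m * (v * e + (e * v - v * e)))"
    unfolding power_add power_one_right mult.assoc by (simp only: add_diff_cancel_left' add.commute[of "v * e"] diff_add_cancel)
  also have "\<dots> = e ^ m' * ((e ^ m * v) * e) + e ^ m * (e ^ m' * (e * v - v * e))"
    by (simp only: distrib_left pow[of m'] mult.assoc)
  also have "\<dots> = (e ^ m' * w + e ^ m * w') * e ^ Suc k"
    unfolding w w' by (simp only: distrib_right mult.assoc power_Suc2)
  finally show ?case by blast
qed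

text \<open>Rests on \<open>ad e\<close> being nilpotent on the Lie algebra, with cube zero. It
  makes the set of vectors killed by some power of \<open>e\<close> stable under
  \<open>U\<close>.\<close>

lemma e_ore_condition: "\<exists>m w. eU ^ m * u = w * eU ^ k"
proof (induction u arbitrary: k rule: uea_gen_induct)
  case (scal c)
  show ?case by (intro exI[of _ k] exI[of _ "cscal c"]) (simp add: cscal_commute)
next
  case (gen x)
  have step: "\<exists>m w. eU ^ m * uea_gen y = w * eU ^ k"
    if "\<And>k. \<exists>m w. eU ^ m * uea_gen (lbr sE y) = w * eU ^ k" for y k
  proof (rule e_ore_step)
    have "eU * uea_gen y - uea_gen y * eU = uea_gen (lbr sE y)" by (simp add: uea_gen_commute[of sE y])
    then show "\<exists>m w. eU ^ m * (eU * uea_gen y - uea_gen y * eU) = w * eU ^ k" for k by (simp only: that)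
  qed
  have "lbr sE (lbr sE (lbr sE x)) = 0" by (simp add: schr_defs)
  then have "\<exists>m w. eU ^ m * uea_gen (lbr sE (lbr sE (lbr sE x))) = w * eU ^ k" for k
    by (intro exI[of _ 0]) (simp add: uea_gen_zero)
  then show ?case by (rule step[OF step[OF step]])
next
  case (add u v)
  then obtain m w m' w' where w: "eU ^ m * u = w * eU ^ k" "eU ^ m' * v = w' * eU ^ k" by blast
  have "eU ^ (m + m') * (u + v) = eU ^ (m' + m) * u + eU ^ (m + m') * v"
    by (simp only: distrib_left add.commute[of m m'])
  also have "\<dots> = (eU ^ m' * w + eU ^ m * w') * eU ^ k"
    unfolding power_add by (simp only: mult.assoc w distrib_right)
  finally show ?case by blast
next
  case (mult u v)
  obtain m w where w: "eU ^ m * v = w * eU ^ k" using mult(2) by blast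
  obtain m' w' where w': "eU ^ m' * u = w' * eU ^ m" using mult(1) by blast
  have "eU ^ m' * (u * v) = w' * w * eU ^ k" by (simp only: mult.assoc[symmetric] w') (simp only: mult.assoc w)
  then show ?case by blast
qed

context left_module
begin

lemma e_nilpotent_part_stable:
  assumes "x \<in> carrier M" "d ^ m \<odot> x = \<zero>" "d ^ m' * r = w * d ^ m"
  shows "d ^ m' \<odot> (r \<odot> x) = \<zero>"
  using smult_mult[OF assms(1), of "d ^ m'" r] smult_mult[OF assms(1), of w "d ^ m"] assms(2,3)
  by (simp add: smult_zero_right)

end

lemma e_power_in_poly_e: "eU ^ k \<in> poly_e"
proof -
  have "(\<Sum>i<Suc k. cscal (if i = k then 1 else 0) * eU ^ i) = (\<Sum>i\<in>{k}. eU ^ i)"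
    by (rule sum.mono_neutral_cong_right) (auto simp: cscal_one)
  then show ?thesis unfolding poly_e_def mem_Collect_eq
    by (intro exI[of _ "Suc k"] exI[of _ "\<lambda>i. if i = k then 1 else 0"]) simp
qed

lemma e_nilpotent_finite_dim:
  assumes M: "left_module M" and x: "x \<in> carrier M" "eU ^ m \<odot>\<^bsub>M\<^esub> x = \<zero>\<^bsub>M\<^esub>"
  shows "finite_dim M ((\<lambda>u. u \<odot>\<^bsub>M\<^esub> x) ` poly_e)"
proof -
  interpret left_module M by fact
  let ?B = "(\<lambda>k. eU ^ k \<odot>\<^bsub>M\<^esub> x) ` {..<m}"
  have nil: "eU ^ k \<odot>\<^bsub>M\<^esub> x = \<zero>\<^bsub>M\<^esub>" if "m \<le> k" for k
  proof -
    have "eU ^ k = eU ^ (k - m) * eU ^ m" using that by (simp flip: power_add)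
    then show ?thesis using smult_mult[OF x(1)] x(2) by (simp add: smult_zero_right)
  qed
  have "u \<odot>\<^bsub>M\<^esub> x \<in> cspan M ?B" if "u \<in> poly_e" for u
    unfolding cspan_def
  proof (rule InterI, elim CollectE conjE)
    fix W assume W: "?B \<subseteq> W" "W \<subseteq> carrier M" "\<zero>\<^bsub>M\<^esub> \<in> W" "\<forall>x\<in>W. \<forall>y\<in>W. x \<oplus>\<^bsub>M\<^esub> y \<in> W"
      "\<forall>c. \<forall>x\<in>W. cscal c \<odot>\<^bsub>M\<^esub> x \<in> W"
    have pow: "eU ^ k \<odot>\<^bsub>M\<^esub> x \<in> W" for k
      using W(1,3) nil[of k] by (cases "k < m") auto
    obtain N c where u: "u = (\<Sum>k<N. cscal (c k) * eU ^ k)" using \<open>u \<in> poly_e\<close> by (auto simp: poly_e_def)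
    have "(\<Sum>k<K. cscal (c k) * eU ^ k) \<odot>\<^bsub>M\<^esub> x \<in> W" for K
    proof (induction K)
      case 0
      show ?case using W(3) smult_zero_left[OF x(1)] by simp
    next
      case (Suc K)
      then show ?case using W(4,5) pow by (simp add: smult_add_left smult_mult x(1))
    qed
    then show "u \<odot>\<^bsub>M\<^esub> x \<in> W" unfolding u .
  qed
  moreover have "?B \<subseteq> (\<lambda>u. u \<odot>\<^bsub>M\<^esub> x) ` poly_e" using e_power_in_poly_e by blast
  ultimately show ?thesis unfolding finite_dim_def by (intro exI[of _ ?B]) auto
qed

section \<open>Comparison of the annihilators\<close>

lemma lfrac_central:
  assumes c: "\<And>u. u * c = c * u"
  shows "lfrac 0 c * x = x * lfrac 0 c"
proof (cases x)
  case (1 k u)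
  show ?thesis unfolding 1 using frac_mult[of k c c k 0 u] frac_mult[of 0 u u 0 k c] c[of "fU ^ k"] c[of u] by simp
qed

text \<open>A central element commutes with all fractions, so it crosses the tensor sign and acts on
  the Verma factor.\<close>

lemma central_annihilator_sf_verma:
  assumes c: "\<And>u. u * c = c * u" and ann: "c \<in> annihilator (verma l1 l2)"
  shows "c \<in> annihilator (sf_verma l1 l2)"
proof (rule tensor_annihilatorI[OF bimodule_sf])
  fix s A assume A: "A \<in> carrier (verma l1 l2)"
  obtain x where x: "s = abs_sf x" by (rule sf_cases)
  have "sf_left c s = sf_right s c"
    unfolding x sf_left.abs_eq sf_right.abs_eq lfrac_central[OF c] ..
  moreover have "c \<odot>\<^bsub>verma l1 l2\<^esub> A = \<zero>\<^bsub>verma l1 l2\<^esub>" using ann A by (simp add: annihilator_def)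
  ultimately show "c \<odot>\<^bsub>sf_verma l1 l2\<^esub> tens sf_right (verma l1 l2) s A = \<zero>\<^bsub>sf_verma l1 l2\<^esub>"
    by (simp add: tens_smult[OF bimodule_sf] tens_balanced[OF A]
        tens_zero_right[OF left_module.axioms(1)[OF left_module_verma]])
qed

lemma schr_ideal_annihilates:
  assumes "(2 * l1 + 3)\<^sup>2 = (2 * of_nat n + 1)\<^sup>2"
  shows "schr_ideal n l2 \<subseteq> annihilator (verma l1 l2)" "schr_ideal n l2 \<subseteq> annihilator (sf_verma l1 l2)"
proof -
  note central = central_diff_cscal[OF zU_commute] central_diff_cscal[OF bC_commute]
  have ann: "zU - cscal l2 \<in> annihilator (verma l1 l2)"
    "bC - cscal (casimir_value n l2) \<in> annihilator (verma l1 l2)"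
    by (rule verma_kernel_central[OF central(1) verma_kernel_generators(4)],
        rule verma_kernel_central[OF central(2) verma_kernel_casimir[OF assms]])
  show "schr_ideal n l2 \<subseteq> annihilator (verma l1 l2)"
    by (rule schr_ideal_subsetI[OF left_module.two_sided_annihilator[OF left_module_verma] ann])
  show "schr_ideal n l2 \<subseteq> annihilator (sf_verma l1 l2)"
    by (rule schr_ideal_subsetI[OF left_module.two_sided_annihilator[OF left_module_sf_verma]
          central_annihilator_sf_verma[OF central(1) ann(1)]
          central_annihilator_sf_verma[OF central(2) ann(2)]])
qed

lemma annihilator_verma:
  assumes "l2 \<noteq> 0" "(2 * l1 + 3)\<^sup>2 = (2 * of_nat n + 1)\<^sup>2"
  shows "annihilator (verma l1 l2) = schr_ideal n l2"
  by (rule schr_ideal_maximal[OF assms(1) left_module.two_sided_annihilator[OF left_module_verma]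
        schr_ideal_annihilates(1)[OF assms(2)] one_notin_annihilator_verma])

text \<open>The annihilator is squeezed between \<open>I\<close> and the ideal \<open>J\<close>
  killing the vectors \<open>X\<close> on which some power of \<open>e\<close> vanishes. Since
  \<open>X\<close> lies in the completion, is stable under \<open>U\<close> and contains a nonzero
  vector, \<open>J\<close> is a proper two-sided ideal, and maximality gives \<open>J = I\<close>.
  Stability of the full \<open>e\<close>-finite part is thereby bypassed.\<close>

lemma annihilator_V_module:
  assumes l: "l2 \<noteq> 0"
  shows "annihilator (V_module n l2) = schr_ideal n l2"
proof
  let ?T = "sf_verma (of_nat n - 1) l2" and ?V = "V_module n l2"
  interpret left_module ?T by (rule left_module_sf_verma)
  define X where "X = {x \<in> carrier ?T. \<exists>m. eU ^ m \<odot>\<^bsub>?T\<^esub> x = \<zero>\<^bsub>?T\<^esub>}"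
  define J where "J = {r. \<forall>x\<in>X. r \<odot>\<^bsub>?T\<^esub> x = \<zero>\<^bsub>?T\<^esub>}"
  have V: "carrier ?V = {x \<in> carrier ?T. finite_dim ?T ((\<lambda>u. u \<odot>\<^bsub>?T\<^esub> x) ` poly_e)}"
    "\<zero>\<^bsub>?V\<^esub> = \<zero>\<^bsub>?T\<^esub>" "r \<odot>\<^bsub>?V\<^esub> x = r \<odot>\<^bsub>?T\<^esub> x" for r x
    by (simp_all add: V_module_def EA_def Let_def)
  have eq: "(2 * (of_nat n - 1) + 3)\<^sup>2 = (2 * of_nat n + 1 :: complex)\<^sup>2" by (simp add: add.commute)
  have "r \<odot>\<^bsub>?T\<^esub> x \<in> X" if x: "x \<in> X" for r x
  proof -
    obtain m where m: "x \<in> carrier ?T" "eU ^ m \<odot>\<^bsub>?T\<^esub> x = \<zero>\<^bsub>?T\<^esub>" using x by (auto simp: X_def)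
    obtain m' w where "eU ^ m' * r = w * eU ^ m" using e_ore_condition by blast
    from e_nilpotent_part_stable[OF m this] smult_closed[OF m(1)] show ?thesis by (auto simp: X_def)
  qed
  then have J: "two_sided_ideal J"
    unfolding J_def by (intro two_sided_ideal_kill) (auto simp: X_def)
  show sub: "schr_ideal n l2 \<subseteq> annihilator ?V"
    using schr_ideal_annihilates(2)[OF eq, of l2] by (auto simp: annihilator_def V)
  have "X \<subseteq> carrier ?V"
    unfolding V using e_nilpotent_finite_dim[OF left_module_sf_verma] by (auto simp: X_def)
  then have le: "annihilator ?V \<subseteq> J" by (auto simp: annihilator_def J_def V(2,3))
  have "ladder_vec n l2 1 1 \<in> X"
    unfolding X_def using ladder_vec_closed ladder_vec_e_nilpotent by blast
  then have "1 \<notin> J"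
    using smult_one[OF ladder_vec_closed] ladder_vec_nonzero unfolding J_def by fastforce
  then have "J = schr_ideal n l2" using schr_ideal_maximal[OF l J] sub le by blast
  then show "annihilator ?V \<subseteq> schr_ideal n l2" using le by simp
qed

theorem corollary57:
  fixes n :: nat and l2 :: complex
  assumes "l2 \<noteq> 0"
  shows "annihilator (V_module n l2) = annihilator (verma (of_nat n - 1) l2)
       \<and> annihilator (verma (of_nat n - 1) l2) = annihilator (verma (- of_nat n - 2) l2)
       \<and> centrally_generated (annihilator (V_module n l2))
       \<and> centrally_generated (annihilator (verma (of_nat n - 1) l2))
       \<and> centrally_generated (annihilator (verma (- of_nat n - 2) l2))"
proof -
  \<comment> \<open>Here \<open>2 * l1 + 3\<close> is \<open>2n + 1\<close> for
    \<open>l1 = n - 1\<close> and \<open>-(2n + 1)\<close> for \<open>l1 = -n - 2\<close>.\<close>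
  have "(2 * (of_nat n - 1) + 3)\<^sup>2 = (2 * of_nat n + 1 :: complex)\<^sup>2"
    "(2 * (- of_nat n - 2) + 3)\<^sup>2 = (2 * of_nat n + 1 :: complex)\<^sup>2"
    by (simp_all add: power2_eq_square algebra_simps)
  note verma = this[THEN annihilator_verma[OF assms]]
  show ?thesis
    unfolding annihilator_V_module[OF assms] verma by (simp add: centrally_generated_schr_ideal)
qed

end
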